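(* Let $\phi:\mathbb D\to\mathbb D$ be a parabolic inner function of positive hyperbolic step. Then for every unimodular constant $\tau$ there exists a non-constant inner function $u$ such that $u\circ\phi=\tau u$.
   Context: $\mathbb D$ is the open unit disk, $\mathbb T$ its boundary. For $n\in\mathbb N_0$, $\phi^{[n]}$ denotes the $n$-th iterate of $\phi$. The pseudo-hyperbolic distance is $\rho(z_1,z_2)=\left|\frac{z_2-z_1}{1-\overline{z_2}z_1}\right|$. A holomorphic self-map $\phi$ of $\mathbb D$ is of positive hyperbolic step if $\lim_{n\to\infty}\rho(\phi^{[n]}(z_0),\phi^{[n+1]}(z_0))>0$ for some $z_0\in\mathbb D$. A holomorphic self-map of $\mathbb D$ is parabolic if its Denjoy--Wolff point lies on $\mathbb T$ and its angular derivative there equals $1$. *)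

theory Defs
  imports "HOL-Complex_Analysis.Complex_Analysis"
begin

definition self_map_disk :: "(complex \<Rightarrow> complex) \<Rightarrow> bool" where
  "self_map_disk f \<longleftrightarrow> f holomorphic_on ball 0 1 \<and> f ` ball 0 1 \<subseteq> ball 0 1"

definition radial_limit :: "(complex \<Rightarrow> complex) \<Rightarrow> real \<Rightarrow> complex \<Rightarrow> bool" where
  "radial_limit f t l \<longleftrightarrow> ((\<lambda>r::real. f (complex_of_real r * cis t)) \<longlongrightarrow> l) (at_left 1)"

definition inner_function :: "(complex \<Rightarrow> complex) \<Rightarrow> bool" where
  "inner_function f \<longleftrightarrow> f holomorphic_on ball 0 1 \<and> (\<forall>z\<in>ball 0 1. norm (f z) \<le> 1) \<and>
     (AE t in lebesgue. t \<in> {0..2*pi} \<longrightarrow> (\<exists>l. radial_limit f t l \<and> norm l = 1))"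

definition pseudo_hyp :: "complex \<Rightarrow> complex \<Rightarrow> real" where
  "pseudo_hyp z1 z2 = norm ((z2 - z1) / (1 - cnj z2 * z1))"

definition positive_hyperbolic_step :: "(complex \<Rightarrow> complex) \<Rightarrow> bool" where
  "positive_hyperbolic_step f \<longleftrightarrow>
     (\<exists>z0\<in>ball 0 1. \<exists>L>0. (\<lambda>n. pseudo_hyp ((f ^^ n) z0) ((f ^^ Suc n) z0)) \<longlonglongrightarrow> L)"

definition stolz_angle :: "complex \<Rightarrow> real \<Rightarrow> complex set" where
  "stolz_angle w M = {z \<in> ball 0 1. norm (w - z) \<le> M * (1 - norm z)}"

definition angular_limit :: "(complex \<Rightarrow> complex) \<Rightarrow> complex \<Rightarrow> complex \<Rightarrow> bool" where
  "angular_limit g w l \<longleftrightarrow> (\<forall>M>1. (g \<longlongrightarrow> l) (at w within stolz_angle w M))"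

definition angular_derivative :: "(complex \<Rightarrow> complex) \<Rightarrow> complex \<Rightarrow> complex \<Rightarrow> bool" where
  "angular_derivative f w c \<longleftrightarrow> angular_limit f w w \<and>
     angular_limit (\<lambda>z. (f z - w) / (z - w)) w c"

definition boundary_DW_point :: "(complex \<Rightarrow> complex) \<Rightarrow> complex \<Rightarrow> bool" where
  "boundary_DW_point f w \<longleftrightarrow> norm w = 1 \<and> (\<forall>z\<in>ball 0 1. (\<lambda>n. (f ^^ n) z) \<longlonglongrightarrow> w)"

definition parabolic :: "(complex \<Rightarrow> complex) \<Rightarrow> bool" where
  "parabolic f \<longleftrightarrow> self_map_disk f \<and> (\<exists>w. boundary_DW_point f w \<and> angular_derivative f w 1)"

end

theory Submission
  imports Defs
begin

text \<open>
  Move the Denjoy--Wolff point to \<open>\<infinity>\<close> in the upper half-plane and let \<open>x\<^sub>n + i y\<^sub>n\<close> be the orbit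
  of \<open>z\<^sub>0\<close> there. After Pommerenke, the normalised iterates \<open>g\<^sub>n = (\<phi>\<^sup>n - x\<^sub>n) / y\<^sub>n\<close> subconverge to some
  \<open>g\<close> with \<open>g \<circ> \<phi> = g + b\<close>, where \<open>b \<noteq> 0\<close> is real because the hyperbolic step is positive. Then
  \<open>u = exp (i c g)\<close> satisfies \<open>u \<circ> \<phi> = exp (i c b) u\<close>, and a suitable \<open>c > 0\<close> gives the multiplier \<open>\<tau>\<close>.

  It remains to see that \<open>u\<close> is inner. In the disc, the Cayley transforms \<open>f\<^sub>n\<close> of \<open>g\<^sub>n\<close> are inner and
  decrease in modulus (Schwarz--Pick), so each \<open>f\<^sub>n\<close> divides the limit; for large \<open>n\<close> the quotient is nearly
  unimodular at one point, hence in mean, so the limit is inner. Here innerness is expressed by the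
  \<open>L\<^sup>2\<close> means \<open>\<integral> |u (r e\<^sup>i\<^sup>t)|\<^sup>2 dt \<longrightarrow> 2 \<pi>\<close>. That these imply the existence of unimodular radial limits
  follows from the weak-type estimate for the radial maximal function, applied to \<open>u - u (R \<cdot>)\<close>.
\<close>

section \<open>Means over circles and the Poisson integral\<close>

definition circ_mean :: "(complex \<Rightarrow> 'a::banach) \<Rightarrow> real \<Rightarrow> 'a" where
  "circ_mean h r = integral {0..2*pi} (\<lambda>t. h (of_real r * cis t)) /\<^sub>R (2*pi)"

abbreviation mean_square :: "(complex \<Rightarrow> complex) \<Rightarrow> real \<Rightarrow> real" where
  "mean_square f \<equiv> circ_mean (\<lambda>z. (norm (f z))\<^sup>2)"

lemma circ_mean_real: "circ_mean h r = integral {0..2*pi} (\<lambda>t. h (of_real r * cis t)) / (2*pi)"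
  for h :: "complex \<Rightarrow> real"
  unfolding circ_mean_def real_scaleR_def divide_inverse by (rule mult.commute)

lemma continuous_on_circle_param:
  assumes "continuous_on (sphere 0 \<bar>r\<bar>) h"
  shows "continuous_on S (\<lambda>t. h (of_real r * cis t))"
  by (rule continuous_on_compose2[OF assms], intro continuous_intros) (auto simp: norm_mult)

lemma integrable_circle:
  fixes h :: "complex \<Rightarrow> 'a::banach"
  assumes "continuous_on (sphere 0 \<bar>r\<bar>) h"
  shows "(\<lambda>t. h (of_real r * cis t)) integrable_on {a..b}"
  by (intro integrable_continuous_real continuous_on_circle_param assms)

lemma circ_mean_cong:
  assumes "\<And>z. norm z = \<bar>r\<bar> \<Longrightarrow> f z = g z"
  shows "circ_mean f r = circ_mean g r"
  using assms by (simp add: circ_mean_def norm_mult)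

lemma circ_mean_dilation: "circ_mean (\<lambda>z. f (of_real R * z)) r = circ_mean f (R * r)"
  by (simp add: circ_mean_def mult_ac)

lemma circ_mean_add:
  assumes "continuous_on (sphere 0 \<bar>r\<bar>) f" "continuous_on (sphere 0 \<bar>r\<bar>) g"
  shows "circ_mean (\<lambda>z. f z + g z) r = circ_mean f r + circ_mean g r"
  using assms by (simp add: circ_mean_def integral_add integrable_circle scaleR_add_right)

lemma circ_mean_diff:
  assumes "continuous_on (sphere 0 \<bar>r\<bar>) f" "continuous_on (sphere 0 \<bar>r\<bar>) g"
  shows "circ_mean (\<lambda>z. f z - g z) r = circ_mean f r - circ_mean g r"
  using assms by (simp add: circ_mean_def integral_diff integrable_circle scaleR_diff_right)

lemma circ_mean_const [simp]: "circ_mean (\<lambda>z. c) r = c"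
  by (simp add: circ_mean_def)

lemma circ_mean_one_minus:
  fixes f :: "complex \<Rightarrow> real"
  assumes "continuous_on (sphere 0 \<bar>r\<bar>) f"
  shows "circ_mean (\<lambda>z. 1 - f z) r = 1 - circ_mean f r"
  using assms by (simp add: circ_mean_diff)

lemma circ_mean_linear:
  assumes "continuous_on (sphere 0 \<bar>r\<bar>) f" "bounded_linear h"
  shows "circ_mean (\<lambda>z. h (f z)) r = h (circ_mean f r)"
proof -
  interpret bounded_linear h by fact
  show ?thesis
    using integral_linear[OF integrable_circle[OF assms(1)] assms(2)]
    by (simp add: circ_mean_def o_def scaleR)
qed

lemma circ_mean_cmult_real: "circ_mean (\<lambda>z. c * f z) r = c * circ_mean f r" for c :: real
  by (simp add: circ_mean_def)

lemma circ_mean_mono: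
  fixes f g :: "complex \<Rightarrow> real"
  assumes "continuous_on (sphere 0 \<bar>r\<bar>) f" "continuous_on (sphere 0 \<bar>r\<bar>) g"
    and "\<And>z. norm z = \<bar>r\<bar> \<Longrightarrow> f z \<le> g z"
  shows "circ_mean f r \<le> circ_mean g r"
proof -
  have "integral {0..2*pi} (\<lambda>t. f (of_real r * cis t)) \<le> integral {0..2*pi} (\<lambda>t. g (of_real r * cis t))"
    by (intro integral_le integrable_circle assms) (auto simp: norm_mult)
  then show ?thesis
    by (simp add: circ_mean_def divide_simps)
qed

lemma circ_mean_nonneg:
  fixes f :: "complex \<Rightarrow> real"
  assumes "continuous_on (sphere 0 \<bar>r\<bar>) f" "\<And>z. norm z = \<bar>r\<bar> \<Longrightarrow> 0 \<le> f z"
  shows "0 \<le> circ_mean f r"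
  using circ_mean_mono[of r "\<lambda>_. 0" f] assms by simp

lemma circ_mean_swap:
  fixes k :: "complex \<Rightarrow> complex \<Rightarrow> real"
  assumes "continuous_on (sphere 0 \<bar>r\<bar> \<times> sphere 0 \<bar>s\<bar>) (\<lambda>(x, y). k x y)"
  shows "circ_mean (\<lambda>x. circ_mean (\<lambda>y. k x y) s) r = circ_mean (\<lambda>y. circ_mean (\<lambda>x. k x y) r) s"
proof -
  have "continuous_on (cbox (0,0) (2*pi,2*pi))
      (\<lambda>p. (\<lambda>(x, y). k x y) ((\<lambda>p. (of_real r * cis (fst p), of_real s * cis (snd p))) p))"
    by (rule continuous_on_compose2[OF assms], intro continuous_intros) (auto simp: norm_mult)
  then have "continuous_on (cbox (0,0) (2*pi,2*pi)) (\<lambda>(x,y). k (of_real r * cis x) (of_real s * cis y))"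
    by (simp add: case_prod_unfold)
  from integral_swap_continuous[OF this] show ?thesis
    by (simp add: circ_mean_def)
qed

lemma circ_mean_eqI_contour:
  assumes "0 < r" "(f has_contour_integral 2 * of_real pi * \<i> * I) (circlepath 0 r)"
    and "\<And>z. norm z = r \<Longrightarrow> g z = f z * z"
  shows "circ_mean g r = I"
proof -
  have "((\<lambda>t. f (0 + of_real r * cis t) * r * \<i> * cis t) has_integral 2 * of_real pi * \<i> * I) {0..2*pi}"
    using assms(2) unfolding circlepath_def
    by (subst (asm) has_contour_integral_part_circlepath_iff) (auto simp: algebra_simps)
  then have "((\<lambda>t. f (0 + of_real r * cis t) * r * \<i> * cis t * (-\<i>))
      has_integral 2 * of_real pi * \<i> * I * (-\<i>)) {0..2*pi}"
    by (rule has_integral_mult_left)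
  then have "((\<lambda>t. g (of_real r * cis t)) has_integral 2 * of_real pi * I) {0..2*pi}"
    by (rule has_integral_eq_rhs[OF has_integral_eq, rotated])
       (use assms(1,3) in \<open>auto simp: norm_mult mult_ac\<close>)
  then show ?thesis
    by (simp add: circ_mean_def integral_unique scaleR_conv_of_real)
qed

lemma circlepath_segment_subset_annulus:
  assumes "0 \<le> a" "a < r" "r \<le> s" "s < b"
  shows "closed_segment (circlepath 0 s t) (circlepath 0 r t) \<subseteq> ball 0 b - cball 0 a"
proof
  fix x assume "x \<in> closed_segment (circlepath 0 s t) (circlepath 0 r t)"
  then obtain l where l: "0 \<le> l" "l \<le> 1" and x: "x = (1 - l) *\<^sub>R circlepath 0 s t + l *\<^sub>R circlepath 0 r t"
    by (auto simp: closed_segment_def)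
  have "x = of_real ((1 - l) * s + l * r) * exp (2 * of_real pi * \<i> * of_real t)"
    unfolding x circlepath by (simp add: scaleR_conv_of_real algebra_simps)
  then have "norm x = \<bar>(1 - l) * s + l * r\<bar>"
    by (simp only: norm_mult norm_of_real) simp
  moreover have "r \<le> (1 - l) * s + l * r" "(1 - l) * s + l * r \<le> s"
    using l assms mult_left_mono[of r s l] mult_left_mono[of r s "1 - l"] by (auto simp: algebra_simps)
  ultimately show "x \<in> ball 0 b - cball 0 a" using assms by auto
qed

lemma circ_mean_annulus:
  assumes "f holomorphic_on ball 0 b - cball 0 a" and "0 \<le> a" "a < r" "r \<le> s" "s < b"
  shows "circ_mean f s = circ_mean f r"
proof -
  define A where "A = ball (0::complex) b - cball 0 a"
  define G where "G z = f z / z" for z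
  have open_A: "open A" by (auto simp: A_def)
  have G: "G holomorphic_on A"
    unfolding G_def A_def using assms by (intro holomorphic_intros) auto
  have "circ_mean f \<rho> = contour_integral (circlepath 0 \<rho>) G / (2 * of_real pi * \<i>)" if "a < \<rho>" "\<rho> < b" for \<rho>
  proof (rule circ_mean_eqI_contour)
    have "(G has_contour_integral contour_integral (circlepath 0 \<rho>) G) (circlepath 0 \<rho>)"
      using that assms(2) open_A G
      by (intro has_contour_integral_integral contour_integrable_holomorphic_simple[of _ A])
         (auto simp: A_def)
    then show "(G has_contour_integral 2 * of_real pi * \<i> *
        (contour_integral (circlepath 0 \<rho>) G / (2 * of_real pi * \<i>))) (circlepath 0 \<rho>)"
      by simp
  qed (use that assms(2) in \<open>auto simp: G_def\<close>)
  moreover have "contour_integral (circlepath 0 s) G = contour_integral (circlepath 0 r) G"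
  proof (rule Cauchy_theorem_homotopic_loops[OF _ open_A G])
    show "homotopic_loops A (circlepath 0 s) (circlepath 0 r)"
      unfolding A_def using assms by (intro homotopic_loops_linear circlepath_segment_subset_annulus) auto
  qed auto
  ultimately show ?thesis using assms by simp
qed

definition poisson_kernel :: "complex \<Rightarrow> complex \<Rightarrow> real" where
  "poisson_kernel \<zeta> w = ((norm \<zeta>)\<^sup>2 - (norm w)\<^sup>2) / (norm (\<zeta> - w))\<^sup>2"

lemma poisson_kernel_eq_Re:
  assumes "\<zeta> \<noteq> w"
  shows "poisson_kernel \<zeta> w = Re ((\<zeta> + w) / (\<zeta> - w))"
proof -
  have "(\<zeta> + w) / (\<zeta> - w) = (\<zeta> + w) * cnj (\<zeta> - w) / of_real ((norm (\<zeta> - w))\<^sup>2)"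
    using assms by (simp only: complex_norm_square) (simp add: divide_simps)
  then have "Re ((\<zeta> + w) / (\<zeta> - w)) = Re ((\<zeta> + w) * cnj (\<zeta> - w)) / (norm (\<zeta> - w))\<^sup>2"
    by (metis Re_divide_of_real)
  also have "Re ((\<zeta> + w) * cnj (\<zeta> - w)) = (norm \<zeta>)\<^sup>2 - (norm w)\<^sup>2"
    unfolding cmod_power2 by (simp add: algebra_simps power2_eq_square)
  finally show ?thesis by (simp add: poisson_kernel_def)
qed

lemma poisson_kernel_nonneg: "norm w \<le> norm \<zeta> \<Longrightarrow> 0 \<le> poisson_kernel \<zeta> w"
  by (simp add: poisson_kernel_def power_mono)

lemma poisson_kernel_le:
  assumes "norm w < norm \<zeta>"
  shows "poisson_kernel \<zeta> w \<le> (norm \<zeta> + norm w) / (norm \<zeta> - norm w)"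
proof -
  have "(norm \<zeta> - norm w)\<^sup>2 \<le> (norm (\<zeta> - w))\<^sup>2"
    using assms by (intro power_mono) (auto simp: norm_triangle_ineq2)
  then have "poisson_kernel \<zeta> w \<le> ((norm \<zeta>)\<^sup>2 - (norm w)\<^sup>2) / (norm \<zeta> - norm w)\<^sup>2"
    unfolding poisson_kernel_def using assms
    by (intro divide_left_mono mult_pos_pos zero_less_power) (auto simp: power_mono)
  also have "\<dots> = (norm \<zeta> + norm w) / (norm \<zeta> - norm w)"
    using assms by (simp add: power2_eq_square square_diff_square_factored)
  finally show ?thesis .
qed

lemma poisson_kernel_ge:
  assumes "norm w < norm \<zeta>"
  shows "(norm \<zeta> - norm w) / (norm \<zeta> + norm w) \<le> poisson_kernel \<zeta> w"
proof -
  have "(norm (\<zeta> - w))\<^sup>2 \<le> (norm \<zeta> + norm w)\<^sup>2"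
    by (intro power_mono) (auto simp: norm_triangle_ineq4)
  moreover have "norm (\<zeta> - w) > 0" "norm \<zeta> + norm w > 0"
    using assms norm_ge_zero[of w] by (auto simp del: norm_ge_zero)
  ultimately have "((norm \<zeta>)\<^sup>2 - (norm w)\<^sup>2) / (norm \<zeta> + norm w)\<^sup>2 \<le> poisson_kernel \<zeta> w"
    unfolding poisson_kernel_def using assms by (intro divide_left_mono) (auto simp: power_mono)
  moreover have "((norm \<zeta>)\<^sup>2 - (norm w)\<^sup>2) / (norm \<zeta> + norm w)\<^sup>2 = (norm \<zeta> - norm w) / (norm \<zeta> + norm w)"
    using \<open>norm \<zeta> + norm w > 0\<close> by (simp add: power2_eq_square square_diff_square_factored)
  ultimately show ?thesis by simp
qed

lemma continuous_on_poisson_kernel [continuous_intros]: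
  assumes "continuous_on S f" "continuous_on S g" "\<And>x. x \<in> S \<Longrightarrow> f x \<noteq> g x"
  shows "continuous_on S (\<lambda>x. poisson_kernel (f x) (g x))"
  unfolding poisson_kernel_def using assms by (intro continuous_intros) auto

definition poisson_integral :: "real \<Rightarrow> (complex \<Rightarrow> 'a::banach) \<Rightarrow> complex \<Rightarrow> 'a" where
  "poisson_integral s g w = circ_mean (\<lambda>\<zeta>. poisson_kernel \<zeta> w *\<^sub>R g \<zeta>) s"

lemma continuous_on_poisson_integrand:
  fixes g :: "complex \<Rightarrow> 'a::real_normed_vector"
  assumes "norm w < s" "continuous_on (sphere 0 s) g"
  shows "continuous_on (sphere 0 \<bar>s\<bar>) (\<lambda>\<zeta>. poisson_kernel \<zeta> w *\<^sub>R g \<zeta>)"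
proof -
  have "0 < s" using assms(1) norm_ge_zero[of w] by linarith
  then show ?thesis using assms by (intro continuous_intros) auto
qed

text \<open>Cauchy's formula at \<open>w\<close> for \<open>z \<mapsto> f z * (s\<^sup>2 - |w|\<^sup>2) / (s\<^sup>2 - cnj w * z)\<close>, whose value at \<open>w\<close> is \<open>f w\<close>.\<close>
lemma poisson_integral_holomorphic:
  assumes f: "continuous_on (cball 0 s) f" "f holomorphic_on ball 0 s" and w: "norm w < s"
  shows "poisson_integral s f w = f w"
proof -
  define h where "h z = f z * of_real (s\<^sup>2 - (norm w)\<^sup>2) / (of_real (s\<^sup>2) - cnj w * z)" for z
  have s: "0 < s" using w norm_ge_zero[of w] by linarith
  have denominator_nonzero: "of_real (s\<^sup>2) - cnj w * z \<noteq> 0" if "norm z \<le> s" for z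
  proof
    assume "of_real (s\<^sup>2) - cnj w * z = 0"
    then have "s\<^sup>2 = norm w * norm z"
      by (metis abs_of_nonneg complex_mod_cnj eq_iff_diff_eq_0 norm_mult norm_of_real zero_le_power2)
    moreover have "norm w * norm z \<le> norm w * s" "norm w * s < s * s"
      using w that s by (auto intro: mult_left_mono)
    ultimately show False by (simp add: power2_eq_square)
  qed
  have "((\<lambda>z. h z / (z - w)) has_contour_integral 2 * of_real pi * \<i> * h w) (circlepath 0 s)"
    unfolding h_def
    by (intro Cauchy_integral_circlepath continuous_intros holomorphic_intros f)
       (use w denominator_nonzero in auto)
  moreover have "poisson_kernel z w *\<^sub>R f z = h z / (z - w) * z" if "norm z = s" for z
  proof -
    have z_neq: "z \<noteq> w" "z \<noteq> 0" using that w s by auto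
    have denominator_eq: "of_real (s\<^sup>2) - cnj w * z = z * cnj (z - w)"
      using that by (simp add: complex_norm_square[symmetric] algebra_simps flip: that)
    have "of_real (poisson_kernel z w) = of_real (s\<^sup>2 - (norm w)\<^sup>2) / ((z - w) * cnj (z - w))"
      using that unfolding poisson_kernel_def of_real_divide complex_norm_square[of "z - w"] by simp
    then show ?thesis
      unfolding h_def denominator_eq scaleR_conv_of_real using z_neq by (simp add: mult.commute)
  qed
  ultimately have "poisson_integral s f w = h w"
    unfolding poisson_integral_def using s by (intro circ_mean_eqI_contour[of s "\<lambda>z. h z / (z - w)"])
  moreover have "of_real (s\<^sup>2) - cnj w * w = of_real (s\<^sup>2 - (norm w)\<^sup>2)"
    by (simp only: of_real_diff complex_norm_square mult.commute)
  ultimately show ?thesis using denominator_nonzero[of w] w unfolding h_def by auto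
qed

lemma poisson_integral_linear:
  assumes "continuous_on (sphere 0 s) g" "norm w < s" "bounded_linear h"
  shows "poisson_integral s (\<lambda>\<zeta>. h (g \<zeta>)) w = h (poisson_integral s g w)"
  using circ_mean_linear[OF continuous_on_poisson_integrand[OF assms(2,1)] assms(3)]
  unfolding poisson_integral_def by (simp add: linear_simps(5)[OF assms(3)])

lemma poisson_integral_add:
  assumes "continuous_on (sphere 0 s) f" "continuous_on (sphere 0 s) g" "norm w < s"
  shows "poisson_integral s (\<lambda>\<zeta>. f \<zeta> + g \<zeta>) w = poisson_integral s f w + poisson_integral s g w"
  unfolding poisson_integral_def scaleR_add_right
  by (intro circ_mean_add continuous_on_poisson_integrand assms)

lemma poisson_integral_diff:
  assumes "continuous_on (sphere 0 s) f" "continuous_on (sphere 0 s) g" "norm w < s"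
  shows "poisson_integral s (\<lambda>\<zeta>. f \<zeta> - g \<zeta>) w = poisson_integral s f w - poisson_integral s g w"
  unfolding poisson_integral_def scaleR_diff_right
  by (intro circ_mean_diff continuous_on_poisson_integrand assms)

lemma poisson_integral_const:
  fixes c :: real
  assumes "norm w < s"
  shows "poisson_integral s (\<lambda>_. c) w = c"
proof -
  have "poisson_integral s (\<lambda>_. complex_of_real c) w = of_real c"
    by (intro poisson_integral_holomorphic assms) auto
  then show ?thesis
    using poisson_integral_linear[OF _ assms bounded_linear_Re, of "\<lambda>_. complex_of_real c"] by simp
qed

lemma poisson_integral_mono:
  fixes f g :: "complex \<Rightarrow> real"
  assumes "continuous_on (sphere 0 s) f" "continuous_on (sphere 0 s) g" "norm w < s"
    and "\<And>\<zeta>. norm \<zeta> = s \<Longrightarrow> f \<zeta> \<le> g \<zeta>"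
  shows "poisson_integral s f w \<le> poisson_integral s g w"
  unfolding poisson_integral_def using assms norm_ge_zero[of w]
  by (intro circ_mean_mono continuous_on_poisson_integrand scaleR_left_mono poisson_kernel_nonneg)
     (auto simp del: norm_ge_zero)

lemma poisson_integral_Harnack:
  fixes g :: "complex \<Rightarrow> real"
  assumes w: "norm w < s" and g: "continuous_on (sphere 0 s) g" "\<And>\<zeta>. norm \<zeta> = s \<Longrightarrow> 0 \<le> g \<zeta>"
  shows "poisson_integral s g w \<le> (s + norm w) / (s - norm w) * circ_mean g s" (is ?upper)
    and "(s - norm w) / (s + norm w) * circ_mean g s \<le> poisson_integral s g w" (is ?lower)
proof -
  have s: "0 < s" using w norm_ge_zero[of w] by linarith
  have cont: "continuous_on (sphere 0 \<bar>s\<bar>) (\<lambda>\<zeta>. c *\<^sub>R g \<zeta>)" for c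
    using s g(1) by (intro continuous_intros) auto
  have "poisson_integral s g w \<le> circ_mean (\<lambda>\<zeta>. ((s + norm w) / (s - norm w)) *\<^sub>R g \<zeta>) s"
    unfolding poisson_integral_def
  proof (rule circ_mean_mono[OF continuous_on_poisson_integrand[OF w g(1)]])
    show "poisson_kernel z w *\<^sub>R g z \<le> ((s + norm w) / (s - norm w)) *\<^sub>R g z" if "norm z = \<bar>s\<bar>" for z
      using poisson_kernel_le[of w z] that w g(2)[of z] s by (intro scaleR_right_mono) auto
  qed (rule cont)
  then show ?upper by (simp only: real_scaleR_def circ_mean_cmult_real)
  have "circ_mean (\<lambda>\<zeta>. ((s - norm w) / (s + norm w)) *\<^sub>R g \<zeta>) s \<le> poisson_integral s g w"
    unfolding poisson_integral_def
  proof (rule circ_mean_mono[OF _ continuous_on_poisson_integrand[OF w g(1)]])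
    show "((s - norm w) / (s + norm w)) *\<^sub>R g z \<le> poisson_kernel z w *\<^sub>R g z" if "norm z = \<bar>s\<bar>" for z
      using poisson_kernel_ge[of w z] that w g(2)[of z] s by (intro scaleR_right_mono) auto
  qed (rule cont)
  then show ?lower by (simp only: real_scaleR_def circ_mean_cmult_real)
qed

lemma circ_mean_holomorphic:
  assumes "continuous_on (cball 0 r) f" "f holomorphic_on ball 0 r" "0 < r"
  shows "circ_mean f r = f 0"
proof -
  have "circ_mean f r = poisson_integral r f 0"
    unfolding poisson_integral_def using assms(3) by (intro circ_mean_cong) (auto simp: poisson_kernel_def)
  then show ?thesis using poisson_integral_holomorphic[OF assms(1,2), of 0] assms(3) by simp
qed

lemma circ_mean_Re_holomorphic:
  assumes "continuous_on (cball 0 r) f" "f holomorphic_on ball 0 r" "0 < r"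
  shows "circ_mean (\<lambda>z. Re (f z)) r = Re (f 0)"
proof -
  have "continuous_on (sphere 0 \<bar>r\<bar>) f"
    using assms(1,3) by (auto elim: continuous_on_subset)
  then show ?thesis
    using circ_mean_linear[OF _ bounded_linear_Re] circ_mean_holomorphic[OF assms] by simp
qed

lemma circ_mean_poisson_kernel_compose:
  assumes "continuous_on (cball 0 r) \<phi>" "\<phi> holomorphic_on ball 0 r" "0 < r"
    and "\<And>z. norm z \<le> r \<Longrightarrow> norm (\<phi> z) < norm \<zeta>"
  shows "circ_mean (\<lambda>z. poisson_kernel \<zeta> (\<phi> z)) r = poisson_kernel \<zeta> (\<phi> 0)"
proof -
  have neq: "\<zeta> \<noteq> \<phi> z" if "norm z \<le> r" for z using assms(4)[OF that] by (metis less_irrefl)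
  have "circ_mean (\<lambda>z. poisson_kernel \<zeta> (\<phi> z)) r = circ_mean (\<lambda>z. Re ((\<zeta> + \<phi> z) / (\<zeta> - \<phi> z))) r"
    using assms(3) neq by (intro circ_mean_cong poisson_kernel_eq_Re) auto
  also have "\<dots> = Re ((\<zeta> + \<phi> 0) / (\<zeta> - \<phi> 0))"
    using neq by (intro circ_mean_Re_holomorphic continuous_intros holomorphic_intros assms) auto
  finally show ?thesis using poisson_kernel_eq_Re[OF neq, of 0] assms(3) by simp
qed

lemma poisson_integral_variance:
  fixes f :: "complex \<Rightarrow> complex"
  assumes f: "continuous_on (cball 0 s) f" "f holomorphic_on ball 0 s" and w: "norm w < s"
  shows "poisson_integral s (\<lambda>z. (norm (f z - f w))\<^sup>2) w
    = poisson_integral s (\<lambda>z. (norm (f z))\<^sup>2) w - (norm (f w))\<^sup>2"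
proof -
  have cont_f: "continuous_on (sphere 0 s) f"
    using f(1) by (rule continuous_on_subset) auto
  define L where "L x = 2 * Re (x * cnj (f w))" for x
  have L: "bounded_linear L"
    unfolding L_def
    by (intro bounded_linear_compose[OF bounded_linear_mult_right] bounded_linear_compose[OF bounded_linear_Re]
        bounded_linear_mult_left)
  have cont_L: "continuous_on (sphere 0 s) (\<lambda>z. L (f z))"
    using L cont_f by (rule bounded_linear.continuous_on)
  have "(norm (f z - f w))\<^sup>2 = ((norm (f z))\<^sup>2 - L (f z)) + (norm (f w))\<^sup>2" for z
    unfolding L_def cmod_power2 by (simp add: algebra_simps power2_eq_square)
  then have "poisson_integral s (\<lambda>z. (norm (f z - f w))\<^sup>2) w
      = poisson_integral s (\<lambda>z. (norm (f z))\<^sup>2) w - poisson_integral s (\<lambda>z. L (f z)) w + (norm (f w))\<^sup>2"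
    by (simp add: poisson_integral_add poisson_integral_diff poisson_integral_const w cont_f
        cont_L continuous_intros)
  also have "poisson_integral s (\<lambda>z. L (f z)) w = L (f w)"
    using poisson_integral_linear[OF cont_f w L] poisson_integral_holomorphic[OF f w] by simp
  also have "L (f w) = 2 * (norm (f w))\<^sup>2"
    unfolding L_def complex_norm_square[symmetric] by (simp only: Re_complex_of_real)
  finally show ?thesis by simp
qed

lemma norm_square_le_poisson_integral:
  fixes f :: "complex \<Rightarrow> complex"
  assumes f: "continuous_on (cball 0 s) f" "f holomorphic_on ball 0 s" and w: "norm w < s"
  shows "(norm (f w))\<^sup>2 \<le> poisson_integral s (\<lambda>z. (norm (f z))\<^sup>2) w"
proof -
  have "continuous_on (sphere 0 s) f"
    using f(1) by (rule continuous_on_subset) auto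
  then have "poisson_integral s (\<lambda>_. 0) w \<le> poisson_integral s (\<lambda>z. (norm (f z - f w))\<^sup>2) w"
    by (intro poisson_integral_mono continuous_intros w) auto
  then show ?thesis using poisson_integral_variance[OF assms] by (simp add: poisson_integral_const w)
qed

lemma poisson_integral_norm_square_le_lipschitz:
  fixes h :: "complex \<Rightarrow> complex"
  assumes h: "continuous_on (cball 0 1) h" "h holomorphic_on ball 0 1" and w: "norm w < 1"
    and lipschitz: "\<And>z w. norm z \<le> 1 \<Longrightarrow> norm w \<le> 1 \<Longrightarrow> norm (h z - h w) \<le> L * norm (z - w)"
  shows "poisson_integral 1 (\<lambda>z. (norm (h z))\<^sup>2) w \<le> (norm (h w))\<^sup>2 + L\<^sup>2 * (1 - (norm w)\<^sup>2)"
proof -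
  have cont: "continuous_on (sphere 0 1) h" by (rule continuous_on_subset[OF h(1)]) auto
  have "poisson_integral 1 (\<lambda>z. (norm (h z - h w))\<^sup>2) w \<le> circ_mean (\<lambda>z. L\<^sup>2 * (1 - (norm w)\<^sup>2)) 1"
    unfolding poisson_integral_def
  proof (rule circ_mean_mono[OF continuous_on_poisson_integrand[OF w]])
    fix z :: complex assume z: "norm z = \<bar>1\<bar>"
    have "poisson_kernel z w *\<^sub>R (norm (h z - h w))\<^sup>2 \<le> poisson_kernel z w * (L * norm (z - w))\<^sup>2"
      using z w lipschitz
      unfolding real_scaleR_def by (intro mult_left_mono power_mono poisson_kernel_nonneg) auto
    also have "\<dots> = L\<^sup>2 * (1 - (norm w)\<^sup>2)"
      using z w unfolding poisson_kernel_def by (auto simp: power_mult_distrib)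
    finally show "poisson_kernel z w *\<^sub>R (norm (h z - h w))\<^sup>2 \<le> L\<^sup>2 * (1 - (norm w)\<^sup>2)" .
  qed (intro continuous_intros cont)+
  then show ?thesis using poisson_integral_variance[OF h w] by simp
qed

context
  fixes \<phi> :: "complex \<Rightarrow> complex" and g :: "complex \<Rightarrow> real" and r s :: real
  assumes r: "0 < r" and \<phi>: "continuous_on (cball 0 r) \<phi>" "\<And>z. norm z \<le> r \<Longrightarrow> norm (\<phi> z) < s"
    and g: "continuous_on (sphere 0 s) g"
begin

lemma continuous_on_poisson_integral_compose:
  "continuous_on (sphere 0 r) (\<lambda>z. poisson_integral s g (\<phi> z))"
proof -
  have "norm (\<phi> 0) < s" using \<phi>(2)[of 0] r by simp
  then have s: "0 < s" using norm_ge_zero[of "\<phi> 0"] by linarith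
  have neq: "\<zeta> \<noteq> \<phi> z" if "norm \<zeta> = s" "norm z \<le> r" for \<zeta> z
    using \<phi>(2)[of z] that by auto
  have "continuous_on (sphere 0 r \<times> cbox 0 (2*pi))
      (\<lambda>p. poisson_kernel (of_real s * cis (snd p)) (\<phi> (fst p)) * g (of_real s * cis (snd p)))"
    using s
    by (intro continuous_intros continuous_on_compose2[OF \<phi>(1)] continuous_on_compose2[OF g])
       (use neq in \<open>auto simp: norm_mult\<close>)
  then have "continuous_on (sphere 0 r)
      (\<lambda>z. integral (cbox 0 (2*pi)) (\<lambda>t. poisson_kernel (of_real s * cis t) (\<phi> z) * g (of_real s * cis t)))"
    by (intro integral_continuous_on_param) (simp add: case_prod_unfold)
  then show ?thesis
    unfolding poisson_integral_def circ_mean_real real_scaleR_def by (intro continuous_intros) auto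
qed

lemma circ_mean_poisson_integral_compose:
  assumes hol: "\<phi> holomorphic_on ball 0 r"
  shows "circ_mean (\<lambda>z. poisson_integral s g (\<phi> z)) r = poisson_integral s g (\<phi> 0)"
proof -
  have "norm (\<phi> 0) < s" using \<phi>(2)[of 0] r by simp
  then have s: "0 < s" using norm_ge_zero[of "\<phi> 0"] by linarith
  have "circ_mean (\<lambda>z. poisson_integral s g (\<phi> z)) r
      = circ_mean (\<lambda>\<zeta>. circ_mean (\<lambda>z. poisson_kernel \<zeta> (\<phi> z) *\<^sub>R g \<zeta>) r) s"
    unfolding poisson_integral_def
  proof (rule circ_mean_swap)
    have "continuous_on (sphere 0 r \<times> sphere 0 s) (\<lambda>p. poisson_kernel (snd p) (\<phi> (fst p)) *\<^sub>R g (snd p))"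
      using \<phi>(2)
      by (intro continuous_intros continuous_on_compose2[OF \<phi>(1)] continuous_on_compose2[OF g]) force+
    then show "continuous_on (sphere 0 \<bar>r\<bar> \<times> sphere 0 \<bar>s\<bar>) (\<lambda>(z, \<zeta>). poisson_kernel \<zeta> (\<phi> z) *\<^sub>R g \<zeta>)"
      using r s by (simp add: case_prod_unfold)
  qed
  also have "\<dots> = poisson_integral s g (\<phi> 0)"
    unfolding poisson_integral_def
  proof (rule circ_mean_cong)
    fix \<zeta> :: complex assume \<zeta>: "norm \<zeta> = \<bar>s\<bar>"
    have "circ_mean (\<lambda>z. poisson_kernel \<zeta> (\<phi> z)) r = poisson_kernel \<zeta> (\<phi> 0)"
      using r \<zeta> s \<phi> by (intro circ_mean_poisson_kernel_compose hol) auto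
    then show "circ_mean (\<lambda>z. poisson_kernel \<zeta> (\<phi> z) *\<^sub>R g \<zeta>) r = poisson_kernel \<zeta> (\<phi> 0) *\<^sub>R g \<zeta>"
      using circ_mean_cmult_real[of "g \<zeta>" "\<lambda>z. poisson_kernel \<zeta> (\<phi> z)" r] by (simp add: mult.commute)
  qed
  finally show ?thesis .
qed

end

lemma norm_of_real_mult_less_1: "0 \<le> R \<Longrightarrow> R < 1 \<Longrightarrow> norm z \<le> 1 \<Longrightarrow> norm (of_real R * z) < 1"
  for z :: complex
  using mult_left_le[of "norm z" R] by (simp add: norm_mult)

lemma holomorphic_on_ball_compose:
  assumes "g holomorphic_on ball 0 1" "f holomorphic_on ball 0 1" "\<And>z. norm z < 1 \<Longrightarrow> norm (f z) < 1"
  shows "(\<lambda>z. g (f z)) holomorphic_on ball 0 1"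
  using holomorphic_on_compose_gen[OF assms(2,1)] assms(3) by (simp add: o_def image_subset_iff)

lemma holomorphic_on_dilation:
  assumes "f holomorphic_on ball 0 1" "0 \<le> R" "R \<le> 1"
  shows "(\<lambda>z. f (of_real R * z)) holomorphic_on ball 0 1"
proof (rule holomorphic_on_ball_compose[OF assms(1)])
  show "norm (of_real R * z) < 1" if "norm z < 1" for z :: complex
    using that assms(2,3) mult_left_le_one_le[of "norm z" R] by (simp add: norm_mult)
qed (intro holomorphic_intros)

lemma continuous_on_dilation:
  fixes f :: "complex \<Rightarrow> 'a::topological_space"
  assumes "continuous_on (ball 0 1) f" "0 \<le> R" "R < 1"
  shows "continuous_on (cball 0 1) (\<lambda>z. f (of_real R * z))"
  using norm_of_real_mult_less_1[OF assms(2,3)]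
  by (intro continuous_on_compose2[OF assms(1)] continuous_intros) auto

lemma holomorphic_on_ball_continuous_on_cball:
  assumes "f holomorphic_on ball 0 1" "r < 1"
  shows "continuous_on (cball 0 r) f" "f holomorphic_on ball 0 r"
  using assms
  by (auto intro!: continuous_on_subset[OF holomorphic_on_imp_continuous_on] holomorphic_on_subset[OF assms(1)])

lemma holomorphic_on_ball_continuous_on_sphere:
  assumes "f holomorphic_on ball 0 1" "\<bar>r\<bar> < 1"
  shows "continuous_on (sphere 0 \<bar>r\<bar>) f"
  using assms by (intro continuous_on_subset[OF holomorphic_on_imp_continuous_on]) auto

lemma circ_mean_mult_inversion:
  assumes f: "f holomorphic_on ball 0 1" and h: "h holomorphic_on ball 0 1"
    and "0 < q" "q < r" "r \<le> s" "s < 1"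
  shows "circ_mean (\<lambda>z. f z * h (of_real q / z)) s = circ_mean (\<lambda>z. f z * h (of_real q / z)) r"
proof (rule circ_mean_annulus)
  have "(\<lambda>z. complex_of_real q / z) ` (ball 0 1 - cball 0 q) \<subseteq> ball 0 1"
  proof (rule image_subsetI)
    fix z :: complex assume "z \<in> ball 0 1 - cball 0 q"
    then show "of_real q / z \<in> ball 0 1"
      using \<open>0 < q\<close> unfolding mem_ball_0 norm_divide norm_of_real by (simp add: divide_less_eq)
  qed
  then have "(h \<circ> (\<lambda>z. of_real q / z)) holomorphic_on ball 0 1 - cball 0 q"
    using \<open>0 < q\<close> h by (intro holomorphic_on_compose_gen holomorphic_intros) auto
  then show "(\<lambda>z. f z * h (of_real q / z)) holomorphic_on ball 0 1 - cball 0 q"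
    by (intro holomorphic_intros holomorphic_on_subset[OF f]) (auto simp: o_def)
qed (use assms in auto)

text \<open>With \<open>h z = cnj (g (cnj z))\<close>, the integrand is \<open>f z * h (R s\<^sup>2 / z)\<close> on \<open>|z| = s\<close>, and the latter
  function equals \<open>f z * cnj (g z)\<close> on \<open>|z| = s * sqrt R\<close>.\<close>
lemma circ_mean_mult_cnj_dilation:
  assumes f: "f holomorphic_on ball 0 1" and g: "g holomorphic_on ball 0 1"
    and s: "0 < s" "s < 1" and R: "0 < R" "R \<le> 1"
  shows "circ_mean (\<lambda>z. f z * cnj (g (of_real R * z))) s = circ_mean (\<lambda>z. f z * cnj (g z)) (s * sqrt R)"
proof -
  define h where "h z = cnj (g (cnj z))" for z
  define k where "k z = f z * h (of_real (R * s\<^sup>2) / z)" for z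
  have Rs_pos: "0 < R * s\<^sup>2" using s R by simp
  have k_circle: "k z = f z * cnj (g (of_real c * z))" if "(norm z)\<^sup>2 * c = R * s\<^sup>2" for z c
  proof -
    have "z \<noteq> 0" using that Rs_pos by auto
    have "of_real (R * s\<^sup>2) = z * cnj z * of_real c"
      unfolding that[symmetric] of_real_mult complex_norm_square ..
    then have "of_real (R * s\<^sup>2) / z = of_real c * cnj z" using \<open>z \<noteq> 0\<close> by simp
    then show ?thesis by (simp add: k_def h_def)
  qed
  have "cnj ` ball 0 1 = ball (0::complex) 1"
    by (auto simp: image_cnj_conv_vimage_cnj)
  then have h: "h holomorphic_on ball 0 1"
    using holomorphic_on_compose_cnj_cnj[of g "ball 0 1"] g by (simp add: h_def[abs_def] o_def)
  have radius_le: "s * sqrt R \<le> s" using s R by (intro mult_left_le) auto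
  have "R \<le> sqrt R" using R by (simp add: real_le_rsqrt power2_eq_square mult_le_one mult_left_le)
  then have "R * s\<^sup>2 \<le> s * sqrt R * s"
    using s by (simp add: power2_eq_square mult_ac)
  also have "\<dots> < s * sqrt R" using s R by simp
  finally have "circ_mean k s = circ_mean k (s * sqrt R)"
    unfolding k_def using Rs_pos s radius_le by (intro circ_mean_mult_inversion f h) auto
  moreover have "circ_mean k s = circ_mean (\<lambda>z. f z * cnj (g (of_real R * z))) s"
    using s by (intro circ_mean_cong k_circle) auto
  moreover have "circ_mean k (s * sqrt R) = circ_mean (\<lambda>z. f z * cnj (g z)) (s * sqrt R)"
    using k_circle[of _ 1] R by (intro circ_mean_cong) (auto simp: power_mult_distrib)
  ultimately show ?thesis by simp
qed

lemma mean_square_diff_dilation: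
  assumes f: "f holomorphic_on ball 0 1" and s: "0 < s" "s < 1" and R: "0 < R" "R \<le> 1"
  shows "mean_square (\<lambda>z. f z - f (of_real R * z)) s
    = mean_square f s + mean_square f (R * s) - 2 * mean_square f (s * sqrt R)"
proof -
  let ?fR = "\<lambda>z. f (of_real R * z)"
  have cont: "continuous_on (sphere 0 \<bar>s\<bar>) f" "continuous_on (sphere 0 \<bar>s\<bar>) ?fR"
    using s R by (intro holomorphic_on_ball_continuous_on_sphere holomorphic_on_dilation f; simp)+
  have "s * sqrt R \<le> s" using s R by (intro mult_left_le) auto
  then have "s * sqrt R < 1" using s(2) by (rule le_less_trans)
  then have radius_less: "\<bar>s * sqrt R\<bar> < 1" using s R by (simp add: abs_mult)
  have "mean_square (\<lambda>z. f z - ?fR z) s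
    = circ_mean (\<lambda>z. ((norm (f z))\<^sup>2 + (norm (?fR z))\<^sup>2) - 2 * Re (f z * cnj (?fR z))) s"
    unfolding cmod_power2 by (intro circ_mean_cong) (simp add: power2_eq_square algebra_simps)
  also have "\<dots> = mean_square f s + mean_square ?fR s - 2 * circ_mean (\<lambda>z. Re (f z * cnj (?fR z))) s"
    by (subst circ_mean_diff circ_mean_add, (intro continuous_intros cont)+)+ (simp only: circ_mean_cmult_real)
  also have "circ_mean (\<lambda>z. Re (f z * cnj (?fR z))) s = Re (circ_mean (\<lambda>z. f z * cnj (?fR z)) s)"
    by (intro circ_mean_linear bounded_linear_Re continuous_intros cont)
  also have "\<dots> = Re (circ_mean (\<lambda>z. f z * cnj (f z)) (s * sqrt R))"
    by (simp only: circ_mean_mult_cnj_dilation[OF f f s R])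
  also have "\<dots> = circ_mean (\<lambda>z. Re (f z * cnj (f z))) (s * sqrt R)"
    by (intro circ_mean_linear[symmetric] bounded_linear_Re continuous_intros
        holomorphic_on_ball_continuous_on_sphere[OF f radius_less])
  also have "\<dots> = mean_square f (s * sqrt R)"
    by (simp only: complex_norm_square[symmetric] Re_complex_of_real)
  finally show ?thesis by (simp only: circ_mean_dilation[where f="\<lambda>z. (norm (f z))\<^sup>2"])
qed

section \<open>The half-plane model and the Schwarz--Pick lemma\<close>

definition cayley :: "complex \<Rightarrow> complex" where
  "cayley \<zeta> = (\<zeta> - \<i>) / (\<zeta> + \<i>)"

definition cayley_inv :: "complex \<Rightarrow> complex" where
  "cayley_inv z = \<i> * (1 + z) / (1 - z)"

definition half_plane_dist :: "complex \<Rightarrow> complex \<Rightarrow> real" where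
  "half_plane_dist \<zeta> \<omega> = norm ((\<zeta> - \<omega>) / (\<zeta> - cnj \<omega>))"

lemma one_minus_half_plane_dist_square:
  assumes "0 < Im \<zeta>" "0 < Im \<omega>"
  shows "1 - (half_plane_dist \<zeta> \<omega>)\<^sup>2 = 4 * Im \<zeta> * Im \<omega> / (norm (\<zeta> - cnj \<omega>))\<^sup>2"
proof -
  have "(norm (\<zeta> - cnj \<omega>))\<^sup>2 - (norm (\<zeta> - \<omega>))\<^sup>2 = 4 * Im \<zeta> * Im \<omega>"
    unfolding cmod_power2 by (simp add: power2_eq_square algebra_simps)
  moreover have "\<zeta> - cnj \<omega> \<noteq> 0" using assms by (auto simp: complex_eq_iff)
  ultimately show ?thesis
    unfolding half_plane_dist_def norm_divide power_divide by (simp add: diff_divide_eq_iff)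
qed

lemma half_plane_dist_le_imp:
  assumes "0 < Im \<zeta>" "0 < Im \<alpha>" "0 < Im \<omega>" "0 < Im \<beta>"
    and dist_le: "half_plane_dist \<omega> \<beta> \<le> half_plane_dist \<zeta> \<alpha>"
  shows "Im \<zeta> * Im \<alpha> / (norm (\<zeta> - cnj \<alpha>))\<^sup>2 \<le> Im \<omega> * Im \<beta> / (norm (\<omega> - cnj \<beta>))\<^sup>2"
proof -
  have "(half_plane_dist \<omega> \<beta>)\<^sup>2 \<le> (half_plane_dist \<zeta> \<alpha>)\<^sup>2"
    using dist_le by (intro power_mono) (auto simp: half_plane_dist_def)
  then show ?thesis
    using one_minus_half_plane_dist_square[OF assms(1,2)] one_minus_half_plane_dist_square[OF assms(3,4)]
    by simp
qed

lemma half_plane_dist_less_1: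
  assumes "0 < Im \<zeta>" "0 < Im \<omega>"
  shows "half_plane_dist \<zeta> \<omega> < 1"
proof -
  have "\<zeta> - cnj \<omega> \<noteq> 0" using assms by (auto simp: complex_eq_iff)
  then have "0 < 1 - (half_plane_dist \<zeta> \<omega>)\<^sup>2"
    unfolding one_minus_half_plane_dist_square[OF assms] using assms by simp
  then show ?thesis by (simp add: half_plane_dist_def abs_square_less_1)
qed

lemma half_plane_dist_scale: "t \<noteq> 0 \<Longrightarrow> half_plane_dist (of_real t * \<zeta>) (of_real t * \<omega>) = half_plane_dist \<zeta> \<omega>"
  by (simp add: half_plane_dist_def flip: right_diff_distrib)

lemma half_plane_dist_dilation_ge:
  assumes "0 < Im \<zeta>" "1 < \<mu>"
  shows "(\<mu> - 1) / (\<mu> + 1) \<le> half_plane_dist (of_real \<mu> * \<zeta>) \<zeta>"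
proof -
  have "0 < \<mu> * Im \<zeta> + Im \<zeta>" using assms by (simp add: add_pos_pos)
  then have \<zeta>: "\<zeta> \<noteq> 0" and denominator_nonzero: "of_real \<mu> * \<zeta> - cnj \<zeta> \<noteq> 0"
    by (auto simp: complex_eq_iff)
  have "of_real \<mu> * \<zeta> - \<zeta> = of_real (\<mu> - 1) * \<zeta>" by (simp add: left_diff_distrib)
  then have "norm (of_real \<mu> * \<zeta> - \<zeta>) = (\<mu> - 1) * norm \<zeta>"
    using assms by (simp only: norm_mult norm_of_real abs_of_pos diff_gt_0_iff_gt)
  moreover have "norm (of_real \<mu> * \<zeta> - cnj \<zeta>) \<le> (\<mu> + 1) * norm \<zeta>"
    using norm_triangle_ineq4[of "of_real \<mu> * \<zeta>" "cnj \<zeta>"] assms by (simp add: norm_mult distrib_right)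
  ultimately have "((\<mu> - 1) * norm \<zeta>) / ((\<mu> + 1) * norm \<zeta>) \<le> half_plane_dist (of_real \<mu> * \<zeta>) \<zeta>"
    unfolding half_plane_dist_def norm_divide using assms denominator_nonzero by (intro frac_le) auto
  then show ?thesis using \<zeta> by simp
qed

lemma norm_cayley: "norm (cayley \<zeta>) = half_plane_dist \<zeta> \<i>"
  by (simp add: cayley_def half_plane_dist_def)

lemma norm_cayley_less_1: "0 < Im \<zeta> \<Longrightarrow> norm (cayley \<zeta>) < 1"
  by (simp add: norm_cayley half_plane_dist_less_1)

lemma cayley_normalize:
  assumes "0 < Im \<omega>"
  shows "cayley ((\<zeta> - of_real (Re \<omega>)) / of_real (Im \<omega>)) = (\<zeta> - \<omega>) / (\<zeta> - cnj \<omega>)"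
proof -
  have Im_nonzero: "complex_of_real (Im \<omega>) \<noteq> 0" using assms by simp
  have "(\<zeta> - of_real (Re \<omega>)) / of_real (Im \<omega>) - \<i> = (\<zeta> - \<omega>) / of_real (Im \<omega>)"
    using Im_nonzero complex_eq[of \<omega>] by (simp add: field_simps)
  moreover have "(\<zeta> - of_real (Re \<omega>)) / of_real (Im \<omega>) + \<i> = (\<zeta> - cnj \<omega>) / of_real (Im \<omega>)"
    using Im_nonzero by (simp add: field_simps complex_eq_iff)
  ultimately show ?thesis using Im_nonzero by (simp add: cayley_def)
qed

lemma plus_i_nonzero: "0 < Im \<zeta> \<Longrightarrow> \<zeta> + \<i> \<noteq> 0"
  by (auto simp: complex_eq_iff)

lemma cayley_inv_cayley:
  assumes "0 < Im \<zeta>"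
  shows "cayley_inv (cayley \<zeta>) = \<zeta>"
proof -
  have denominator_nonzero: "\<zeta> + \<i> \<noteq> 0" using assms by (rule plus_i_nonzero)
  then have "1 + cayley \<zeta> = 2 * \<zeta> / (\<zeta> + \<i>)" "1 - cayley \<zeta> = 2 * \<i> / (\<zeta> + \<i>)"
    by (auto simp: cayley_def field_simps)
  then show ?thesis using denominator_nonzero by (simp add: cayley_inv_def)
qed

lemma cayley_cayley_inv:
  assumes "z \<noteq> 1"
  shows "cayley (cayley_inv z) = z"
proof -
  have "cayley_inv z - \<i> = 2 * \<i> * z / (1 - z)" "cayley_inv z + \<i> = 2 * \<i> / (1 - z)"
    using assms by (auto simp: cayley_inv_def field_simps)
  then show ?thesis using assms by (simp add: cayley_def)
qed

lemma Im_cayley_inv: "Im (cayley_inv z) = poisson_kernel 1 z"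
proof (cases "z = 1")
  case False
  have "Im (cayley_inv z) = Re ((1 + z) / (1 - z))"
    by (simp add: cayley_inv_def flip: times_divide_eq_right)
  then show ?thesis using False by (simp add: poisson_kernel_eq_Re)
qed (simp add: cayley_inv_def poisson_kernel_def)

lemma Im_cayley_inv_pos: "norm z < 1 \<Longrightarrow> 0 < Im (cayley_inv z)"
  unfolding Im_cayley_inv poisson_kernel_def by (intro divide_pos_pos) (auto simp: power_less_one_iff)

lemma holomorphic_on_cayley [holomorphic_intros]:
  assumes "f holomorphic_on S" "\<And>z. z \<in> S \<Longrightarrow> 0 < Im (f z)"
  shows "(\<lambda>z. cayley (f z)) holomorphic_on S"
  unfolding cayley_def using assms plus_i_nonzero by (intro holomorphic_intros) auto

lemma holomorphic_on_cayley_inv [holomorphic_intros]: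
  assumes "f holomorphic_on S" "\<And>z. z \<in> S \<Longrightarrow> norm (f z) < 1"
  shows "(\<lambda>z. cayley_inv (f z)) holomorphic_on S"
  unfolding cayley_inv_def using assms by (intro holomorphic_intros) force+

lemma tendsto_cayley_inv:
  assumes "(f \<longlongrightarrow> l) F" "norm l < 1"
  shows "((\<lambda>x. cayley_inv (f x)) \<longlongrightarrow> cayley_inv l) F"
  unfolding cayley_inv_def using assms by (intro tendsto_intros) auto

lemma one_minus_cnj_mult_nonzero:
  assumes "norm a < 1" "norm z < 1"
  shows "1 - cnj a * z \<noteq> 0"
proof
  assume "1 - cnj a * z = 0"
  then have "norm a * norm z = 1" by (metis complex_mod_cnj eq_iff_diff_eq_0 norm_mult norm_one)
  moreover have "norm a * norm z < 1 * 1" using assms by (intro mult_strict_mono') auto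
  ultimately show False by simp
qed

lemma pseudo_hyp_commute: "pseudo_hyp a z = pseudo_hyp z a"
proof -
  have "norm (1 - cnj z * a) = norm (1 - cnj a * z)"
    by (metis complex_cnj_cnj complex_cnj_diff complex_cnj_mult complex_cnj_one complex_mod_cnj mult.commute)
  then show ?thesis by (simp add: pseudo_hyp_def norm_divide norm_minus_commute)
qed

lemma one_minus_pseudo_hyp_square:
  assumes "norm z < 1" "norm a < 1"
  shows "1 - (pseudo_hyp z a)\<^sup>2 = (1 - (norm a)\<^sup>2) * (1 - (norm z)\<^sup>2) / (norm (1 - cnj a * z))\<^sup>2"
proof -
  have "1 - cnj a * z \<noteq> 0" using assms(2,1) by (rule one_minus_cnj_mult_nonzero)
  moreover have "(norm (1 - cnj a * z))\<^sup>2 - (norm (a - z))\<^sup>2 = (1 - (norm a)\<^sup>2) * (1 - (norm z)\<^sup>2)"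
    unfolding cmod_power2 by (simp add: power2_eq_square algebra_simps)
  ultimately show ?thesis
    unfolding pseudo_hyp_def norm_divide power_divide by (simp add: diff_divide_eq_iff)
qed

lemma half_plane_dist_cayley_inv:
  assumes "norm z < 1" "norm a < 1"
  shows "half_plane_dist (cayley_inv z) (cayley_inv a) = pseudo_hyp z a"
proof -
  have nonzero: "1 - z \<noteq> 0" "1 - a \<noteq> 0" "1 - cnj a \<noteq> 0" using assms by auto
  have diff: "cayley_inv z - cayley_inv a = 2 * \<i> * (z - a) / ((1 - z) * (1 - a))"
    unfolding cayley_inv_def using nonzero by (simp add: field_simps)
  have diff_cnj: "cayley_inv z - cnj (cayley_inv a) = 2 * \<i> * (1 - cnj a * z) / ((1 - z) * (1 - cnj a))"
    unfolding cayley_inv_def using nonzero by (simp add: field_simps)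
  have "norm (1 - cnj a) = norm (1 - a)" by (metis complex_cnj_diff complex_cnj_one complex_mod_cnj)
  then show ?thesis
    unfolding half_plane_dist_def pseudo_hyp_def diff diff_cnj using nonzero
    by (simp add: norm_divide norm_mult norm_minus_commute)
qed

lemma Schwarz_Pick_half_plane:
  assumes G: "G holomorphic_on ball 0 1" "\<And>z. norm z < 1 \<Longrightarrow> 0 < Im (G z)" and z: "norm z < 1"
    and a: "norm a < 1"
  shows "half_plane_dist (G z) (G a) \<le> pseudo_hyp z a"
proof -
  define m where "m = Moebius_function 0 (-a)"
  define v where "v = Moebius_function 0 a z"
  define h where "h x = (G (m x) - G a) / (G (m x) - cnj (G a))" for x
  have norm_m: "norm (m x) < 1" if "norm x < 1" for x
    unfolding m_def using a that by (intro Moebius_function_norm_lt_1) auto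
  have norm_v: "norm v < 1" unfolding v_def using a z by (intro Moebius_function_norm_lt_1) auto
  have denominator_nonzero: "G x - cnj (G a) \<noteq> 0" if "norm x < 1" for x
    using G(2)[OF that] G(2)[OF a] by (auto simp: complex_eq_iff)
  have "m holomorphic_on ball 0 1" unfolding m_def using a by (intro Moebius_function_holomorphic) auto
  then have "(G \<circ> m) holomorphic_on ball 0 1"
    using norm_m by (intro holomorphic_on_compose_gen[OF _ G(1)]) auto
  then have "h holomorphic_on ball 0 1"
    unfolding h_def using denominator_nonzero norm_m by (intro holomorphic_intros) (auto simp: o_def)
  moreover have "h 0 = 0" by (simp add: h_def m_def Moebius_function_of_zero)
  moreover have "norm (h x) < 1" if "norm x < 1" for x
    using half_plane_dist_less_1[OF G(2)[OF norm_m[OF that]] G(2)[OF a]]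
    by (simp add: h_def half_plane_dist_def)
  ultimately have "norm (h v) \<le> norm v" using norm_v by (rule Schwarz_Lemma(1))
  moreover have "m v = z" unfolding m_def v_def using a z by (intro Moebius_function_compose) auto
  moreover have "norm v = pseudo_hyp z a"
    by (simp add: v_def Moebius_function_simple pseudo_hyp_def norm_divide norm_minus_commute)
  ultimately show ?thesis by (simp add: h_def half_plane_dist_def)
qed

section \<open>Functions dominated in modulus\<close>

lemma meromorphic_bounded_imp_tendsto:
  assumes h: "h meromorphic_on S" and S: "open S" "z \<in> S" and bound: "\<And>z. z \<in> S \<Longrightarrow> norm (h z) \<le> B"
  obtains c where "h \<midarrow>z\<rightarrow> c" "norm c \<le> B"
proof -
  have bound_near: "\<forall>\<^sub>F w in at z. norm (h w) \<le> B"
    using eventually_at_in_open'[OF S] by eventually_elim (rule bound)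
  have "\<not> is_pole h z"
  proof
    assume "is_pole h z"
    then have "\<forall>\<^sub>F w in at z. \<bar>B\<bar> + 1 \<le> norm (h w)"
      using filterlim_at_infinity[of 0 h "at z"] by (auto simp: is_pole_def)
    with bound_near have "\<forall>\<^sub>F w in at z. False"
      by eventually_elim linarith
    then show False by simp
  qed
  moreover have "not_essential h z"
    using meromorphic_on_not_essential[OF meromorphic_on_subset[OF h]] S(2) by simp
  ultimately obtain c where c_limit: "h \<midarrow>z\<rightarrow> c" by (auto simp: not_essential_def)
  moreover have "norm c \<le> B"
    by (rule tendsto_upperbound[OF tendsto_norm[OF c_limit] bound_near]) simp
  ultimately show ?thesis by (rule that)
qed

lemma holomorphic_factor_of_norm_le:
  assumes f: "f holomorphic_on S" and g: "g holomorphic_on S" and S: "open S"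
    and norm_le: "\<And>z. z \<in> S \<Longrightarrow> norm (f z) \<le> norm (g z)"
  obtains Q where "Q holomorphic_on S" "\<And>z. z \<in> S \<Longrightarrow> norm (Q z) \<le> 1" "\<And>z. z \<in> S \<Longrightarrow> f z = g z * Q z"
proof (rule that)
  define h where "h z = f z / g z" for z
  have analytic: "f analytic_on S" "g analytic_on S" using f g S by (simp_all add: analytic_on_open)
  then have h: "h meromorphic_on S"
    unfolding h_def by (intro meromorphic_intros analytic_on_imp_meromorphic_on)
  have h_le: "norm (h z) \<le> 1" and f_eq: "f z = g z * h z" if "z \<in> S" for z
    using norm_le[OF that] by (auto simp: h_def norm_divide divide_le_eq_1)
  have "remove_sings h analytic_on {z}" if "z \<in> S" for z
    using that h
    by (metis meromorphic_bounded_imp_tendsto[OF h S that h_le] meromorphic_onE remove_sings_analytic_at)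
  then show "remove_sings h holomorphic_on S"
    by (intro analytic_imp_holomorphic) (subst analytic_on_analytic_at, blast)
  show "norm (remove_sings h z) \<le> 1" "f z = g z * remove_sings h z" if z: "z \<in> S" for z
  proof -
    obtain c where c: "h \<midarrow>z\<rightarrow> c" "norm c \<le> 1"
      by (rule meromorphic_bounded_imp_tendsto[OF h S z h_le])
    have Q_eq: "remove_sings h z = c" using c(1) by (rule remove_sings_eqI)
    show "norm (remove_sings h z) \<le> 1" unfolding Q_eq by (rule c(2))
    have lim: "f \<midarrow>z\<rightarrow> f z" "g \<midarrow>z\<rightarrow> g z"
      using analytic z by (auto intro!: isContD analytic_at_imp_isCont intro: analytic_on_subset)
    have "(\<lambda>w. g w * h w) \<midarrow>z\<rightarrow> g z * c" by (intro tendsto_mult lim c)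
    then have "f \<midarrow>z\<rightarrow> g z * c"
      by (rule Lim_transform_eventually)
         (use eventually_at_in_open'[OF S z] in eventually_elim, simp add: f_eq)
    then show "f z = g z * remove_sings h z"
      unfolding Q_eq using lim(1) LIM_unique by blast
  qed
qed

lemma norm_eq_imp_rotation:
  assumes f: "f holomorphic_on S" and g: "g holomorphic_on S" and S: "open S" "connected S"
    and norm_eq: "\<And>z. z \<in> S \<Longrightarrow> norm (f z) = norm (g z)" and z0: "z0 \<in> S" "g z0 \<noteq> 0"
  obtains \<beta> where "norm \<beta> = 1" "\<And>z. z \<in> S \<Longrightarrow> f z = \<beta> * g z"
proof -
  obtain Q where Q: "Q holomorphic_on S" "\<And>z. z \<in> S \<Longrightarrow> norm (Q z) \<le> 1" "\<And>z. z \<in> S \<Longrightarrow> f z = g z * Q z"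
    by (rule holomorphic_factor_of_norm_le[OF f g S(1)]) (use norm_eq in auto)
  have norm_Q_z0: "norm (Q z0) = 1"
    using norm_eq[OF z0(1)] Q(3)[OF z0(1)] z0(2) by (simp add: norm_mult)
  then have "Q constant_on S"
    using Q z0 S by (intro maximum_modulus_principle[OF Q(1), of S z0]) auto
  then obtain \<beta> where "\<And>z. z \<in> S \<Longrightarrow> Q z = \<beta>" by (auto simp: constant_on_def)
  then show ?thesis using that[of \<beta>] Q(3) norm_Q_z0 z0(1) by (simp add: mult.commute)
qed

section \<open>Innerness in mean\<close>

text \<open>An \<open>L\<^sup>2\<close> form of innerness, which behaves well under composition and limits.\<close>
definition mean_inner :: "(complex \<Rightarrow> complex) \<Rightarrow> bool" where
  "mean_inner u \<longleftrightarrow> u holomorphic_on ball 0 1 \<and> (\<forall>z\<in>ball 0 1. norm (u z) \<le> 1) \<and> (mean_square u \<longlongrightarrow> 1) (at_left 1)"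

lemma mean_inner_holomorphic: "mean_inner u \<Longrightarrow> u holomorphic_on ball 0 1"
  and mean_inner_norm_le_1: "mean_inner u \<Longrightarrow> norm z < 1 \<Longrightarrow> norm (u z) \<le> 1"
  and mean_inner_tendsto: "mean_inner u \<Longrightarrow> (mean_square u \<longlongrightarrow> 1) (at_left 1)"
  by (auto simp: mean_inner_def)

lemma mean_square_le_1:
  assumes "u holomorphic_on ball 0 1" "\<And>z. norm z < 1 \<Longrightarrow> norm (u z) \<le> 1" "\<bar>r\<bar> < 1"
  shows "mean_square u r \<le> 1"
proof -
  have "mean_square u r \<le> circ_mean (\<lambda>z. 1) r"
    using assms
    by (intro circ_mean_mono continuous_intros holomorphic_on_ball_continuous_on_sphere)
       (auto simp: power_le_one)
  then show ?thesis by simp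
qed

lemma eventually_at_left_1: "\<forall>\<^sub>F r in at_left (1::real). 0 < r \<and> r < 1"
  using eventually_at_left_real[of 0 "1::real"] by simp

lemma mean_innerI:
  assumes hol: "u holomorphic_on ball 0 1" and norm_le_1: "\<And>z. norm z < 1 \<Longrightarrow> norm (u z) \<le> 1"
    and mean_square_gt: "\<And>e. 0 < e \<Longrightarrow> e \<le> 1 \<Longrightarrow> \<forall>\<^sub>F r in at_left 1. 1 - e < mean_square u r"
  shows "mean_inner u"
proof -
  have "(mean_square u \<longlongrightarrow> 1) (at_left 1)"
  proof (rule order_tendstoI)
    fix a :: real assume "a < 1"
    then have "\<forall>\<^sub>F r in at_left 1. 1 - min 1 (1 - a) < mean_square u r"
      by (intro mean_square_gt) auto
    then show "\<forall>\<^sub>F r in at_left 1. a < mean_square u r"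
      by eventually_elim auto
  next
    fix a :: real assume a: "1 < a"
    show "\<forall>\<^sub>F r in at_left 1. mean_square u r < a"
      using eventually_at_left_1
    proof eventually_elim
      case (elim r)
      then show ?case using mean_square_le_1[OF hol norm_le_1, of r] a by auto
    qed
  qed
  then show ?thesis using hol norm_le_1 by (simp add: mean_inner_def)
qed

lemma mean_inner_id: "mean_inner (\<lambda>z. z)"
proof -
  have "mean_square (\<lambda>z. z) = (\<lambda>r. r\<^sup>2)"
  proof
    show "mean_square (\<lambda>z. z) r = r\<^sup>2" for r
      using circ_mean_cong[of r "\<lambda>z. (norm z)\<^sup>2" "\<lambda>z. r\<^sup>2"] by simp
  qed
  moreover have "((\<lambda>r::real. r\<^sup>2) \<longlongrightarrow> 1\<^sup>2) (at_left 1)" by (intro tendsto_intros)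
  ultimately show ?thesis by (simp add: mean_inner_def)
qed

lemma mean_inner_eventually:
  assumes "mean_inner u" "0 < \<epsilon>"
  obtains r0 where "0 < r0" "r0 < 1" "\<And>r. r0 \<le> r \<Longrightarrow> r < 1 \<Longrightarrow> 1 - \<epsilon> < mean_square u r"
proof -
  have "\<forall>\<^sub>F r in at_left 1. 1 - \<epsilon> < mean_square u r"
    using assms by (intro order_tendstoD(1)[OF mean_inner_tendsto]) auto
  then obtain b where b: "b < 1" "\<And>r. b < r \<Longrightarrow> r < 1 \<Longrightarrow> 1 - \<epsilon> < mean_square u r"
    using eventually_at_left[of 0 "1::real"] by auto
  show ?thesis
    by (rule that[of "(max b 0 + 1) / 2"]) (use b in auto)
qed

lemma mean_inner_dilation:
  assumes u: "mean_inner u" and \<epsilon>: "0 < \<epsilon>"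
  obtains R where "0 < R" "R < 1" "1 - \<epsilon> < mean_square u R"
    "\<And>s. sqrt R \<le> s \<Longrightarrow> s < 1 \<Longrightarrow> mean_square (\<lambda>z. u z - u (of_real R * z)) s \<le> 2 * \<epsilon>"
proof -
  obtain R where R: "0 < R" "R < 1" and near: "\<And>r. R \<le> r \<Longrightarrow> r < 1 \<Longrightarrow> 1 - \<epsilon> < mean_square u r"
    using mean_inner_eventually[OF u \<epsilon>] by blast
  show ?thesis
  proof (rule that[OF R near[OF order_refl R(2)]])
    fix s assume s: "sqrt R \<le> s" "s < 1"
    have s_pos: "0 < s" using s(1) R by (meson less_le_trans real_sqrt_gt_zero)
    have "sqrt R * sqrt R \<le> s * sqrt R" using s R by (intro mult_right_mono) auto
    then have "R \<le> s * sqrt R" using R by simp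
    moreover have "s * sqrt R < 1 * 1" "R * s < 1 * 1" using s s_pos R by (intro mult_strict_mono; simp)+
    moreover have "mean_square (\<lambda>z. u z - u (of_real R * z)) s
       = mean_square u s + mean_square u (R * s) - 2 * mean_square u (s * sqrt R)"
      using mean_inner_holomorphic[OF u] s s_pos R by (intro mean_square_diff_dilation) auto
    moreover have "mean_square u r \<le> 1" if "0 < r" "r < 1" for r
      using mean_inner_holomorphic[OF u] mean_inner_norm_le_1[OF u] that by (intro mean_square_le_1) auto
    ultimately show "mean_square (\<lambda>z. u z - u (of_real R * z)) s \<le> 2 * \<epsilon>"
      using near[of "s * sqrt R"] s s_pos R by (smt (verit) mult_pos_pos)
  qed
qed

lemma mean_inner_comparison:
  assumes f: "mean_inner f" and u: "u holomorphic_on ball 0 1" "\<And>z. norm z < 1 \<Longrightarrow> norm (u z) \<le> 1"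
    and dominated: "\<And>e. 0 < e \<Longrightarrow> \<exists>C l. continuous_on (ball 0 1) l \<and> (\<forall>r\<in>{0<..<1}. circ_mean l r \<le> e)
      \<and> (\<forall>z\<in>ball 0 1. 1 - (norm (u z))\<^sup>2 \<le> C * (1 - (norm (f z))\<^sup>2) + l z)"
  shows "mean_inner u"
proof (rule mean_innerI[OF u])
  fix e :: real assume e: "0 < e"
  obtain C l where l: "continuous_on (ball 0 1) l" "\<forall>r\<in>{0<..<1}. circ_mean l r \<le> e / 2"
    and u_dominated: "\<forall>z\<in>ball 0 1. 1 - (norm (u z))\<^sup>2 \<le> C * (1 - (norm (f z))\<^sup>2) + l z"
    using dominated[OF half_gt_zero[OF e]] by blast
  have "((\<lambda>r. C * (1 - mean_square f r)) \<longlongrightarrow> C * (1 - 1)) (at_left 1)"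
    by (intro tendsto_intros mean_inner_tendsto f)
  then have "\<forall>\<^sub>F r in at_left 1. C * (1 - mean_square f r) < e / 2"
    using e by (intro order_tendstoD(2)) auto
  then show "\<forall>\<^sub>F r in at_left 1. 1 - e < mean_square u r"
    using eventually_at_left_1
  proof eventually_elim
    case (elim r)
    then have r: "0 < r" "r < 1" by auto
    have cont: "continuous_on (sphere 0 \<bar>r\<bar>) (\<lambda>z. (norm (u z))\<^sup>2)"
      "continuous_on (sphere 0 \<bar>r\<bar>) (\<lambda>z. (norm (f z))\<^sup>2)"
      using r u(1) mean_inner_holomorphic[OF f]
      by (intro continuous_intros holomorphic_on_ball_continuous_on_sphere; simp)+
    have cont_l: "continuous_on (sphere 0 \<bar>r\<bar>) l" using r by (intro continuous_on_subset[OF l(1)]) auto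
    have dominated: "1 - (norm (u z))\<^sup>2 \<le> C * (1 - (norm (f z))\<^sup>2) + l z" if "norm z = \<bar>r\<bar>" for z
      using u_dominated that r by simp
    have "1 - mean_square u r = circ_mean (\<lambda>z. 1 - (norm (u z))\<^sup>2) r"
      by (rule circ_mean_one_minus[OF cont(1), symmetric])
    also have "\<dots> \<le> circ_mean (\<lambda>z. C * (1 - (norm (f z))\<^sup>2) + l z) r"
      by (intro circ_mean_mono continuous_on_add continuous_on_diff continuous_on_mult continuous_on_const
          cont cont_l dominated)
    also have "\<dots> = circ_mean (\<lambda>z. C * (1 - (norm (f z))\<^sup>2)) r + circ_mean l r"
      by (intro circ_mean_add continuous_on_diff continuous_on_mult continuous_on_const cont cont_l)
    also have "\<dots> = C * (1 - mean_square f r) + circ_mean l r"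
      by (simp only: circ_mean_cmult_real circ_mean_one_minus[OF cont(2)])
    finally show ?case using elim(1) bspec[OF l(2), of r] r by simp
  qed
qed

lemma mean_inner_pseudo_hyp:
  assumes v: "mean_inner v" "\<And>z. norm z < 1 \<Longrightarrow> norm (v z) < 1" and a: "norm a < 1"
    and u: "u holomorphic_on ball 0 1" "\<And>z. norm z < 1 \<Longrightarrow> norm (u z) = pseudo_hyp (v z) a"
  shows "mean_inner u"
proof (rule mean_inner_comparison[OF v(1) u(1)])
  define C where "C = (1 - (norm a)\<^sup>2) / (1 - norm a)\<^sup>2"
  have defect_a: "0 \<le> 1 - (norm a)\<^sup>2" using a by (simp add: power_le_one)
  have defect: "0 \<le> 1 - (norm (u z))\<^sup>2 \<and> 1 - (norm (u z))\<^sup>2 \<le> C * (1 - (norm (v z))\<^sup>2)" if z: "norm z < 1" for z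
  proof -
    have defect_v: "0 \<le> 1 - (norm (v z))\<^sup>2" using v(2)[OF z] by (simp add: power_le_one)
    have "norm (cnj a * v z) \<le> norm a * 1" unfolding norm_mult using v(2)[OF z] by (intro mult_mono) auto
    then have "1 - norm a \<le> norm (1 - cnj a * v z)" using norm_triangle_ineq2[of 1 "cnj a * v z"] by simp
    then have "(1 - (norm a)\<^sup>2) * (1 - (norm (v z))\<^sup>2) / (norm (1 - cnj a * v z))\<^sup>2
        \<le> (1 - (norm a)\<^sup>2) * (1 - (norm (v z))\<^sup>2) / (1 - norm a)\<^sup>2"
      using a defect_a defect_v by (intro frac_le power_mono mult_nonneg_nonneg) auto
    then show ?thesis
      unfolding u(2)[OF z] one_minus_pseudo_hyp_square[OF v(2)[OF z] a]
      using defect_a defect_v by (simp add: C_def)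
  qed
  then show "norm (u z) \<le> 1" if "norm z < 1" for z
    using that by (simp add: abs_square_le_1)
  show "\<exists>C l. continuous_on (ball 0 1) l \<and> (\<forall>r\<in>{0<..<1}. circ_mean l r \<le> e)
      \<and> (\<forall>z\<in>ball 0 1. 1 - (norm (u z))\<^sup>2 \<le> C * (1 - (norm (v z))\<^sup>2) + l z)" if "0 < e" for e
    using that defect by (intro exI[of _ C] exI[of _ "\<lambda>_. 0"]) auto
qed

text \<open>Where \<open>\<zeta>\<close> is large nothing is gained from \<open>1 - |cayley \<zeta>|\<^sup>2 = 4 Im \<zeta> / |\<zeta> + i|\<^sup>2\<close>,
  and the second term takes over.\<close>
lemma one_minus_norm_exp_square_le:
  assumes \<zeta>: "0 < Im \<zeta>" and c: "0 < c" and K: "1 < K"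
  shows "1 - (norm (exp (\<i> * of_real c * \<zeta>)))\<^sup>2
    \<le> c * K\<^sup>2 / 2 * (1 - (norm (cayley \<zeta>))\<^sup>2) + ln (norm (\<zeta> + \<i>)) / ln K"
proof -
  have gt1: "1 < norm (\<zeta> + \<i>)" using abs_Im_le_cmod[of "\<zeta> + \<i>"] \<zeta> by simp
  have defect: "1 - (norm (cayley \<zeta>))\<^sup>2 = 4 * Im \<zeta> / (norm (\<zeta> + \<i>))\<^sup>2"
    using one_minus_half_plane_dist_square[of \<zeta> \<i>] \<zeta> by (simp add: norm_cayley)
  then have defect_nonneg: "0 \<le> 1 - (norm (cayley \<zeta>))\<^sup>2" using \<zeta> by simp
  show ?thesis
  proof (cases "norm (\<zeta> + \<i>) \<le> K")
    case True
    have "(norm (exp (\<i> * of_real c * \<zeta>)))\<^sup>2 = exp (- (2 * c * Im \<zeta>))"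
      by (simp flip: exp_double)
    then have "1 - (norm (exp (\<i> * of_real c * \<zeta>)))\<^sup>2 \<le> 2 * c * Im \<zeta>"
      using exp_ge_add_one_self[of "- (2 * c * Im \<zeta>)"] by simp
    also have "\<dots> = c / 2 * (norm (\<zeta> + \<i>))\<^sup>2 * (1 - (norm (cayley \<zeta>))\<^sup>2)"
      unfolding defect using plus_i_nonzero[OF \<zeta>] by simp
    also have "\<dots> \<le> c / 2 * K\<^sup>2 * (1 - (norm (cayley \<zeta>))\<^sup>2)"
      using True c defect_nonneg by (intro mult_right_mono mult_left_mono power_mono) auto
    also have "\<dots> \<le> c * K\<^sup>2 / 2 * (1 - (norm (cayley \<zeta>))\<^sup>2) + ln (norm (\<zeta> + \<i>)) / ln K"
      using K gt1 by simp
    finally show ?thesis .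
  next
    case False
    then have "ln K \<le> ln (norm (\<zeta> + \<i>))" using K gt1 by (subst ln_le_cancel_iff) auto
    then have "1 \<le> ln (norm (\<zeta> + \<i>)) / ln K" using K by simp
    moreover have "0 \<le> c * K\<^sup>2 / 2 * (1 - (norm (cayley \<zeta>))\<^sup>2)"
      using c defect_nonneg by (intro mult_nonneg_nonneg) auto
    moreover have "1 - (norm (exp (\<i> * of_real c * \<zeta>)))\<^sup>2 \<le> 1" by simp
    ultimately show ?thesis by linarith
  qed
qed

lemma circ_mean_ln_norm:
  assumes h: "h holomorphic_on ball 0 1" "\<And>z. norm z < 1 \<Longrightarrow> h z \<notin> \<real>\<^sub>\<le>\<^sub>0" and r: "0 < r" "r < 1"
  shows "circ_mean (\<lambda>z. ln (norm (h z))) r = ln (norm (h 0))"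
proof -
  have nonzero: "h z \<noteq> 0" if "norm z < 1" for z using h(2)[OF that] by auto
  have Ln_hol: "(\<lambda>z. Ln (h z)) holomorphic_on ball 0 1" using h by (intro holomorphic_intros) auto
  have "circ_mean (\<lambda>z. ln (norm (h z))) r = circ_mean (\<lambda>z. Re (Ln (h z))) r"
    using r nonzero by (intro circ_mean_cong) simp
  also have "\<dots> = Re (Ln (h 0))"
    by (intro circ_mean_Re_holomorphic holomorphic_on_ball_continuous_on_cball[OF Ln_hol] r)
  finally show ?thesis using nonzero[of 0] by simp
qed

text \<open>The harmonic function \<open>ln |g + i|\<close> is nonnegative, so the set where \<open>g\<close> is large is small in mean.\<close>
lemma mean_inner_exp:
  assumes g: "g holomorphic_on ball 0 1" "\<And>z. norm z < 1 \<Longrightarrow> 0 < Im (g z)" and c: "0 < c"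
    and f: "mean_inner (\<lambda>z. cayley (g z))"
  shows "mean_inner (\<lambda>z. exp (\<i> * of_real c * g z))"
proof (rule mean_inner_comparison[OF f])
  show "(\<lambda>z. exp (\<i> * of_real c * g z)) holomorphic_on ball 0 1" by (intro holomorphic_intros g)
  show "norm (exp (\<i> * of_real c * g z)) \<le> 1" if "norm z < 1" for z using g(2)[OF that] c by simp
  fix e :: real assume e: "0 < e"
  define m where "m = ln (norm (g 0 + \<i>))"
  define K where "K = exp (m / e + 1)"
  have "1 < norm (g 0 + \<i>)" using abs_Im_le_cmod[of "g 0 + \<i>"] g(2)[of 0] by simp
  then have m: "0 < m" unfolding m_def by (rule ln_gt_zero)
  have ln_K: "ln K = m / e + 1" by (simp add: K_def)
  have not_nonpos: "g z + \<i> \<notin> \<real>\<^sub>\<le>\<^sub>0" if "norm z < 1" for z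
    using g(2)[OF that] by (auto simp: complex_nonpos_Reals_iff)
  show "\<exists>C l. continuous_on (ball 0 1) l \<and> (\<forall>r\<in>{0<..<1}. circ_mean l r \<le> e)
      \<and> (\<forall>z\<in>ball 0 1. 1 - (norm (exp (\<i> * of_real c * g z)))\<^sup>2 \<le> C * (1 - (norm (cayley (g z)))\<^sup>2) + l z)"
  proof (intro exI conjI ballI)
    show "continuous_on (ball 0 1) (\<lambda>z. ln (norm (g z + \<i>)) / ln K)"
      using plus_i_nonzero g(2) ln_K m e
      by (intro continuous_intros holomorphic_on_imp_continuous_on[OF g(1)])
         (auto simp: add_pos_pos less_imp_neq[symmetric])
    show "circ_mean (\<lambda>z. ln (norm (g z + \<i>)) / ln K) r \<le> e" if "r \<in> {0<..<1}" for r
    proof -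
      have "circ_mean (\<lambda>z. ln (norm (g z + \<i>))) r = m"
        unfolding m_def using that not_nonpos by (intro circ_mean_ln_norm holomorphic_intros g) auto
      then have "circ_mean (\<lambda>z. ln (norm (g z + \<i>)) / ln K) r = m / ln K"
        using circ_mean_cmult_real[of "inverse (ln K)" "\<lambda>z. ln (norm (g z + \<i>))" r]
        by (simp add: field_simps)
      also have "\<dots> \<le> e" unfolding ln_K using m e by (simp add: divide_le_eq add_pos_pos field_simps)
      finally show ?thesis .
    qed
    show "1 - (norm (exp (\<i> * of_real c * g z)))\<^sup>2
        \<le> c * K\<^sup>2 / 2 * (1 - (norm (cayley (g z)))\<^sup>2) + ln (norm (g z + \<i>)) / ln K" if "z \<in> ball 0 1" for z
      using that g(2) c m e by (intro one_minus_norm_exp_square_le) (auto simp: K_def add_pos_pos)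
  qed
qed

lemma circ_mean_one_minus_norm_square_le:
  assumes Q: "Q holomorphic_on ball 0 1" "\<And>z. norm z < 1 \<Longrightarrow> norm (Q z) \<le> 1"
    and w: "norm w < 1" and r: "(1 + norm w) / 2 < r" "r < 1"
  shows "circ_mean (\<lambda>z. 1 - (norm (Q z))\<^sup>2) r \<le> 8 / (1 - norm w) * (1 - norm (Q w))"
proof -
  have w_less_r: "norm w < r" using r w by simp
  then have r_pos: "0 < r" using norm_ge_zero[of w] by linarith
  have cont: "continuous_on (sphere 0 r) Q"
    using holomorphic_on_ball_continuous_on_sphere[OF Q(1), of r] r r_pos by simp
  have nonneg: "0 \<le> circ_mean (\<lambda>z. 1 - (norm (Q z))\<^sup>2) r"
    using r r_pos Q(2) cont by (intro circ_mean_nonneg continuous_intros) (auto simp: power_le_one)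
  have "(1 - norm w) / 4 = (1 - norm w) / 2 / 2" by simp
  also have "\<dots> \<le> (r - norm w) / (r + norm w)"
    using r w r_pos by (intro frac_le) (auto intro: add_pos_nonneg)
  finally have "(1 - norm w) / 4 * circ_mean (\<lambda>z. 1 - (norm (Q z))\<^sup>2) r
      \<le> (r - norm w) / (r + norm w) * circ_mean (\<lambda>z. 1 - (norm (Q z))\<^sup>2) r"
    using nonneg by (rule mult_right_mono)
  also have "\<dots> \<le> poisson_integral r (\<lambda>z. 1 - (norm (Q z))\<^sup>2) w"
    using w_less_r r Q(2)
    by (intro poisson_integral_Harnack(2) continuous_intros cont) (auto simp: power_le_one)
  also have "\<dots> = 1 - poisson_integral r (\<lambda>z. (norm (Q z))\<^sup>2) w"
    by (subst poisson_integral_diff, (intro continuous_intros cont w_less_r)+)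
       (simp add: poisson_integral_const w_less_r)
  also have "\<dots> \<le> 1 - (norm (Q w))\<^sup>2"
    using norm_square_le_poisson_integral[OF holomorphic_on_ball_continuous_on_cball[OF Q(1) r(2)] w_less_r]
    by simp
  also have "\<dots> = (1 - norm (Q w)) * (1 + norm (Q w))" by (simp add: power2_eq_square algebra_simps)
  also have "\<dots> \<le> (1 - norm (Q w)) * 2" using Q(2)[of w] w by (intro mult_left_mono) auto
  finally show ?thesis using w by (simp add: field_simps)
qed

text \<open>The quotient \<open>f / g\<close> is bounded by \<open>1\<close>, so if it is almost unimodular at \<open>w\<close>, then it is almost
  unimodular in mean.\<close>
lemma mean_square_ge_of_norm_le:
  assumes f: "f holomorphic_on ball 0 1"
    and g: "g holomorphic_on ball 0 1" "\<And>z. norm z < 1 \<Longrightarrow> norm (g z) \<le> 1"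
    and norm_le: "\<And>z. norm z < 1 \<Longrightarrow> norm (f z) \<le> norm (g z)"
    and w: "norm w < 1" "g w \<noteq> 0" and r: "(1 + norm w) / 2 < r" "r < 1"
  shows "mean_square g r - 8 / (1 - norm w) * (1 - norm (f w) / norm (g w)) \<le> mean_square f r"
proof -
  obtain Q where Q: "Q holomorphic_on ball 0 1" "\<And>z. z \<in> ball 0 1 \<Longrightarrow> norm (Q z) \<le> 1"
    "\<And>z. z \<in> ball 0 1 \<Longrightarrow> f z = g z * Q z"
    by (rule holomorphic_factor_of_norm_le[OF f g(1) open_ball]) (use norm_le in auto)
  have "0 < (1 + norm w) / 2" by (simp add: add_pos_nonneg)
  then have r_pos: "0 < r" using r(1) by (rule less_trans)
  have cont: "continuous_on (sphere 0 \<bar>r\<bar>) f" "continuous_on (sphere 0 \<bar>r\<bar>) g" "continuous_on (sphere 0 \<bar>r\<bar>) Q"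
    using r r_pos f g(1) Q(1) by (intro holomorphic_on_ball_continuous_on_sphere; simp)+
  have "mean_square g r \<le> circ_mean (\<lambda>z. (norm (f z))\<^sup>2 + (1 - (norm (Q z))\<^sup>2)) r"
  proof (rule circ_mean_mono)
    fix z :: complex assume "norm z = \<bar>r\<bar>"
    then have z: "z \<in> ball 0 1" using r r_pos by simp
    have "0 \<le> (1 - (norm (g z))\<^sup>2) * (1 - (norm (Q z))\<^sup>2)"
      using g(2)[of z] Q(2)[OF z] z by (intro mult_nonneg_nonneg) (auto simp: power_le_one)
    then show "(norm (g z))\<^sup>2 \<le> (norm (f z))\<^sup>2 + (1 - (norm (Q z))\<^sup>2)"
      using Q(3)[OF z] by (simp add: norm_mult power_mult_distrib algebra_simps)
  qed (intro continuous_intros cont)+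
  also have "\<dots> = mean_square f r + circ_mean (\<lambda>z. 1 - (norm (Q z))\<^sup>2) r"
    by (intro circ_mean_add continuous_intros cont)
  also have "circ_mean (\<lambda>z. 1 - (norm (Q z))\<^sup>2) r \<le> 8 / (1 - norm w) * (1 - norm (Q w))"
    using Q(2) by (intro circ_mean_one_minus_norm_square_le Q(1) w r) simp
  also have "norm (Q w) = norm (f w) / norm (g w)"
    using Q(3)[of w] w by (simp add: norm_mult)
  finally show ?thesis by simp
qed

lemma mean_inner_limit:
  assumes F: "\<And>n. mean_inner (F n)" and f: "f holomorphic_on ball 0 1"
    and norm_le: "\<And>n z. norm z < 1 \<Longrightarrow> norm (f z) \<le> norm (F n z)"
    and lim: "(\<lambda>n. F n w) \<longlonglongrightarrow> f w" and w: "norm w < 1" "f w \<noteq> 0"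
  shows "mean_inner f"
proof (rule mean_innerI[OF f])
  show "norm (f z) \<le> 1" if "norm z < 1" for z
    using norm_le[OF that] mean_inner_norm_le_1[OF F that] by (rule order_trans)
  fix e :: real assume e: "0 < e"
  define C where "C = 8 / (1 - norm w)"
  have F_w_nonzero: "F n w \<noteq> 0" for n using norm_le[OF w(1), of n] w(2) by auto
  have "(\<lambda>n. C * (1 - norm (f w) / norm (F n w))) \<longlonglongrightarrow> C * (1 - norm (f w) / norm (f w))"
    using w by (intro tendsto_intros lim) auto
  then have "\<forall>\<^sub>F n in sequentially. C * (1 - norm (f w) / norm (F n w)) < e / 2"
    using w e by (intro order_tendstoD(2)) auto
  then obtain n where n: "C * (1 - norm (f w) / norm (F n w)) < e / 2"
    using eventually_happens'[OF sequentially_bot] by blast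
  have "\<forall>\<^sub>F r in at_left 1. 1 - e / 2 < mean_square (F n) r"
    using e by (intro order_tendstoD(1)[OF mean_inner_tendsto[OF F]]) auto
  moreover have "\<forall>\<^sub>F r in at_left 1. r \<in> {(1 + norm w) / 2<..<1}"
    using w by (intro eventually_at_left_real) auto
  ultimately show "\<forall>\<^sub>F r in at_left 1. 1 - e < mean_square f r"
  proof eventually_elim
    case (elim r)
    then have "mean_square (F n) r - C * (1 - norm (f w) / norm (F n w)) \<le> mean_square f r"
      unfolding C_def
      by (intro mean_square_ge_of_norm_le f mean_inner_holomorphic[OF F] mean_inner_norm_le_1[OF F]
          norm_le w F_w_nonzero) auto
    then show ?case using elim(1) n by linarith
  qed
qed

lemma poisson_kernel_le_defect:
  assumes F: "F holomorphic_on ball 0 1" "\<And>z. norm z < 1 \<Longrightarrow> norm (F z) < 1" and \<eta>: "norm \<eta> = 1" and \<delta>: "0 < \<delta>"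
    and far: "\<And>z. norm z < 1 \<Longrightarrow> \<delta> \<le> norm (\<eta> - F z)" and r: "0 < r" "r < 1"
  shows "poisson_kernel \<eta> (F 0) \<le> inverse (\<delta>\<^sup>2) * (1 - mean_square F r)"
proof -
  have cont: "continuous_on (sphere 0 \<bar>r\<bar>) F"
    using r by (intro holomorphic_on_ball_continuous_on_sphere F(1)) auto
  have "poisson_kernel \<eta> (F 0) = circ_mean (\<lambda>z. poisson_kernel \<eta> (F z)) r"
    using r \<eta> F(2) holomorphic_on_ball_continuous_on_cball[OF F(1)]
    by (intro circ_mean_poisson_kernel_compose[symmetric]) auto
  also have "\<dots> \<le> circ_mean (\<lambda>z. inverse (\<delta>\<^sup>2) * (1 - (norm (F z))\<^sup>2)) r"
  proof (rule circ_mean_mono)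
    fix z :: complex assume "norm z = \<bar>r\<bar>"
    then have z: "norm z < 1" using r by simp
    then have "poisson_kernel \<eta> (F z) \<le> (1 - (norm (F z))\<^sup>2) / \<delta>\<^sup>2"
      unfolding poisson_kernel_def \<eta> power_one
      using far[OF z] F(2)[OF z] \<delta> by (intro frac_le power_mono) (auto simp: power_le_one)
    then show "poisson_kernel \<eta> (F z) \<le> inverse (\<delta>\<^sup>2) * (1 - (norm (F z))\<^sup>2)"
      by (simp add: divide_inverse mult.commute)
  next
    have "\<eta> \<noteq> F z" if "z \<in> sphere 0 \<bar>r\<bar>" for z using F(2)[of z] that r \<eta> by auto
    then show "continuous_on (sphere 0 \<bar>r\<bar>) (\<lambda>z. poisson_kernel \<eta> (F z))"
      by (intro continuous_intros cont)
  qed (intro continuous_intros cont)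
  also have "\<dots> = inverse (\<delta>\<^sup>2) * (1 - mean_square F r)"
    by (simp only: circ_mean_cmult_real circ_mean_one_minus[OF continuous_on_power[OF continuous_on_norm[OF cont]]])
  finally show ?thesis .
qed

lemma mean_inner_approaches_circle:
  assumes F: "mean_inner F" "\<And>z. norm z < 1 \<Longrightarrow> norm (F z) < 1" and \<eta>: "norm \<eta> = 1" and \<delta>: "0 < \<delta>"
  shows "\<exists>z\<in>ball 0 1. norm (\<eta> - F z) < \<delta>"
proof (rule ccontr)
  assume "\<not> ?thesis"
  then have far: "\<delta> \<le> norm (\<eta> - F z)" if "norm z < 1" for z using that by (simp add: not_less)
  have "poisson_kernel \<eta> (F 0) \<le> inverse (\<delta>\<^sup>2) * (1 - 1)"
  proof (rule tendsto_lowerbound)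
    show "((\<lambda>r. inverse (\<delta>\<^sup>2) * (1 - mean_square F r)) \<longlongrightarrow> inverse (\<delta>\<^sup>2) * (1 - 1)) (at_left 1)"
      by (intro tendsto_intros mean_inner_tendsto F)
    show "\<forall>\<^sub>F r in at_left 1. poisson_kernel \<eta> (F 0) \<le> inverse (\<delta>\<^sup>2) * (1 - mean_square F r)"
      using eventually_at_left_1
      by eventually_elim (auto intro: poisson_kernel_le_defect[OF mean_inner_holomorphic[OF F(1)] F(2) \<eta> \<delta> far])
  qed simp
  moreover have "0 < poisson_kernel \<eta> (F 0)"
    using \<eta> F(2)[of 0]
    unfolding poisson_kernel_def by (intro divide_pos_pos) (auto simp: power_less_one_iff)
  ultimately show False by simp
qed

lemma compact_norm_bound_less_1:
  fixes \<phi> :: "'a::topological_space \<Rightarrow> complex"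
  assumes "compact K" "continuous_on K \<phi>" "\<And>z. z \<in> K \<Longrightarrow> norm (\<phi> z) < 1"
  obtains m where "m < 1" "\<And>z. z \<in> K \<Longrightarrow> norm (\<phi> z) \<le> m"
proof (cases "K = {}")
  case False
  then obtain z0 where "z0 \<in> K" "\<And>z. z \<in> K \<Longrightarrow> norm (\<phi> z) \<le> norm (\<phi> z0)"
    using continuous_attains_sup[of K "\<lambda>z. norm (\<phi> z)"] assms(1,2) by (auto intro: continuous_intros)
  then show ?thesis using that[of "norm (\<phi> z0)"] assms(3) by auto
qed (use that[of 0] in auto)

lemma mean_square_compose_le_Harnack:
  assumes h: "h holomorphic_on ball 0 1" and \<phi>: "\<phi> holomorphic_on ball 0 1"
    and r: "0 < r" "r < 1" and s: "s < 1" "\<And>z. norm z \<le> r \<Longrightarrow> norm (\<phi> z) < s"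
  shows "mean_square (\<lambda>z. h (\<phi> z)) r \<le> (s + norm (\<phi> 0)) / (s - norm (\<phi> 0)) * mean_square h s"
proof -
  note \<phi>_cball = holomorphic_on_ball_continuous_on_cball[OF \<phi> r(2)]
    and h_cball = holomorphic_on_ball_continuous_on_cball[OF h s(1)]
  have cont: "continuous_on (sphere 0 s) (\<lambda>z. (norm (h z))\<^sup>2)"
    by (intro continuous_intros continuous_on_subset[OF h_cball(1)]) auto
  have "mean_square (\<lambda>z. h (\<phi> z)) r \<le> circ_mean (\<lambda>z. poisson_integral s (\<lambda>\<zeta>. (norm (h \<zeta>))\<^sup>2) (\<phi> z)) r"
  proof (rule circ_mean_mono)
    show "(norm (h (\<phi> z)))\<^sup>2 \<le> poisson_integral s (\<lambda>\<zeta>. (norm (h \<zeta>))\<^sup>2) (\<phi> z)" if "norm z = \<bar>r\<bar>" for z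
      using that r by (intro norm_square_le_poisson_integral h_cball s) auto
    show "continuous_on (sphere 0 \<bar>r\<bar>) (\<lambda>z. (norm (h (\<phi> z)))\<^sup>2)"
      using r less_imp_le[OF s(2)]
      by (intro continuous_intros continuous_on_compose2[OF h_cball(1)] continuous_on_subset[OF \<phi>_cball(1)]) auto
    show "continuous_on (sphere 0 \<bar>r\<bar>) (\<lambda>z. poisson_integral s (\<lambda>\<zeta>. (norm (h \<zeta>))\<^sup>2) (\<phi> z))"
      using continuous_on_poisson_integral_compose[OF r(1) \<phi>_cball(1) s(2) cont] r by simp
  qed
  also have "\<dots> = poisson_integral s (\<lambda>\<zeta>. (norm (h \<zeta>))\<^sup>2) (\<phi> 0)"
    by (rule circ_mean_poisson_integral_compose[OF r(1) \<phi>_cball(1) s(2) cont \<phi>_cball(2)])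
  also have "\<dots> \<le> (s + norm (\<phi> 0)) / (s - norm (\<phi> 0)) * mean_square h s"
    using s(2)[of 0] r cont by (intro poisson_integral_Harnack) auto
  finally show ?thesis .
qed

lemma littlewood_subordination:
  assumes h: "h holomorphic_on ball 0 1" and \<phi>: "\<phi> holomorphic_on ball 0 1" "\<And>z. norm z < 1 \<Longrightarrow> norm (\<phi> z) < 1"
    and r: "0 < r" "r < 1" and \<sigma>: "\<sigma> < 1" and bound: "\<And>s. \<sigma> \<le> s \<Longrightarrow> s < 1 \<Longrightarrow> mean_square h s \<le> \<epsilon>"
  shows "mean_square (\<lambda>z. h (\<phi> z)) r \<le> (1 + norm (\<phi> 0)) / (1 - norm (\<phi> 0)) * \<epsilon>"
proof -
  obtain m where m: "m < 1" "\<And>z. norm z \<le> r \<Longrightarrow> norm (\<phi> z) \<le> m"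
    by (rule compact_norm_bound_less_1[OF compact_cball holomorphic_on_ball_continuous_on_cball(1)[OF \<phi>(1) r(2)]])
       (use \<phi>(2) r in auto)
  have norm_\<phi>_0: "norm (\<phi> 0) \<le> m" "norm (\<phi> 0) < 1" using m(2)[of 0] \<phi>(2)[of 0] r by auto
  show ?thesis
  proof (rule tendsto_lowerbound[where F="at_left 1"])
    show "((\<lambda>s. (s + norm (\<phi> 0)) / (s - norm (\<phi> 0)) * \<epsilon>) \<longlongrightarrow> (1 + norm (\<phi> 0)) / (1 - norm (\<phi> 0)) * \<epsilon>) (at_left 1)"
      using norm_\<phi>_0 by (intro tendsto_intros) auto
    have "\<forall>\<^sub>F s in at_left 1. s \<in> {max m \<sigma><..<1}" using m(1) \<sigma> by (intro eventually_at_left_real) auto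
    then show "\<forall>\<^sub>F s in at_left 1. mean_square (\<lambda>z. h (\<phi> z)) r \<le> (s + norm (\<phi> 0)) / (s - norm (\<phi> 0)) * \<epsilon>"
    proof eventually_elim
      case (elim s)
      then have s: "\<sigma> \<le> s" "s < 1" "m < s" by auto
      then have "mean_square (\<lambda>z. h (\<phi> z)) r \<le> (s + norm (\<phi> 0)) / (s - norm (\<phi> 0)) * mean_square h s"
        using m(2) by (intro mean_square_compose_le_Harnack h \<phi>(1) r) (auto intro: le_less_trans)
      also have "\<dots> \<le> (s + norm (\<phi> 0)) / (s - norm (\<phi> 0)) * \<epsilon>"
        using s norm_\<phi>_0(1) norm_ge_zero[of "\<phi> 0"]
        by (intro mult_left_mono bound divide_nonneg_nonneg) (auto simp del: norm_ge_zero)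
      finally show ?case .
    qed
  qed simp
qed

lemma holomorphic_dilation_lipschitz:
  assumes h: "h holomorphic_on ball 0 1" and R: "0 < R" "R < 1"
  obtains L where "\<And>z w. norm z \<le> 1 \<Longrightarrow> norm w \<le> 1 \<Longrightarrow> norm (h (of_real R * z) - h (of_real R * w)) \<le> L * norm (z - w)"
proof -
  have "continuous_on (cball 0 R) (deriv h)"
    using R
    by (intro continuous_on_subset[OF holomorphic_on_imp_continuous_on[OF holomorphic_deriv[OF h]]]) auto
  then have "bounded (deriv h ` cball 0 R)" by (intro compact_imp_bounded compact_continuous_image) auto
  then obtain B where "\<forall>x\<in>deriv h ` cball 0 R. norm x \<le> B" unfolding bounded_iff by blast
  then have deriv_le: "norm (deriv h z) \<le> B" if "norm z \<le> R" for z using that by simp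
  show ?thesis
  proof (rule that)
    fix z w :: complex assume zw: "norm z \<le> 1" "norm w \<le> 1"
    have "norm (h (of_real R * z) - h (of_real R * w)) \<le> B * norm (of_real R * z - of_real R * w)"
    proof (rule field_differentiable_bound[of "cball 0 R" h "deriv h"])
      fix x :: complex assume "x \<in> cball 0 R"
      then show "(h has_field_derivative deriv h x) (at x within cball 0 R)"
        using R h by (intro has_field_derivative_at_within[OF holomorphic_derivI[of _ "ball 0 1"]]) auto
    qed (use deriv_le zw R in \<open>auto simp: norm_mult mult_left_le\<close>)
    also have "norm (of_real R * z - of_real R * w) = R * norm (z - w)"
      using R by (simp flip: right_diff_distrib add: norm_mult)
    finally show "norm (h (of_real R * z) - h (of_real R * w)) \<le> (B * R) * norm (z - w)"
      by (simp add: mult.assoc)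
  qed
qed

lemma one_minus_mean_square_compose_le:
  assumes h: "continuous_on (cball 0 1) h" "h holomorphic_on ball 0 1" "\<And>z. norm z \<le> 1 \<Longrightarrow> norm (h z) \<le> 1"
    and lipschitz: "\<And>z w. norm z \<le> 1 \<Longrightarrow> norm w \<le> 1 \<Longrightarrow> norm (h z - h w) \<le> L * norm (z - w)"
    and \<phi>: "\<phi> holomorphic_on ball 0 1" "\<And>z. norm z < 1 \<Longrightarrow> norm (\<phi> z) < 1" and r: "0 < r" "r < 1"
  shows "1 - mean_square (\<lambda>z. h (\<phi> z)) r
    \<le> (1 + norm (\<phi> 0)) / (1 - norm (\<phi> 0)) * (1 - mean_square h 1) + L\<^sup>2 * (1 - mean_square \<phi> r)"
proof -
  note \<phi>_cball = holomorphic_on_ball_continuous_on_cball[OF \<phi>(1) r(2)]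
  have norm_\<phi>: "norm (\<phi> z) < 1" if "norm z \<le> r" for z using \<phi>(2)[of z] that r by simp
  have norm_\<phi>_0: "norm (\<phi> 0) < 1" by (intro \<phi>) simp
  have cont_h: "continuous_on (sphere 0 1) (\<lambda>z. (norm (h z))\<^sup>2)"
    by (intro continuous_intros continuous_on_subset[OF h(1)]) auto
  have cont_\<phi>: "continuous_on (sphere 0 \<bar>r\<bar>) \<phi>"
    using r by (intro holomorphic_on_ball_continuous_on_sphere \<phi>(1)) auto
  have cont_h_\<phi>: "continuous_on (sphere 0 \<bar>r\<bar>) (\<lambda>z. h (\<phi> z))"
    using r norm_\<phi> by (intro continuous_on_compose2[OF h(1) cont_\<phi>]) (auto simp: less_imp_le)
  have "1 - poisson_integral 1 (\<lambda>\<zeta>. (norm (h \<zeta>))\<^sup>2) (\<phi> 0) = poisson_integral 1 (\<lambda>\<zeta>. 1 - (norm (h \<zeta>))\<^sup>2) (\<phi> 0)"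
    by (subst poisson_integral_diff, (intro continuous_intros cont_h norm_\<phi>_0)+)
       (simp add: poisson_integral_const norm_\<phi>_0)
  also have "\<dots> \<le> (1 + norm (\<phi> 0)) / (1 - norm (\<phi> 0)) * circ_mean (\<lambda>\<zeta>. 1 - (norm (h \<zeta>))\<^sup>2) 1"
    using h(3)
    by (intro poisson_integral_Harnack(1) continuous_on_diff continuous_on_const cont_h norm_\<phi>_0)
       (auto simp: power_le_one)
  also have "circ_mean (\<lambda>\<zeta>. 1 - (norm (h \<zeta>))\<^sup>2) 1 = 1 - mean_square h 1"
    using cont_h by (intro circ_mean_one_minus) simp
  finally have lower: "1 - (1 + norm (\<phi> 0)) / (1 - norm (\<phi> 0)) * (1 - mean_square h 1)
      \<le> poisson_integral 1 (\<lambda>\<zeta>. (norm (h \<zeta>))\<^sup>2) (\<phi> 0)" by simp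
  have "poisson_integral 1 (\<lambda>\<zeta>. (norm (h \<zeta>))\<^sup>2) (\<phi> 0)
    = circ_mean (\<lambda>z. poisson_integral 1 (\<lambda>\<zeta>. (norm (h \<zeta>))\<^sup>2) (\<phi> z)) r"
    by (rule circ_mean_poisson_integral_compose[OF r(1) \<phi>_cball(1) norm_\<phi> cont_h \<phi>_cball(2), symmetric])
  also have "\<dots> \<le> circ_mean (\<lambda>z. (norm (h (\<phi> z)))\<^sup>2 + L\<^sup>2 * (1 - (norm (\<phi> z))\<^sup>2)) r"
  proof (rule circ_mean_mono)
    show "poisson_integral 1 (\<lambda>\<zeta>. (norm (h \<zeta>))\<^sup>2) (\<phi> z) \<le> (norm (h (\<phi> z)))\<^sup>2 + L\<^sup>2 * (1 - (norm (\<phi> z))\<^sup>2)"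
      if "norm z = \<bar>r\<bar>" for z
      using that r lipschitz by (intro poisson_integral_norm_square_le_lipschitz h norm_\<phi>) auto
    show "continuous_on (sphere 0 \<bar>r\<bar>) (\<lambda>z. poisson_integral 1 (\<lambda>\<zeta>. (norm (h \<zeta>))\<^sup>2) (\<phi> z))"
      using continuous_on_poisson_integral_compose[OF r(1) \<phi>_cball(1) norm_\<phi> cont_h] r by simp
  qed (intro continuous_intros cont_h_\<phi> cont_\<phi>)
  also have "\<dots> = mean_square (\<lambda>z. h (\<phi> z)) r + L\<^sup>2 * (1 - mean_square \<phi> r)"
    by (subst circ_mean_add, (intro continuous_intros cont_h_\<phi> cont_\<phi>)+)
       (simp only: circ_mean_cmult_real
          circ_mean_one_minus[OF continuous_on_power[OF continuous_on_norm[OF cont_\<phi>]]])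
  finally show ?thesis using lower by linarith
qed

lemma mean_square_le_mean_square_diff:
  assumes u: "continuous_on (sphere 0 \<bar>r\<bar>) u" and v: "continuous_on (sphere 0 \<bar>r\<bar>) v"
    and norm_le_1: "\<And>z. norm z = \<bar>r\<bar> \<Longrightarrow> norm (u z) \<le> 1" "\<And>z. norm z = \<bar>r\<bar> \<Longrightarrow> norm (v z) \<le> 1" and e: "0 < e"
  shows "mean_square u r \<le> mean_square v r + e + mean_square (\<lambda>z. v z - u z) r / e"
proof -
  have "mean_square u r \<le> circ_mean (\<lambda>z. ((norm (v z))\<^sup>2 + e) + inverse e * (norm (v z - u z))\<^sup>2) r"
  proof (rule circ_mean_mono)
    fix z :: complex assume z: "norm z = \<bar>r\<bar>"
    define x where "x = norm (v z - u z)"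
    have "(norm (u z))\<^sup>2 - (norm (v z))\<^sup>2 = (norm (u z) - norm (v z)) * (norm (u z) + norm (v z))"
      by (simp add: power2_eq_square algebra_simps)
    also have "\<dots> \<le> x * (norm (u z) + norm (v z))"
      unfolding x_def using norm_triangle_ineq2[of "u z" "v z"]
      by (intro mult_right_mono) (auto simp: norm_minus_commute)
    also have "\<dots> \<le> x * 2" using norm_le_1[OF z] by (intro mult_left_mono) (auto simp: x_def)
    also have "x * 2 \<le> e + inverse e * x\<^sup>2"
    proof -
      have "0 \<le> (e - x)\<^sup>2 * inverse e" using e by simp
      also have "(e - x)\<^sup>2 * inverse e = e - x * 2 + inverse e * x\<^sup>2"
        using e by (simp add: power2_eq_square field_simps)
      finally show ?thesis by simp
    qed
    finally show "(norm (u z))\<^sup>2 \<le> (norm (v z))\<^sup>2 + e + inverse e * (norm (v z - u z))\<^sup>2"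
      by (simp add: x_def)
  qed (intro continuous_intros u v)+
  also have "\<dots> = mean_square v r + e + inverse e * mean_square (\<lambda>z. v z - u z) r"
    by (subst circ_mean_add, (intro continuous_intros u v)+)+ (simp only: circ_mean_cmult_real circ_mean_const)
  finally show ?thesis by (simp add: divide_inverse mult.commute)
qed

text \<open>Approximate \<open>\<psi>\<close> by the dilation \<open>h z = \<psi> (R z)\<close>, which is smooth up to the circle: \<open>h \<circ> \<phi>\<close> has a small
  defect by the Lipschitz bound, and \<open>\<psi> \<circ> \<phi> - h \<circ> \<phi>\<close> is small in mean by subordination.\<close>
lemma one_minus_mean_square_compose_dilation_le:
  assumes \<psi>: "\<psi> holomorphic_on ball 0 1" "\<And>z. norm z < 1 \<Longrightarrow> norm (\<psi> z) \<le> 1" and R: "0 < R" "R < 1"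
    and dilation: "\<And>s. sqrt R \<le> s \<Longrightarrow> s < 1 \<Longrightarrow> mean_square (\<lambda>z. \<psi> z - \<psi> (of_real R * z)) s \<le> \<epsilon>"
    and lipschitz: "\<And>z w. norm z \<le> 1 \<Longrightarrow> norm w \<le> 1 \<Longrightarrow> norm (\<psi> (of_real R * z) - \<psi> (of_real R * w)) \<le> L * norm (z - w)"
    and \<phi>: "\<phi> holomorphic_on ball 0 1" "\<And>z. norm z < 1 \<Longrightarrow> norm (\<phi> z) < 1" and r: "0 < r" "r < 1"
    and e: "0 < e"
  defines "K \<equiv> (1 + norm (\<phi> 0)) / (1 - norm (\<phi> 0))"
  shows "1 - mean_square (\<lambda>z. \<psi> (\<phi> z)) r \<le> K * (1 - mean_square \<psi> R) + L\<^sup>2 * (1 - mean_square \<phi> r) + e + K * \<epsilon> / e"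
proof -
  define h where "h z = \<psi> (of_real R * z)" for z
  have h: "continuous_on (cball 0 1) h" "h holomorphic_on ball 0 1"
    unfolding h_def using R
    by (simp_all add: continuous_on_dilation[OF holomorphic_on_imp_continuous_on[OF \<psi>(1)]]
        holomorphic_on_dilation[OF \<psi>(1)])
  have h_le: "norm (h z) \<le> 1" if "norm z \<le> 1" for z
    unfolding h_def using R that by (intro \<psi>(2) norm_of_real_mult_less_1) auto
  have "1 - mean_square (\<lambda>z. h (\<phi> z)) r \<le> K * (1 - mean_square h 1) + L\<^sup>2 * (1 - mean_square \<phi> r)"
    unfolding K_def by (rule one_minus_mean_square_compose_le[OF h h_le lipschitz[folded h_def] \<phi> r])
  also have "mean_square h 1 = mean_square \<psi> R"
    using circ_mean_dilation[of "\<lambda>z. (norm (\<psi> z))\<^sup>2" R 1] by (simp add: h_def)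
  finally have defect: "1 - mean_square (\<lambda>z. h (\<phi> z)) r \<le> K * (1 - mean_square \<psi> R) + L\<^sup>2 * (1 - mean_square \<phi> r)" .
  have "mean_square (\<lambda>z. h (\<phi> z)) r
      \<le> mean_square (\<lambda>z. \<psi> (\<phi> z)) r + e + mean_square (\<lambda>z. \<psi> (\<phi> z) - h (\<phi> z)) r / e"
    using r e \<psi>(2) \<phi>(2) holomorphic_on_ball_compose[OF h(2) \<phi>] holomorphic_on_ball_compose[OF \<psi>(1) \<phi>]
    by (intro mean_square_le_mean_square_diff holomorphic_on_ball_continuous_on_sphere h_le)
       (auto simp: less_imp_le)
  also have "mean_square (\<lambda>z. \<psi> (\<phi> z) - h (\<phi> z)) r \<le> K * \<epsilon>"
    unfolding K_def using R dilation
    by (intro littlewood_subordination[where h="\<lambda>z. \<psi> z - h z" and \<sigma>="sqrt R"] holomorphic_intros \<psi>(1) h \<phi> r)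
       (auto simp: h_def)
  finally show ?thesis using e defect by (simp add: divide_right_mono)
qed

theorem mean_inner_compose:
  assumes \<psi>: "mean_inner \<psi>" and \<phi>: "mean_inner \<phi>" "\<And>z. norm z < 1 \<Longrightarrow> norm (\<phi> z) < 1"
  shows "mean_inner (\<lambda>z. \<psi> (\<phi> z))"
proof (rule mean_innerI)
  note hol = mean_inner_holomorphic[OF \<psi>] mean_inner_holomorphic[OF \<phi>(1)]
  show "(\<lambda>z. \<psi> (\<phi> z)) holomorphic_on ball 0 1"
    by (rule holomorphic_on_ball_compose[OF hol \<phi>(2)])
  show "norm (\<psi> (\<phi> z)) \<le> 1" if "norm z < 1" for z
    using that by (intro mean_inner_norm_le_1[OF \<psi>] \<phi>(2))
  fix e :: real assume e: "0 < e" "e \<le> 1"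
  define K where "K = (1 + norm (\<phi> 0)) / (1 - norm (\<phi> 0))"
  define \<epsilon> where "\<epsilon> = e\<^sup>2 / (32 * K)"
  have "norm (\<phi> 0) < 1" by (intro \<phi>) simp
  then have K: "0 < K" by (auto simp: K_def intro!: divide_pos_pos add_pos_nonneg)
  then have \<epsilon>: "0 < \<epsilon>" and K_\<epsilon>: "K * \<epsilon> = e\<^sup>2 / 32" using e by (simp_all add: \<epsilon>_def)
  obtain R where R: "0 < R" "R < 1" and "1 - \<epsilon> < mean_square \<psi> R"
    and dilation: "\<And>s. sqrt R \<le> s \<Longrightarrow> s < 1 \<Longrightarrow> mean_square (\<lambda>z. \<psi> z - \<psi> (of_real R * z)) s \<le> 2 * \<epsilon>"
    by (rule mean_inner_dilation[OF \<psi> \<epsilon>]) (rule that)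
  then have "K * (1 - mean_square \<psi> R) \<le> K * \<epsilon>"
    using K by (intro mult_left_mono) auto
  moreover have "e\<^sup>2 \<le> e" using e by (simp add: power2_eq_square mult_left_le)
  ultimately have defect_R: "K * (1 - mean_square \<psi> R) < e / 4" using K_\<epsilon> e by linarith
  have error: "K * (2 * \<epsilon>) / (e / 4) = e / 4" using K_\<epsilon> e by (simp add: power2_eq_square field_simps)
  obtain L where lipschitz: "\<And>z w. norm z \<le> 1 \<Longrightarrow> norm w \<le> 1 \<Longrightarrow>
      norm (\<psi> (of_real R * z) - \<psi> (of_real R * w)) \<le> L * norm (z - w)"
    by (rule holomorphic_dilation_lipschitz[OF hol(1) R]) (rule that)
  have "((\<lambda>r. L\<^sup>2 * (1 - mean_square \<phi> r)) \<longlongrightarrow> L\<^sup>2 * (1 - 1)) (at_left 1)"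
    by (intro tendsto_intros mean_inner_tendsto \<phi>)
  then have "\<forall>\<^sub>F r in at_left 1. L\<^sup>2 * (1 - mean_square \<phi> r) < e / 4"
    using e by (intro order_tendstoD(2)) auto
  then show "\<forall>\<^sub>F r in at_left 1. 1 - e < mean_square (\<lambda>z. \<psi> (\<phi> z)) r"
    using eventually_at_left_1
  proof eventually_elim
    case (elim r)
    have "1 - mean_square (\<lambda>z. \<psi> (\<phi> z)) r
        \<le> K * (1 - mean_square \<psi> R) + L\<^sup>2 * (1 - mean_square \<phi> r) + e / 4 + K * (2 * \<epsilon>) / (e / 4)"
      unfolding K_def using elim(2) e
      by (intro one_minus_mean_square_compose_dilation_le hol mean_inner_norm_le_1[OF \<psi>] R dilation
          lipschitz \<phi>(2)) auto
    then show ?case using elim(1) defect_R error by linarith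
  qed
qed

section \<open>The radial maximal function\<close>

lemma integral_periodic:
  fixes g :: "real \<Rightarrow> real"
  assumes cont: "continuous_on UNIV g" and period: "\<And>x. g (x + T) = g x" and T: "0 < T"
  shows "integral {a..a+T} g = integral {0..T} g"
proof -
  interpret periodic_fun_simple g T by standard (rule period)
  have integrable: "g integrable_on {c..d}" for c d
    using cont by (meson continuous_on_subset integrable_continuous_real subset_UNIV)
  have shift: "integral {c + of_int k * T..d + of_int k * T} g = integral {c..d} g" for c d k
    using integral_shift_Icc_real[of c d g "of_int k * T"] plus_of_int[of _ k]
    by (simp add: o_def add.commute)
  define b where "b = a - of_int \<lfloor>a / T\<rfloor> * T"
  have b: "0 \<le> b" "b \<le> T"
    unfolding b_def
    using T floor_divide_lower[OF T, of a] floor_divide_upper[OF T, of a] by (auto simp: algebra_simps)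
  have "integral {a..a+T} g = integral {b..b+T} g"
    using shift[of b "\<lfloor>a / T\<rfloor>" "b + T"] by (simp add: b_def algebra_simps)
  also have "\<dots> = integral {b..T} g + integral {T..b+T} g"
    using b T integrable Henstock_Kurzweil_Integration.integral_combine[where a=b and c=T and b="b + T" and f=g]
    by simp
  also have "integral {T..b+T} g = integral {0..b} g"
    using shift[of 0 1 b] by simp
  also have "integral {b..T} g + integral {0..b} g = integral {0..T} g"
    using b integrable Henstock_Kurzweil_Integration.integral_combine[where a=0 and c=b and b=T and f=g]
    by simp
  finally show ?thesis .
qed

lemma jordan_inequality:
  assumes "0 \<le> x" "x \<le> pi / 2"
  shows "2 / pi * x \<le> sin x"
proof -
  have "convex_on {0..pi/2} (\<lambda>x. - sin x)"
    by (rule f''_ge0_imp_convex[where f'="\<lambda>x. - cos x" and f''=sin])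
       (auto intro!: derivative_eq_intros sin_ge_zero)
  from convex_onD[OF this, of "2 / pi * x" 0 "pi / 2"] show ?thesis
    using assms by (simp add: field_simps)
qed

lemma norm_cis_diff_ge:
  assumes "\<bar>x\<bar> \<le> pi" "0 \<le> \<rho>" "\<rho> \<le> 1"
  shows "\<bar>x\<bar> / 4 \<le> norm (cis x - of_real \<rho>)"
proof -
  have "\<bar>x\<bar> / 2 \<le> 2 * (2 / pi * (\<bar>x\<bar> / 2))"
    using mult_right_mono[of pi 4 "\<bar>x\<bar>"] pi_less_4 by (simp add: field_simps)
  also have "\<dots> \<le> 2 * \<bar>sin (\<bar>x\<bar> / 2)\<bar>"
    using jordan_inequality[of "\<bar>x\<bar> / 2"] assms by auto
  also have "\<dots> = norm (cis x - 1)"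
    using dist_exp_i_1[of x] by (cases "0 \<le> x") (auto simp: cis_conv_exp)
  also have "\<dots> \<le> norm (cis x - of_real \<rho>) + norm (of_real \<rho> - (1::complex))"
    using norm_triangle_ineq[of "cis x - of_real \<rho>" "of_real \<rho> - 1"] by simp
  also have "norm (of_real \<rho> - (1::complex)) = 1 - \<rho>"
    using assms
    by (metis abs_minus_commute abs_of_nonneg diff_ge_0_iff_ge norm_of_real of_real_1 of_real_diff)
  also have "1 - \<rho> \<le> norm (cis x - of_real \<rho>)"
    using norm_triangle_ineq2[of "cis x" "of_real \<rho>"] assms by simp
  finally show ?thesis by simp
qed

lemma poisson_kernel_mult:
  assumes "a \<noteq> 0"
  shows "poisson_kernel (a * \<zeta>) (a * w) = poisson_kernel \<zeta> w"
proof -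
  have "(norm (a * \<zeta> - a * w))\<^sup>2 = (norm a)\<^sup>2 * (norm (\<zeta> - w))\<^sup>2"
    by (simp only: norm_mult power_mult_distrib flip: right_diff_distrib)
  then show ?thesis
    using assms unfolding poisson_kernel_def norm_mult power_mult_distrib
    by (simp flip: right_diff_distrib)
qed

lemma poisson_kernel_cis_le_dyadic:
  assumes \<rho>: "0 \<le> \<rho>" "\<rho> < 1" and x: "\<bar>x\<bar> \<le> pi" and N: "pi \<le> 2 ^ N * (1 - \<rho>)"
  shows "poisson_kernel (cis x) (of_real \<rho>)
    \<le> (\<Sum>k\<le>N. 128 / (4 ^ k * (1 - \<rho>)) * indicator {- (2 ^ k * (1 - \<rho>))..2 ^ k * (1 - \<rho>)} x)"
proof -
  define \<delta> where "\<delta> = 1 - \<rho>"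
  have \<delta>: "0 < \<delta>" using \<rho> by (simp add: \<delta>_def)
  define k where "k = (LEAST k. \<bar>x\<bar> \<le> 2 ^ k * \<delta>)"
  have x_le_N: "\<bar>x\<bar> \<le> 2 ^ N * \<delta>" using x N by (simp add: \<delta>_def)
  have k: "\<bar>x\<bar> \<le> 2 ^ k * \<delta>" unfolding k_def by (rule LeastI) (rule x_le_N)
  have k_le_N: "k \<le> N" unfolding k_def by (rule Least_le) (rule x_le_N)
  have dist: "2 ^ k * \<delta> / 8 \<le> norm (cis x - of_real \<rho>)"
  proof (cases k)
    case 0
    then show ?thesis using norm_triangle_ineq2[of "cis x" "of_real \<rho>"] \<rho> by (simp add: \<delta>_def)
  next
    case (Suc j)
    then have "\<not> \<bar>x\<bar> \<le> 2 ^ j * \<delta>"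
      using not_less_Least[of j "\<lambda>k. \<bar>x\<bar> \<le> 2 ^ k * \<delta>"] by (simp add: k_def)
    then have "2 ^ k * \<delta> / 8 \<le> \<bar>x\<bar> / 4" using Suc by (simp add: mult.commute)
    also have "\<dots> \<le> norm (cis x - of_real \<rho>)" using norm_cis_diff_ge[OF x] \<rho> by simp
    finally show ?thesis .
  qed
  have "1 - \<rho>\<^sup>2 \<le> 2 * \<delta>"
    using \<rho> mult_left_mono[of "1 + \<rho>" 2 "1 - \<rho>"] by (simp add: \<delta>_def power2_eq_square algebra_simps)
  then have "poisson_kernel (cis x) (of_real \<rho>) \<le> (2 * \<delta>) / (2 ^ k * \<delta> / 8)\<^sup>2"
    unfolding poisson_kernel_def using dist \<delta> \<rho> by (intro frac_le power_mono) auto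
  also have "(2 ^ k * \<delta> / 8)\<^sup>2 = 4 ^ k * \<delta>\<^sup>2 / 64"
    by (simp add: power_mult_distrib power_divide power2_eq_square flip: power_mult_distrib)
  also have "2 * \<delta> / (4 ^ k * \<delta>\<^sup>2 / 64) = 128 / (4 ^ k * \<delta>) * indicator {- (2 ^ k * \<delta>)..2 ^ k * \<delta>} x"
    using k \<delta> by (simp add: abs_le_iff power2_eq_square)
  also have "\<dots> \<le> (\<Sum>k\<le>N. 128 / (4 ^ k * \<delta>) * indicator {- (2 ^ k * \<delta>)..2 ^ k * \<delta>} x)"
    using k_le_N \<delta>
    by (intro member_le_sum[of k "{..N}" "\<lambda>k. 128 / (4 ^ k * \<delta>) * indicator {- (2 ^ k * \<delta>)..2 ^ k * \<delta>} x"]) auto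
  finally show ?thesis by (simp add: \<delta>_def)
qed

lemma dyadic_multiple_between:
  fixes a \<delta> :: real
  assumes "0 < \<delta>" "\<delta> < a"
  obtains N where "a \<le> 2 ^ N * \<delta>" "2 ^ N * \<delta> \<le> 2 * a"
proof -
  define N where "N = (LEAST N. a \<le> 2 ^ N * \<delta>)"
  obtain n :: nat where "a / \<delta> < 2 ^ n" using real_arch_pow[of 2 "a / \<delta>"] by auto
  then have "a \<le> 2 ^ n * \<delta>" using assms by (simp add: field_simps)
  then have N: "a \<le> 2 ^ N * \<delta>" unfolding N_def by (rule LeastI)
  then obtain j where j: "N = Suc j" using assms by (cases N) auto
  then have "\<not> a \<le> 2 ^ j * \<delta>" using not_less_Least[of j "\<lambda>k. a \<le> 2 ^ k * \<delta>"] by (simp add: N_def)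
  then show ?thesis using that[OF N] j by simp
qed

lemma integral_mult_le_sum_intervals:
  fixes p h :: "real \<Rightarrow> real"
  assumes h: "continuous_on UNIV h" "\<And>x. 0 \<le> h x" and p: "continuous_on {a..b} p"
    and K: "finite K" "\<And>k. k \<in> K \<Longrightarrow> 0 \<le> c k"
    and p_le: "\<And>x. x \<in> {a..b} \<Longrightarrow> p x \<le> (\<Sum>k\<in>K. c k * indicator {l k..u k} x)"
  shows "integral {a..b} (\<lambda>x. p x * h x) \<le> (\<Sum>k\<in>K. c k * integral {l k..u k} h)"
proof (rule has_integral_le)
  have cont_h: "continuous_on S h" for S using h(1) by (rule continuous_on_subset) simp
  show "((\<lambda>x. if x \<in> {a..b} then p x * h x else 0) has_integral integral {a..b} (\<lambda>x. p x * h x)) UNIV"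
    unfolding has_integral_restrict_UNIV
    by (intro integrable_integral integrable_continuous_real continuous_intros p cont_h)
  show "((\<lambda>x. \<Sum>k\<in>K. c k * (if x \<in> {l k..u k} then h x else 0)) has_integral
      (\<Sum>k\<in>K. c k * integral {l k..u k} h)) UNIV"
    by (intro has_integral_sum has_integral_mult_right K(1), unfold has_integral_restrict_UNIV,
        intro integrable_integral integrable_continuous_real cont_h)
  fix x :: real
  have sum_eq: "(\<Sum>k\<in>K. c k * (if x \<in> {l k..u k} then h x else 0)) = (\<Sum>k\<in>K. c k * indicator {l k..u k} x) * h x"
    unfolding sum_distrib_right by (intro sum.cong) (auto simp: indicator_def)
  show "(if x \<in> {a..b} then p x * h x else 0) \<le> (\<Sum>k\<in>K. c k * (if x \<in> {l k..u k} then h x else 0))"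
    unfolding sum_eq
    using p_le[of x] h(2)[of x] K(2) by (auto intro!: mult_right_mono mult_nonneg_nonneg sum_nonneg)
qed

lemma integral_poisson_kernel_le_dyadic:
  fixes h :: "real \<Rightarrow> real"
  assumes h: "continuous_on UNIV h" "\<And>x. 0 \<le> h x" and \<rho>: "0 \<le> \<rho>" "\<rho> < 1" and N: "pi \<le> 2 ^ N * (1 - \<rho>)"
  shows "integral {t-pi..t+pi} (\<lambda>\<theta>. poisson_kernel (cis (\<theta> - t)) (of_real \<rho>) * h \<theta>)
    \<le> (\<Sum>k\<le>N. 128 / (4 ^ k * (1 - \<rho>)) * integral {t - 2 ^ k * (1 - \<rho>)..t + 2 ^ k * (1 - \<rho>)} h)"
proof (rule integral_mult_le_sum_intervals[OF h])
  have "cis x \<noteq> of_real \<rho>" for x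
    using \<rho> by (metis abs_of_nonneg less_irrefl norm_cis norm_of_real)
  then show "continuous_on {t-pi..t+pi} (\<lambda>\<theta>. poisson_kernel (cis (\<theta> - t)) (of_real \<rho>))"
    by (intro continuous_intros)
next
  fix \<theta> assume "\<theta> \<in> {t-pi..t+pi}"
  then have "poisson_kernel (cis (\<theta> - t)) (of_real \<rho>)
      \<le> (\<Sum>k\<le>N. 128 / (4 ^ k * (1 - \<rho>)) * indicator {- (2 ^ k * (1 - \<rho>))..2 ^ k * (1 - \<rho>)} (\<theta> - t))"
    by (intro poisson_kernel_cis_le_dyadic \<rho> N) auto
  also have "\<dots> = (\<Sum>k\<le>N. 128 / (4 ^ k * (1 - \<rho>)) * indicator {t - 2 ^ k * (1 - \<rho>)..t + 2 ^ k * (1 - \<rho>)} \<theta>)"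
    by (intro sum.cong) (auto simp: indicator_def)
  finally show "poisson_kernel (cis (\<theta> - t)) (of_real \<rho>)
      \<le> (\<Sum>k\<le>N. 128 / (4 ^ k * (1 - \<rho>)) * indicator {t - 2 ^ k * (1 - \<rho>)..t + 2 ^ k * (1 - \<rho>)} \<theta>)" .
qed (use \<rho> in auto)

lemma integral_poisson_kernel_le_averages:
  fixes h :: "real \<Rightarrow> real"
  assumes h: "continuous_on UNIV h" "\<And>x. 0 \<le> h x" and \<rho>: "0 \<le> \<rho>" "\<rho> < 1"
    and averages: "\<And>r. 0 < r \<Longrightarrow> r \<le> 2 * pi \<Longrightarrow> integral {t-r..t+r} h \<le> c * r"
  shows "integral {t-pi..t+pi} (\<lambda>\<theta>. poisson_kernel (cis (\<theta> - t)) (of_real \<rho>) * h \<theta>) \<le> 256 * c"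
proof -
  define \<delta> where "\<delta> = 1 - \<rho>"
  have \<delta>: "0 < \<delta>" "\<delta> \<le> 1" using \<rho> by (auto simp: \<delta>_def)
  have "0 \<le> integral {t-1..t+1} h"
    using h by (intro integral_nonneg integrable_continuous_real) (auto intro: continuous_on_subset)
  also have "\<dots> \<le> c * 1" using pi_gt3 by (intro averages) auto
  finally have c: "0 \<le> c" by simp
  obtain N where N: "pi \<le> 2 ^ N * \<delta>" "2 ^ N * \<delta> \<le> 2 * pi"
    by (rule dyadic_multiple_between[of \<delta> pi]) (use \<delta> pi_gt3 in auto)
  have "integral {t-pi..t+pi} (\<lambda>\<theta>. poisson_kernel (cis (\<theta> - t)) (of_real \<rho>) * h \<theta>)
      \<le> (\<Sum>k\<le>N. 128 / (4 ^ k * \<delta>) * integral {t-2^k*\<delta>..t+2^k*\<delta>} h)"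
    using N unfolding \<delta>_def by (intro integral_poisson_kernel_le_dyadic h \<rho>)
  also have "\<dots> \<le> (\<Sum>k\<le>N. 128 * c * (1/2) ^ k)"
  proof (rule sum_mono)
    fix k assume "k \<in> {..N}"
    then have "2 ^ k * \<delta> \<le> 2 ^ N * \<delta>" using \<delta> by (intro mult_right_mono power_increasing) auto
    then have "2 ^ k * \<delta> \<le> 2 * pi" using N(2) by (rule order_trans)
    then have "integral {t-2^k*\<delta>..t+2^k*\<delta>} h \<le> c * (2 ^ k * \<delta>)" using \<delta> by (intro averages) auto
    then have "128 / (4 ^ k * \<delta>) * integral {t-2^k*\<delta>..t+2^k*\<delta>} h \<le> 128 / (4 ^ k * \<delta>) * (c * (2 ^ k * \<delta>))"
      using \<delta> by (intro mult_left_mono) auto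
    also have "\<dots> = 128 * c * (1/2) ^ k"
    proof -
      have "(4::real) ^ k = 2 ^ k * 2 ^ k" by (simp flip: power_mult_distrib)
      then show ?thesis using \<delta> by (simp add: power_one_over divide_simps)
    qed
    finally show "128 / (4 ^ k * \<delta>) * integral {t-2^k*\<delta>..t+2^k*\<delta>} h \<le> 128 * c * (1/2) ^ k" .
  qed
  also have "\<dots> = 128 * c * (\<Sum>k\<le>N. (1/2) ^ k)" by (simp only: sum_distrib_left)
  also have "\<dots> \<le> 128 * c * 2"
    using c by (intro mult_left_mono) (auto simp: sum_gp0)
  finally show ?thesis by simp
qed

lemma poisson_integral_polar:
  fixes g :: "complex \<Rightarrow> real"
  assumes s: "0 < s" and \<rho>: "0 \<le> \<rho>" "\<rho> < 1" and g: "continuous_on (sphere 0 s) g"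
  shows "poisson_integral s g (of_real (s * \<rho>) * cis t)
    = integral {t-pi..t+pi} (\<lambda>\<theta>. poisson_kernel (cis (\<theta> - t)) (of_real \<rho>) * g (of_real s * cis \<theta>)) / (2 * pi)"
proof -
  let ?k = "\<lambda>\<theta>. poisson_kernel (cis (\<theta> - t)) (of_real \<rho>) * g (of_real s * cis \<theta>)"
  have "poisson_kernel (of_real s * cis \<theta>) (of_real (s * \<rho>) * cis t)
      = poisson_kernel (cis (\<theta> - t)) (of_real \<rho>)" for \<theta>
  proof -
    have polar_eq: "of_real s * cis \<theta> = (of_real s * cis t) * cis (\<theta> - t)"
      "of_real (s * \<rho>) * cis t = (of_real s * cis t) * of_real \<rho>"
      by (simp_all add: mult.assoc cis_mult)
    show ?thesis unfolding polar_eq using s by (subst poisson_kernel_mult) auto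
  qed
  then have "poisson_integral s g (of_real (s * \<rho>) * cis t) = integral {0..2*pi} ?k / (2 * pi)"
    by (simp add: poisson_integral_def circ_mean_real)
  also have "integral {0..2*pi} ?k = integral {t-pi..t-pi+2*pi} ?k"
  proof (rule integral_periodic[symmetric])
    have "cis x \<noteq> of_real \<rho>" for x
      using \<rho> by (metis abs_of_nonneg less_irrefl norm_cis norm_of_real)
    then show "continuous_on UNIV ?k"
      using s g by (intro continuous_intros continuous_on_circle_param) auto
    have "cis (x + 2 * pi) = cis x" "cis (x + 2 * pi - t) = cis (x - t)" for x
      by (simp_all add: complex_eq_iff sin_diff cos_diff)
    then show "?k (x + 2 * pi) = ?k x" for x by simp
  qed simp
  finally show ?thesis by (simp add: add.commute)
qed

lemma norm_square_le_averages:
  fixes f :: "complex \<Rightarrow> complex"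
  assumes f: "continuous_on (cball 0 s) f" "f holomorphic_on ball 0 s" and s: "0 < s" and \<rho>: "0 \<le> \<rho>" "\<rho> < 1"
    and averages: "\<And>r. 0 < r \<Longrightarrow> r \<le> 2 * pi \<Longrightarrow> integral {t-r..t+r} (\<lambda>\<theta>. (norm (f (of_real s * cis \<theta>)))\<^sup>2) \<le> c * r"
  shows "(norm (f (of_real (s * \<rho>) * cis t)))\<^sup>2 \<le> 64 * c"
proof -
  have cont_f: "continuous_on (sphere 0 s) f" using f(1) by (rule continuous_on_subset) auto
  have "(norm (f (of_real (s * \<rho>) * cis t)))\<^sup>2
      \<le> poisson_integral s (\<lambda>z. (norm (f z))\<^sup>2) (of_real (s * \<rho>) * cis t)"
    using s \<rho> by (intro norm_square_le_poisson_integral f) (simp add: norm_mult)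
  also have "\<dots> \<le> 256 * c / (2 * pi)"
  proof (subst poisson_integral_polar[OF s \<rho>])
    show "continuous_on (sphere 0 s) (\<lambda>z. (norm (f z))\<^sup>2)" by (intro continuous_intros cont_f)
    have "continuous_on UNIV (\<lambda>\<theta>. (norm (f (of_real s * cis \<theta>)))\<^sup>2)"
      using s cont_f by (intro continuous_intros continuous_on_circle_param) auto
    then have "integral {t-pi..t+pi} (\<lambda>\<theta>. poisson_kernel (cis (\<theta> - t)) (of_real \<rho>) * (norm (f (of_real s * cis \<theta>)))\<^sup>2)
        \<le> 256 * c"
      by (rule integral_poisson_kernel_le_averages[OF _ _ \<rho> averages]) auto
    then show "integral {t-pi..t+pi} (\<lambda>\<theta>. poisson_kernel (cis (\<theta> - t)) (of_real \<rho>) * (norm (f (of_real s * cis \<theta>)))\<^sup>2)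
        / (2 * pi) \<le> 256 * c / (2 * pi)"
      by (rule divide_right_mono) simp
  qed
  also have "\<dots> \<le> 64 * c"
  proof -
    have "0 \<le> integral {t-1..t+1} (\<lambda>\<theta>. (norm (f (of_real s * cis \<theta>)))\<^sup>2)"
      using cont_f s
      by (intro integral_nonneg integrable_continuous_real continuous_intros continuous_on_circle_param) auto
    then have "0 \<le> c" using averages[of 1] pi_gt3 by simp
    then show ?thesis using pi_gt3 mult_right_mono[of 2 pi c] by (simp add: field_simps)
  qed
  finally show ?thesis .
qed

lemma emeasure_UN_le_nn_integral:
  assumes "countable I" and [measurable]: "\<And>i. i \<in> I \<Longrightarrow> X i \<in> sets M"
  shows "emeasure M (\<Union>i\<in>I. X i) \<le> (\<integral>\<^sup>+i. emeasure M (X i) \<partial>count_space I)"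
proof -
  have "(\<Union>i\<in>I. X i) \<in> sets M" using assms by (intro sets.countable_UN') auto
  then have "emeasure M (\<Union>i\<in>I. X i) = (\<integral>\<^sup>+x. indicator (\<Union>i\<in>I. X i) x \<partial>M)"
    by simp
  also have "\<dots> \<le> (\<integral>\<^sup>+x. \<integral>\<^sup>+i. indicator (X i) x \<partial>count_space I \<partial>M)"
  proof (intro nn_integral_mono)
    show "indicator (\<Union>i\<in>I. X i) x \<le> (\<integral>\<^sup>+i. indicator (X i) x \<partial>count_space I)" for x
    proof (cases "x \<in> (\<Union>i\<in>I. X i)")
      case True
      then obtain j where "j \<in> I" "x \<in> X j" by blast
      then show ?thesis using nn_integral_ge_point[of j I "\<lambda>i. indicator (X i) x"] True by simp
    qed simp
  qed
  also have "\<dots> = (\<integral>\<^sup>+i. \<integral>\<^sup>+x. indicator (X i) x \<partial>M \<partial>count_space I)"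
    using assms(1) by (intro nn_integral_count_space_nn_integral) auto
  also have "\<dots> = (\<integral>\<^sup>+i. emeasure M (X i) \<partial>count_space I)"
    by (intro nn_integral_cong) simp
  finally show ?thesis .
qed

lemma emeasure_le_Vitali:
  fixes \<mu> \<nu> :: "'a::euclidean_space measure"
  assumes sets: "sets \<mu> = sets borel" "sets \<nu> = sets borel"
    and r: "\<And>x. x \<in> E \<Longrightarrow> 0 < r x \<and> r x \<le> B"
    and ball_le: "\<And>x. x \<in> E \<Longrightarrow> emeasure \<mu> (ball x (5 * r x)) \<le> emeasure \<nu> (ball x (r x))"
  shows "emeasure \<mu> E \<le> emeasure \<nu> (space \<nu>)"
proof -
  obtain C where C: "countable C" "C \<subseteq> E"
     "pairwise (\<lambda>i j. disjnt (ball i (r i)) (ball j (r j))) C" "E \<subseteq> (\<Union>i\<in>C. ball i (5 * r i))"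
    by (rule Vitali_covering_lemma_balls[where S=E and K=E and a="\<lambda>x. x" and r=r and B=B]) (use r in auto)
  have "emeasure \<mu> E \<le> emeasure \<mu> (\<Union>i\<in>C. ball i (5 * r i))"
    using C(4) by (intro emeasure_mono) (auto simp: sets intro: borel_open)
  also have "\<dots> \<le> (\<integral>\<^sup>+i. emeasure \<mu> (ball i (5 * r i)) \<partial>count_space C)"
    using C(1) by (intro emeasure_UN_le_nn_integral) (auto simp: sets)
  also have "\<dots> \<le> (\<integral>\<^sup>+i. emeasure \<nu> (ball i (r i)) \<partial>count_space C)"
    using C(2) ball_le by (intro nn_integral_mono) auto
  also have "\<dots> = emeasure \<nu> (\<Union>i\<in>C. ball i (r i))"
    using C(1,3) by (intro emeasure_UN_countable[symmetric])
      (auto simp: sets disjoint_family_on_def pairwise_def disjnt_def)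
  also have "\<dots> \<le> emeasure \<nu> (space \<nu>)"
    by (rule emeasure_space)
  finally show ?thesis .
qed

lemma nn_integral_continuous_Icc:
  fixes h :: "real \<Rightarrow> real"
  assumes "continuous_on UNIV h" "\<And>x. 0 \<le> h x"
  shows "(\<integral>\<^sup>+x. ennreal (h x) * indicator {a..b} x \<partial>lborel) = ennreal (integral {a..b} h)"
proof -
  have [measurable]: "h \<in> borel_measurable borel"
    using assms(1) by (rule borel_measurable_continuous_onI)
  have "(\<integral>\<^sup>+x. ennreal (h x) * indicator {a..b} x \<partial>lborel) = integral\<^sup>N lborel (\<lambda>x. if x \<in> {a..b} then h x else 0)"
    by (intro nn_integral_cong) (auto simp: indicator_def)
  also have "\<dots> = integral {a..b} h"
  proof (rule nn_integral_has_integral_lborel)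
    show "((\<lambda>x. if x \<in> {a..b} then h x else 0) has_integral integral {a..b} h) UNIV"
      unfolding has_integral_restrict_UNIV using assms(1)
      by (intro integrable_integral integrable_continuous_real continuous_on_subset[OF assms(1)]) auto
  qed (auto simp: assms)
  finally show ?thesis .
qed

lemma emeasure_density_ball:
  fixes h :: "real \<Rightarrow> real"
  assumes h: "continuous_on UNIV h" "\<And>x. 0 \<le> h x" and "a \<le> t - r" "t + r \<le> b"
  shows "emeasure (density lborel (\<lambda>x. ennreal (h x) * indicator {a..b} x)) (ball t r)
    = ennreal (integral {t-r..t+r} h)"
proof -
  have [measurable]: "h \<in> borel_measurable borel"
    using h(1) by (rule borel_measurable_continuous_onI)
  have "emeasure (density lborel (\<lambda>x. ennreal (h x) * indicator {a..b} x)) (ball t r)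
      = (\<integral>\<^sup>+x. ennreal (h x) * indicator {a..b} x * indicator (ball t r) x \<partial>lborel)"
    by (subst emeasure_density) auto
  also have "\<dots> = (\<integral>\<^sup>+x. ennreal (h x) * indicator {t-r..t+r} x \<partial>lborel)"
  proof (rule nn_integral_cong_AE)
    have "AE x in lborel. x \<noteq> t - r" "AE x in lborel. x \<noteq> t + r"
      by (auto intro: AE_lborel_singleton)
    then show "AE x in lborel. ennreal (h x) * indicator {a..b} x * indicator (ball t r) x
        = ennreal (h x) * indicator {t-r..t+r} x"
      by eventually_elim (use assms(3,4) in \<open>auto simp: indicator_def ball_eq_greaterThanLessThan\<close>)
  qed
  also have "\<dots> = ennreal (integral {t-r..t+r} h)"
    by (rule nn_integral_continuous_Icc[OF h])
  finally show ?thesis .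
qed

lemma weak_type_covering:
  fixes h :: "real \<Rightarrow> real"
  assumes h: "continuous_on UNIV h" "\<And>x. 0 \<le> h x" and c: "0 < c"
    and covering: "\<And>t. t \<in> E \<Longrightarrow> \<exists>r. 0 < r \<and> a \<le> t - r \<and> t + r \<le> b \<and> c * r \<le> integral {t-r..t+r} h"
  shows "emeasure lborel E \<le> ennreal (10 / c * integral {a..b} h)"
proof -
  obtain r where r: "\<And>t. t \<in> E \<Longrightarrow> 0 < r t \<and> a \<le> t - r t \<and> t + r t \<le> b \<and> c * r t \<le> integral {t-r t..t+r t} h"
    using covering by metis
  define k where "k x = 10 / c * h x" for x
  have k: "continuous_on UNIV k" "\<And>x. 0 \<le> k x"
    unfolding k_def using h c by (auto intro!: continuous_intros)
  have [measurable]: "k \<in> borel_measurable borel"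
    using k(1) by (rule borel_measurable_continuous_onI)
  define \<nu> where "\<nu> = density lborel (\<lambda>x. ennreal (k x) * indicator {a..b} x)"
  have "emeasure lborel E \<le> emeasure \<nu> (space \<nu>)"
  proof (rule emeasure_le_Vitali[where r=r and B="b - a"])
    fix t assume t: "t \<in> E"
    show "0 < r t \<and> r t \<le> b - a" using r[OF t] by linarith
    have "emeasure lborel (ball t (5 * r t)) = ennreal (10 * r t)"
      using r[OF t] by (simp add: ball_eq_greaterThanLessThan)
    also have "\<dots> \<le> ennreal (integral {t - r t..t + r t} k)"
      using r[OF t] c unfolding k_def by (intro ennreal_leI) (simp add: field_simps)
    also have "\<dots> = emeasure \<nu> (ball t (r t))"
      unfolding \<nu>_def using r[OF t] by (intro emeasure_density_ball[symmetric] k) auto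
    finally show "emeasure lborel (ball t (5 * r t)) \<le> emeasure \<nu> (ball t (r t))" .
  qed (auto simp: \<nu>_def)
  also have "emeasure \<nu> (space \<nu>) = ennreal (integral {a..b} k)"
    unfolding \<nu>_def by (simp add: emeasure_density nn_integral_continuous_Icc[OF k])
  finally show ?thesis by (simp add: k_def[abs_def])
qed

definition radial_superlevel :: "(complex \<Rightarrow> complex) \<Rightarrow> real \<Rightarrow> real \<Rightarrow> real set" where
  "radial_superlevel f s l = {t \<in> {0..2*pi}. \<exists>r\<in>{1/2<..<s}. l < norm (f (of_real r * cis t))}"

lemma radial_superlevel_sets:
  assumes f: "f holomorphic_on ball 0 1" and s: "s \<le> 1"
  shows "radial_superlevel f s l \<in> sets borel"
proof -
  have "open (\<Union>r\<in>{1/2<..<s}. {t. l < norm (f (of_real r * cis t))})"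
    using s
    by (intro open_UN ballI open_Collect_less continuous_intros continuous_on_circle_param
        holomorphic_on_ball_continuous_on_sphere[OF f]) auto
  moreover have "radial_superlevel f s l = {0..2*pi} \<inter> (\<Union>r\<in>{1/2<..<s}. {t. l < norm (f (of_real r * cis t))})"
    by (auto simp: radial_superlevel_def)
  ultimately show ?thesis by (auto intro: borel_open)
qed

lemma emeasure_radial_superlevel_le:
  assumes f: "f holomorphic_on ball 0 1" and l: "0 < l" and s: "0 < s" "s < 1"
  shows "emeasure lborel (radial_superlevel f s l) \<le> ennreal (3840 * pi / l\<^sup>2 * mean_square f s)"
proof -
  define h where "h \<theta> = (norm (f (of_real s * cis \<theta>)))\<^sup>2" for \<theta>
  have cont_h: "continuous_on UNIV h"
    unfolding h_def using s
    by (intro continuous_intros continuous_on_circle_param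
        holomorphic_on_ball_continuous_on_sphere[OF f]) auto
  have integrable: "h integrable_on {c..d}" for c d
    using cont_h by (meson continuous_on_subset integrable_continuous_real subset_UNIV)
  have "emeasure lborel (radial_superlevel f s l) \<le> ennreal (10 / (l\<^sup>2 / 64) * integral {-2*pi..4*pi} h)"
  proof (rule weak_type_covering[OF cont_h])
    fix t assume "t \<in> radial_superlevel f s l"
    then obtain r where r: "1/2 < r" "r < s" "l < norm (f (of_real r * cis t))" and t: "0 \<le> t" "t \<le> 2 * pi"
      by (auto simp: radial_superlevel_def)
    have "64 * (l\<^sup>2 / 64) < (norm (f (of_real (s * (r / s)) * cis t)))\<^sup>2"
      using r l s by (simp add: power_strict_mono)
    then have "\<exists>q. 0 < q \<and> q \<le> 2 * pi \<and> l\<^sup>2 / 64 * q < integral {t-q..t+q} h"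
      using norm_square_le_averages[OF holomorphic_on_ball_continuous_on_cball[OF f s(2)] s(1),
          of "r / s" t "l\<^sup>2 / 64"] r s
      unfolding h_def[abs_def] by fastforce
    then obtain q where "0 < q" "q \<le> 2 * pi" "l\<^sup>2 / 64 * q < integral {t-q..t+q} h"
      by blast
    then show "\<exists>q. 0 < q \<and> -2*pi \<le> t - q \<and> t + q \<le> 4*pi \<and> l\<^sup>2 / 64 * q \<le> integral {t-q..t+q} h"
      using t by (intro exI[of _ q]) auto
  qed (use l in \<open>auto simp: h_def\<close>)
  also have "integral {-2*pi..4*pi} h = integral {-2*pi..0} h + (integral {0..2*pi} h + integral {2*pi..4*pi} h)"
    using integrable Henstock_Kurzweil_Integration.integral_combine[where a="-2*pi" and c=0 and b="4*pi" and f=h]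
      Henstock_Kurzweil_Integration.integral_combine[where a=0 and c="2*pi" and b="4*pi" and f=h] by simp
  also have "\<dots> = 3 * integral {0..2*pi} h"
  proof -
    have "cis (x + 2 * pi) = cis x" for x by (simp add: complex_eq_iff)
    then have "h (x + 2 * pi) = h x" for x by (simp only: h_def)
    from integral_periodic[OF cont_h this, of "-2*pi"] integral_periodic[OF cont_h this, of "2*pi"] show ?thesis
      by simp
  qed
  also have "\<dots> = 6 * pi * mean_square f s"
    unfolding circ_mean_real h_def by simp
  finally show ?thesis using l by (simp add: field_simps)
qed

lemma emeasure_radial_superlevel_1_le:
  assumes f: "f holomorphic_on ball 0 1" and l: "0 < l" and \<sigma>: "0 < \<sigma>" "\<sigma> < 1"
    and bound: "\<And>s. \<sigma> \<le> s \<Longrightarrow> s < 1 \<Longrightarrow> mean_square f s \<le> \<epsilon>"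
  shows "emeasure lborel (radial_superlevel f 1 l) \<le> ennreal (3840 * pi / l\<^sup>2 * \<epsilon>)"
proof -
  define S where "S n = max \<sigma> (1 - 1 / real (Suc n))" for n
  have S: "\<sigma> \<le> S n" "S n < 1" for n using \<sigma> by (auto simp: S_def)
  have "radial_superlevel f 1 l = (\<Union>n. radial_superlevel f (S n) l)"
  proof (intro equalityI subsetI)
    fix t assume "t \<in> radial_superlevel f 1 l"
    then obtain r where r: "1/2 < r" "r < 1" "l < norm (f (of_real r * cis t))" "t \<in> {0..2*pi}"
      by (auto simp: radial_superlevel_def)
    obtain n where "1 / real (Suc n) < 1 - r"
      using reals_Archimedean[of "1 - r"] r by (auto simp: inverse_eq_divide)
    then have "r < S n" by (simp add: S_def)
    then show "t \<in> (\<Union>n. radial_superlevel f (S n) l)"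
      using r by (auto simp: radial_superlevel_def intro!: exI[of _ n] bexI[of _ r])
  qed (use S(2) in \<open>force simp: radial_superlevel_def intro: less_trans\<close>)
  also have "emeasure lborel \<dots> = (SUP n. emeasure lborel (radial_superlevel f (S n) l))"
  proof (rule SUP_emeasure_incseq[symmetric])
    have "S m \<le> S n" if "m \<le> n" for m n
      unfolding S_def using that by (intro max.mono diff_left_mono divide_left_mono) auto
    then show "incseq (\<lambda>n. radial_superlevel f (S n) l)"
      by (fastforce simp: incseq_def radial_superlevel_def)
    show "range (\<lambda>n. radial_superlevel f (S n) l) \<subseteq> sets lborel"
      using radial_superlevel_sets[OF f less_imp_le[OF S(2)]] by auto
  qed
  also have "\<dots> \<le> ennreal (3840 * pi / l\<^sup>2 * \<epsilon>)"
  proof (rule SUP_least)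
    fix n
    have "emeasure lborel (radial_superlevel f (S n) l) \<le> ennreal (3840 * pi / l\<^sup>2 * mean_square f (S n))"
      using S[of n] \<sigma> by (intro emeasure_radial_superlevel_le f l) auto
    also have "\<dots> \<le> ennreal (3840 * pi / l\<^sup>2 * \<epsilon>)"
      using S by (intro ennreal_leI mult_left_mono bound) auto
    finally show "emeasure lborel (radial_superlevel f (S n) l) \<le> ennreal (3840 * pi / l\<^sup>2 * \<epsilon>)" .
  qed
  finally show ?thesis .
qed

section \<open>Radial limits\<close>

lemma tendsto_if_eventually_near:
  fixes f :: "'a \<Rightarrow> 'b::complete_space"
  assumes "F \<noteq> bot" and near: "\<And>e. 0 < e \<Longrightarrow> \<exists>v. \<forall>\<^sub>F x in F. dist (f x) v < e"
  shows "\<exists>l. (f \<longlongrightarrow> l) F"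
proof -
  have "cauchy_filter (filtermap f F)"
    unfolding cauchy_filter_metric_filtermap
  proof (intro allI impI)
    fix e :: real assume "0 < e"
    then obtain v where v: "\<forall>\<^sub>F x in F. dist (f x) v < e / 2" using near[OF half_gt_zero] by blast
    have "\<forall>x y. dist (f x) v < e / 2 \<and> dist (f y) v < e / 2 \<longrightarrow> dist (f x) (f y) < e"
      using dist_triangle_half_l by blast
    with v show "\<exists>P. eventually P F \<and> (\<forall>x y. P x \<and> P y \<longrightarrow> dist (f x) (f y) < e)"
      by (intro exI[of _ "\<lambda>x. dist (f x) v < e / 2"] conjI)
  qed
  then have "\<exists>l. filtermap f F \<le> nhds l"
    by (rule cauchy_filter_complete_converges[OF _ complete_UNIV])
       (simp_all add: filtermap_bot_iff assms(1))
  then show ?thesis by (simp only: filterlim_def)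
qed

lemma radial_limit_if_dilations_near:
  assumes u: "continuous_on (ball 0 1) u" and R: "\<And>k. 0 < R k" "\<And>k. R k < 1" and \<epsilon>: "\<epsilon> \<longlonglongrightarrow> 0"
    and near: "\<forall>\<^sub>F k in sequentially. \<forall>r\<in>{1/2<..<1}.
      dist (u (of_real (R k) * (of_real r * cis t))) (u (of_real r * cis t)) \<le> \<epsilon> k"
  shows "\<exists>l. radial_limit u t l"
  unfolding radial_limit_def
proof (rule tendsto_if_eventually_near)
  fix e :: real assume e: "0 < e"
  then have "\<forall>\<^sub>F k in sequentially. \<epsilon> k < e / 2" by (intro order_tendstoD(2)[OF \<epsilon>]) simp
  from eventually_happens'[OF sequentially_bot eventually_conj[OF near this]] obtain k
    where k: "\<epsilon> k < e / 2"
      "\<forall>r\<in>{1/2<..<1}. dist (u (of_real (R k) * (of_real r * cis t))) (u (of_real r * cis t)) \<le> \<epsilon> k"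
    by blast
  have "isCont u (of_real (R k) * (of_real 1 * cis t))"
    using R[of k] by (intro continuous_on_interior[OF u]) (simp add: norm_mult)
  then have "((\<lambda>r. u (of_real (R k) * (of_real r * cis t))) \<longlongrightarrow> u (of_real (R k) * (of_real 1 * cis t))) (at_left 1)"
    by (rule isCont_tendsto_compose) (intro tendsto_intros)
  then have "\<forall>\<^sub>F r in at_left 1.
      dist (u (of_real (R k) * (of_real r * cis t))) (u (of_real (R k) * (of_real 1 * cis t))) < e / 2"
    using e by (intro tendstoD) auto
  moreover have "\<forall>\<^sub>F r in at_left 1. r \<in> {1/2<..<(1::real)}" by (rule eventually_at_left_real) simp
  ultimately have "\<forall>\<^sub>F r in at_left 1. dist (u (of_real r * cis t)) (u (of_real (R k) * (of_real 1 * cis t))) < e"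
  proof eventually_elim
    case (elim r)
    have "dist (u (of_real (R k) * (of_real r * cis t))) (u (of_real r * cis t)) < e / 2"
      using bspec[OF k(2) elim(2)] k(1) by (rule le_less_trans)
    then show ?case using elim(1) by (rule dist_triangle_half_r)
  qed
  then show "\<exists>v. \<forall>\<^sub>F r in at_left 1. dist (u (of_real r * cis t)) v < e" by (rule exI)
qed simp

lemma mean_inner_dilation_superlevel:
  assumes u: "mean_inner u" and \<epsilon>: "0 < \<epsilon>" and l: "0 < l"
  obtains R where "0 < R" "R < 1"
    "emeasure lborel (radial_superlevel (\<lambda>z. u z - u (of_real R * z)) 1 l) \<le> ennreal (7680 * pi / l\<^sup>2 * \<epsilon>)"
proof -
  obtain R where R: "0 < R" "R < 1"
    and dilation: "\<And>s. sqrt R \<le> s \<Longrightarrow> s < 1 \<Longrightarrow> mean_square (\<lambda>z. u z - u (of_real R * z)) s \<le> 2 * \<epsilon>"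
    by (rule mean_inner_dilation[OF u \<epsilon>]) (rule that)
  have "emeasure lborel (radial_superlevel (\<lambda>z. u z - u (of_real R * z)) 1 l) \<le> ennreal (3840 * pi / l\<^sup>2 * (2 * \<epsilon>))"
    using R mean_inner_holomorphic[OF u] holomorphic_on_dilation[OF mean_inner_holomorphic[OF u], of R]
    by (intro emeasure_radial_superlevel_1_le[where \<sigma>="sqrt R"] holomorphic_on_diff l dilation) auto
  then show ?thesis using that[OF R] by (simp add: mult.assoc)
qed

lemma mean_inner_dilation_superlevel_sequence:
  assumes u: "mean_inner u"
  obtains R :: "nat \<Rightarrow> real" where "\<And>k. 0 < R k" "\<And>k. R k < 1"
    "\<And>k. emeasure lborel (radial_superlevel (\<lambda>z. u z - u (of_real (R k) * z)) 1 ((1/2) ^ k))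
      \<le> ennreal (7680 * pi * (1/2) ^ k)"
proof -
  have "\<forall>k::nat. \<exists>R. 0 < R \<and> R < 1 \<and> emeasure lborel (radial_superlevel (\<lambda>z. u z - u (of_real R * z)) 1 ((1/2) ^ k))
      \<le> ennreal (7680 * pi * (1/2) ^ k)"
  proof
    fix k :: nat
    obtain R where R: "0 < R" "R < 1" "emeasure lborel (radial_superlevel (\<lambda>z. u z - u (of_real R * z)) 1 ((1/2) ^ k))
        \<le> ennreal (7680 * pi / ((1/2) ^ k)\<^sup>2 * (1/8) ^ k)"
      by (rule mean_inner_dilation_superlevel[OF u, of "(1/8) ^ k" "(1/2) ^ k"]) auto
    have "(1/8 :: real) ^ k = ((1/2) ^ k)\<^sup>2 * (1/2) ^ k"
      by (simp add: power2_eq_square flip: power_mult_distrib)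
    then have "7680 * pi / ((1/2) ^ k)\<^sup>2 * (1/8) ^ k = 7680 * pi * (1/2) ^ k" by simp
    then show "\<exists>R. 0 < R \<and> R < 1 \<and> emeasure lborel (radial_superlevel (\<lambda>z. u z - u (of_real R * z)) 1 ((1/2) ^ k))
        \<le> ennreal (7680 * pi * (1/2) ^ k)"
      using R by (intro exI[of _ R]) simp
  qed
  from choice[OF this] show ?thesis using that by blast
qed

text \<open>Borel--Cantelli for the exceptional sets of the maximal inequality applied to \<open>u - u (R \<cdot>)\<close>.\<close>
lemma mean_inner_AE_dilations_near:
  assumes u: "mean_inner u"
  obtains R :: "nat \<Rightarrow> real" where "\<And>k. 0 < R k" "\<And>k. R k < 1"
    "AE t in lborel. t \<in> {0..2*pi} \<longrightarrow> (\<forall>\<^sub>F k in sequentially. \<forall>r\<in>{1/2<..<1}.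
      dist (u (of_real (R k) * (of_real r * cis t))) (u (of_real r * cis t)) \<le> (1/2) ^ k)"
proof -
  obtain R :: "nat \<Rightarrow> real" where R: "\<And>k. 0 < R k" "\<And>k. R k < 1"
    and small: "\<And>k. emeasure lborel (radial_superlevel (\<lambda>z. u z - u (of_real (R k) * z)) 1 ((1/2) ^ k))
      \<le> ennreal (7680 * pi * (1/2) ^ k)"
    by (rule mean_inner_dilation_superlevel_sequence[OF u]) (rule that)
  define E where "E k = radial_superlevel (\<lambda>z. u z - u (of_real (R k) * z)) 1 ((1/2) ^ k)" for k
  have "AE t in lborel. \<forall>\<^sub>F k in sequentially. t \<in> space lborel - E k"
  proof (rule borel_cantelli_AE1)
    show "E k \<in> sets lborel" for k
      unfolding E_def sets_lborel
      using R[of k] mean_inner_holomorphic[OF u] holomorphic_on_dilation[OF mean_inner_holomorphic[OF u], of "R k"]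
      by (intro radial_superlevel_sets holomorphic_on_diff) auto
    show "emeasure lborel (E k) < \<infinity>" for k
      using le_less_trans[OF small[of k] ennreal_less_top] by (simp add: E_def)
    have "measure lborel (E k) \<le> 7680 * pi * (1/2) ^ k" for k
      unfolding measure_def E_def by (rule enn2real_leI[OF _ small]) simp
    then have "norm (measure lborel (E k)) \<le> 7680 * pi * (1/2) ^ k" for k by simp
    moreover have "summable (\<lambda>k. 7680 * pi * (1/2) ^ k)" by (intro summable_mult summable_geometric) simp
    ultimately show "summable (\<lambda>k. measure lborel (E k))" by (rule summable_comparison_test'[rotated])
  qed
  moreover have "dist (u (of_real (R k) * (of_real r * cis t))) (u (of_real r * cis t)) \<le> (1/2) ^ k"
    if "t \<notin> E k" "t \<in> {0..2*pi}" "r \<in> {1/2<..<1}" for t k r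
  proof -
    have "norm (u (of_real r * cis t) - u (of_real (R k) * (of_real r * cis t))) \<le> (1/2) ^ k"
      using that unfolding E_def radial_superlevel_def not_less[symmetric] by blast
    then show ?thesis by (simp only: dist_norm norm_minus_commute)
  qed
  ultimately have "AE t in lborel. t \<in> {0..2*pi} \<longrightarrow> (\<forall>\<^sub>F k in sequentially. \<forall>r\<in>{1/2<..<1}.
      dist (u (of_real (R k) * (of_real r * cis t))) (u (of_real r * cis t)) \<le> (1/2) ^ k)"
    by (elim AE_mp[OF _ AE_I2]) (auto elim!: eventually_mono)
  then show ?thesis by (rule that[OF R])
qed

lemma mean_inner_AE_radial_limit:
  assumes u: "mean_inner u"
  shows "AE t in lborel. t \<in> {0..2*pi} \<longrightarrow> (\<exists>l. radial_limit u t l)"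
proof -
  obtain R :: "nat \<Rightarrow> real" where R: "\<And>k. 0 < R k" "\<And>k. R k < 1"
    and near: "AE t in lborel. t \<in> {0..2*pi} \<longrightarrow> (\<forall>\<^sub>F k in sequentially. \<forall>r\<in>{1/2<..<1}.
      dist (u (of_real (R k) * (of_real r * cis t))) (u (of_real r * cis t)) \<le> (1/2) ^ k)"
    by (rule mean_inner_AE_dilations_near[OF u]) (rule that)
  have cont: "continuous_on (ball 0 1) u"
    by (intro holomorphic_on_imp_continuous_on mean_inner_holomorphic u)
  have half_powers: "(\<lambda>k. (1/2) ^ k :: real) \<longlonglongrightarrow> 0" by (intro LIMSEQ_realpow_zero) auto
  from near show ?thesis
  proof eventually_elim
    case (elim t)
    then show ?case by (intro impI radial_limit_if_dilations_near[where R=R, OF cont R half_powers]) blast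
  qed
qed

lemma mean_square_tendsto_boundary_integral:
  assumes u: "u holomorphic_on ball 0 1" "\<And>z. norm z < 1 \<Longrightarrow> norm (u z) \<le> 1"
    and q [measurable]: "q \<in> borel_measurable borel"
    and lim: "AE t in lborel. t \<in> {0..2*pi} \<longrightarrow> ((\<lambda>r. (norm (u (of_real r * cis t)))\<^sup>2) \<longlongrightarrow> q t) (at_left 1)"
  shows "(mean_square u \<longlongrightarrow> (\<integral>t. indicator {0..2*pi} t * q t \<partial>lborel) / (2 * pi)) (at_left 1)"
proof (rule tendsto_at_left_sequentially[of 0])
  fix S :: "nat \<Rightarrow> real" assume S: "\<And>n. S n < 1" "\<And>n. 0 < S n" "S \<longlonglongrightarrow> 1"
  then have S_left: "filterlim S (at_left 1) sequentially"
    by (auto simp: filterlim_at intro!: always_eventually less_imp_neq)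
  define g where "g n t = (norm (u (of_real (S n) * cis t)))\<^sup>2" for n t
  have cont_g: "continuous_on X (g n)" for n X
    unfolding g_def using S(1,2)[of n]
    by (intro continuous_intros continuous_on_circle_param holomorphic_on_ball_continuous_on_sphere[OF u(1)]) auto
  have [measurable]: "g n \<in> borel_measurable borel" for n
    by (intro borel_measurable_continuous_onI cont_g)
  have "(\<lambda>n. \<integral>t. indicator {0..2*pi} t * g n t \<partial>lborel) \<longlonglongrightarrow> (\<integral>t. indicator {0..2*pi} t * q t \<partial>lborel)"
  proof (rule integral_dominated_convergence[where w="indicator {0..2*pi}"])
    show "AE t in lborel. (\<lambda>n. indicator {0..2*pi} t * g n t) \<longlonglongrightarrow> indicator {0..2*pi} t * q t"
      using lim by eventually_elim (auto simp: g_def indicator_def intro: filterlim_compose[OF _ S_left])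
    show "AE t in lborel. norm (indicator {0..2*pi} t * g n t) \<le> indicator {0..2*pi} t" for n
      using S(1,2)[of n] by (intro AE_I2) (auto simp: g_def indicator_def norm_mult power_le_one u(2))
  qed auto
  moreover have "(\<integral>t. indicator {0..2*pi} t * g n t \<partial>lborel) = integral {0..2*pi} (g n)" for n
    using set_borel_integral_eq_integral(2)[OF borel_integrable_atLeastAtMost'[OF cont_g]]
    by (simp add: set_lebesgue_integral_def)
  ultimately show "(\<lambda>n. mean_square u (S n)) \<longlonglongrightarrow> (\<integral>t. indicator {0..2*pi} t * q t \<partial>lborel) / (2 * pi)"
    unfolding circ_mean_real g_def[abs_def] by (auto intro: tendsto_divide)
qed simp

theorem inner_function_imp_mean_inner:
  assumes "inner_function u"
  shows "mean_inner u"
proof -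
  have hol: "u holomorphic_on ball 0 1" and norm_le_1: "\<And>z. norm z < 1 \<Longrightarrow> norm (u z) \<le> 1"
    and unimodular: "AE t in lborel. t \<in> {0..2*pi} \<longrightarrow> (\<exists>l. radial_limit u t l \<and> norm l = 1)"
    using assms unfolding inner_function_def AE_completion_iff by auto
  have "AE t in lborel. t \<in> {0..2*pi} \<longrightarrow> ((\<lambda>r. (norm (u (of_real r * cis t)))\<^sup>2) \<longlongrightarrow> 1) (at_left 1)"
    using unimodular
  proof eventually_elim
    case (elim t)
    show ?case
    proof
      assume "t \<in> {0..2*pi}"
      then obtain l where "radial_limit u t l" "norm l = 1" using elim by blast
      then show "((\<lambda>r. (norm (u (of_real r * cis t)))\<^sup>2) \<longlongrightarrow> 1) (at_left 1)"
        unfolding radial_limit_def using tendsto_power[OF tendsto_norm, of _ l _ 2] by fastforce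
    qed
  qed
  from mean_square_tendsto_boundary_integral[OF hol norm_le_1 _ this] have "(mean_square u \<longlongrightarrow> 1) (at_left 1)"
    by simp
  then show ?thesis using hol norm_le_1 by (simp add: mean_inner_def)
qed

lemma AE_eq_1_of_integral_eq:
  fixes q :: "real \<Rightarrow> real"
  assumes "a < b" and integral_q: "(\<integral>t. indicator {a..b} t * q t \<partial>lborel) = b - a"
    and q_le: "AE t in lborel. t \<in> {a..b} \<longrightarrow> q t \<le> 1"
  shows "AE t in lborel. t \<in> {a..b} \<longrightarrow> q t = 1"
proof -
  have integrable: "integrable lborel (\<lambda>t. indicator {a..b} t * q t)"
    using integral_q not_integrable_integral_eq[of lborel "\<lambda>t. indicator {a..b} t * q t"] \<open>a < b\<close> by force
  have nonneg: "AE t in lborel. 0 \<le> indicator {a..b} t - indicator {a..b} t * q t"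
    using q_le by eventually_elim (auto simp: indicator_def)
  have "(\<integral>t. indicator {a..b} t - indicator {a..b} t * q t \<partial>lborel) = 0"
    using integral_q \<open>a < b\<close> integrable by (subst Bochner_Integration.integral_diff) auto
  then have "AE t in lborel. indicator {a..b} t - indicator {a..b} t * q t = 0"
    using \<open>a < b\<close>
    by (subst (asm) integral_nonneg_eq_0_iff_AE[OF Bochner_Integration.integrable_diff[OF _ integrable] nonneg]) auto
  then show ?thesis by eventually_elim (auto simp: indicator_def split: if_splits)
qed

lemma radial_limit_norm_square_measurable:
  assumes u: "u holomorphic_on ball 0 1"
  obtains q :: "real \<Rightarrow> real" where "q \<in> borel_measurable borel" "\<And>t l. radial_limit u t l \<Longrightarrow> q t = (norm l)\<^sup>2"
proof -
  define \<rho> where "\<rho> n = 1 - 1 / (real n + 2)" for n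
  have \<rho>: "0 < \<rho> n" "\<rho> n < 1" for n by (auto simp: \<rho>_def field_simps)
  have "\<rho> \<longlonglongrightarrow> 1" unfolding \<rho>_def by real_asymp
  then have \<rho>_left: "filterlim \<rho> (at_left 1) sequentially"
    using \<rho> by (auto simp: filterlim_at intro!: always_eventually less_imp_neq)
  define q where "q t = lim (\<lambda>n. (norm (u (of_real (\<rho> n) * cis t)))\<^sup>2)" for t
  have [measurable]: "(\<lambda>t. (norm (u (of_real (\<rho> n) * cis t)))\<^sup>2) \<in> borel_measurable borel" for n
    using \<rho>[of n] by (intro borel_measurable_continuous_onI continuous_intros continuous_on_circle_param
        holomorphic_on_ball_continuous_on_sphere[OF u]) auto
  have "q \<in> borel_measurable borel" unfolding q_def by measurable
  moreover have "q t = (norm l)\<^sup>2" if "radial_limit u t l" for t l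
  proof -
    have "(\<lambda>n. u (of_real (\<rho> n) * cis t)) \<longlonglongrightarrow> l"
      using that unfolding radial_limit_def by (rule filterlim_compose[OF _ \<rho>_left])
    then show ?thesis unfolding q_def by (intro limI tendsto_intros)
  qed
  ultimately show ?thesis by (rule that)
qed

lemma radial_limit_norm_le_1:
  assumes "\<And>z. norm z < 1 \<Longrightarrow> norm (u z) \<le> 1" "radial_limit u t l"
  shows "norm l \<le> 1"
proof (rule tendsto_upperbound[OF tendsto_norm[OF assms(2)[unfolded radial_limit_def]]])
  show "\<forall>\<^sub>F r in at_left 1. norm (u (of_real r * cis t)) \<le> 1"
    using eventually_at_left_1 by eventually_elim (auto intro!: assms(1) simp: norm_mult)
qed simp

theorem mean_inner_imp_inner_function:
  assumes u: "mean_inner u"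
  shows "inner_function u"
proof -
  note hol = mean_inner_holomorphic[OF u] and norm_le_1 = mean_inner_norm_le_1[OF u]
  obtain q :: "real \<Rightarrow> real" where q: "q \<in> borel_measurable borel" "\<And>t l. radial_limit u t l \<Longrightarrow> q t = (norm l)\<^sup>2"
    by (rule radial_limit_norm_square_measurable[OF hol]) (rule that)
  have limits: "AE t in lborel. t \<in> {0..2*pi} \<longrightarrow> (\<exists>l. radial_limit u t l)"
    by (rule mean_inner_AE_radial_limit[OF u])
  then have "AE t in lborel. t \<in> {0..2*pi} \<longrightarrow> ((\<lambda>r. (norm (u (of_real r * cis t)))\<^sup>2) \<longlongrightarrow> q t) (at_left 1)"
    by eventually_elim (use q(2) in \<open>auto simp: radial_limit_def intro!: tendsto_intros\<close>)
  from tendsto_unique[OF _ mean_square_tendsto_boundary_integral[OF hol norm_le_1 q(1) this] mean_inner_tendsto[OF u]]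
  have integral_q: "(\<integral>t. indicator {0..2*pi} t * q t \<partial>lborel) = 2 * pi - 0" by simp
  have q_le: "q t \<le> 1" if "radial_limit u t l" for t l
    using q(2)[OF that] radial_limit_norm_le_1[OF norm_le_1 that] by (simp add: power_le_one)
  have "AE t in lborel. t \<in> {0..2*pi} \<longrightarrow> q t \<le> 1"
    using limits by eventually_elim (use q_le in blast)
  then have q_eq_1: "AE t in lborel. t \<in> {0..2*pi} \<longrightarrow> q t = 1"
    by (intro AE_eq_1_of_integral_eq[OF _ integral_q]) auto
  have unimodular: "norm l = 1" if "radial_limit u t l" "q t = 1" for t l
    using q(2)[OF that(1)] that(2) power2_eq_imp_eq[of "norm l" 1] by simp
  have "AE t in lborel. t \<in> {0..2*pi} \<longrightarrow> (\<exists>l. radial_limit u t l \<and> norm l = 1)"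
    using q_eq_1 limits by eventually_elim (use unimodular in blast)
  then show ?thesis
    unfolding inner_function_def using hol norm_le_1 by (auto intro: AE_completion)
qed

section \<open>Dynamics near a parabolic Denjoy--Wolff point\<close>

lemma angular_limit_radial:
  assumes "angular_limit g w l" "norm w = 1"
  shows "((\<lambda>r. g (of_real r * w)) \<longlongrightarrow> l) (at_left 1)"
proof -
  have "filterlim (\<lambda>r. of_real r * w) (at w within stolz_angle w 2) (at_left 1)"
    unfolding filterlim_at
  proof
    show "\<forall>\<^sub>F r in at_left 1. of_real r * w \<in> stolz_angle w 2 \<and> of_real r * w \<noteq> w"
      using eventually_at_left_1
    proof eventually_elim
      case (elim r)
      have "norm (w - of_real r * w) = norm (of_real (1 - r) * w)" by (simp add: algebra_simps)
      also have "\<dots> = 1 - r" using elim assms(2) by (simp only: norm_mult norm_of_real) simp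
      finally have "norm (w - of_real r * w) = 1 - r" .
      then show ?case using elim assms(2) by (auto simp: stolz_angle_def norm_mult)
    qed
    have "((\<lambda>r. of_real r * w) \<longlongrightarrow> of_real 1 * w) (at_left 1)" by (intro tendsto_intros)
    then show "((\<lambda>r. of_real r * w) \<longlongrightarrow> w) (at_left 1)" by simp
  qed
  moreover have "(g \<longlongrightarrow> l) (at w within stolz_angle w 2)" using assms(1) by (simp add: angular_limit_def)
  ultimately show ?thesis by (rule filterlim_compose[rotated])
qed

locale parabolic_self_map =
  fixes \<phi> :: "complex \<Rightarrow> complex" and w :: complex
  assumes self_map: "self_map_disk \<phi>" and w: "norm w = 1" and deriv_w: "angular_derivative \<phi> w 1"
begin

lemma holomorphic: "\<phi> holomorphic_on ball 0 1"
  and norm_less_1: "norm z < 1 \<Longrightarrow> norm (\<phi> z) < 1"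
  using self_map by (auto simp: self_map_disk_def image_subset_iff)

lemma norm_iterate_less_1: "norm z < 1 \<Longrightarrow> norm ((\<phi> ^^ n) z) < 1"
  by (induction n) (auto intro: norm_less_1)

lemma holomorphic_iterate: "(\<lambda>z. (\<phi> ^^ n) z) holomorphic_on ball 0 1"
proof (induction n)
  case (Suc n)
  then show ?case
    using holomorphic_on_ball_compose[OF holomorphic Suc norm_iterate_less_1] by simp
qed (simp add: holomorphic_on_id[unfolded id_def])

lemma mean_inner_iterate:
  assumes "mean_inner \<phi>"
  shows "mean_inner (\<lambda>z. (\<phi> ^^ n) z)"
proof (induction n)
  case (Suc n)
  then show ?case using mean_inner_compose[OF assms Suc norm_iterate_less_1] by simp
qed (simp add: mean_inner_id)

definition half_plane_coord :: "complex \<Rightarrow> complex" where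
  "half_plane_coord z = cayley_inv (z / w)"

lemma norm_divide_w: "norm (z / w) = norm z"
  by (simp add: norm_divide w)

lemma half_plane_coord_eq: "half_plane_coord z = \<i> * (w + z) / (w - z)"
proof -
  have "w \<noteq> 0" using w by auto
  then have "1 + z / w = (w + z) / w" "1 - z / w = (w - z) / w" by (simp_all add: field_simps)
  then show ?thesis using \<open>w \<noteq> 0\<close> by (simp add: half_plane_coord_def cayley_inv_def)
qed

lemma half_plane_coord_radial:
  assumes "r < 1"
  shows "half_plane_coord (of_real r * w) = \<i> * of_real ((1 + r) / (1 - r))"
  using w by (auto simp: half_plane_coord_def cayley_inv_def)

lemma Im_half_plane_coord_pos: "norm z < 1 \<Longrightarrow> 0 < Im (half_plane_coord z)"
  unfolding half_plane_coord_def by (intro Im_cayley_inv_pos) (simp only: norm_divide_w)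

lemma holomorphic_half_plane_coord:
  assumes "f holomorphic_on S" "\<And>z. z \<in> S \<Longrightarrow> norm (f z) < 1"
  shows "(\<lambda>z. half_plane_coord (f z)) holomorphic_on S"
  unfolding half_plane_coord_def using assms w
  by (intro holomorphic_on_cayley_inv holomorphic_intros) (auto simp: norm_divide)

lemma half_plane_dist_coord:
  assumes "norm z < 1" "norm a < 1"
  shows "half_plane_dist (half_plane_coord z) (half_plane_coord a) = pseudo_hyp z a"
proof -
  have "pseudo_hyp (z / w) (a / w) = pseudo_hyp z a"
  proof -
    have "cnj (a / w) * (z / w) = cnj a * z / (w * cnj w)" by simp
    also have "w * cnj w = 1" using complex_norm_square[of w] w by simp
    finally have "cnj (a / w) * (z / w) = cnj a * z" by simp
    then show ?thesis unfolding pseudo_hyp_def norm_divide diff_divide_distrib[symmetric] w by simp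
  qed
  then show ?thesis
    unfolding half_plane_coord_def
    using half_plane_dist_cayley_inv[of "z / w" "a / w"] assms by (simp add: norm_divide_w)
qed

lemma Schwarz_Pick_coord:
  assumes "norm z < 1" "norm a < 1"
  shows "half_plane_dist (half_plane_coord (\<phi> z)) (half_plane_coord (\<phi> a)) \<le> pseudo_hyp z a"
  by (rule Schwarz_Pick_half_plane[OF holomorphic_half_plane_coord[OF holomorphic]])
     (auto intro: Im_half_plane_coord_pos norm_less_1 assms)

lemma Schwarz_Pick:
  assumes "norm z < 1" "norm a < 1"
  shows "pseudo_hyp (\<phi> z) (\<phi> a) \<le> pseudo_hyp z a"
  using Schwarz_Pick_coord[OF assms] half_plane_dist_coord[of "\<phi> z" "\<phi> a"] assms norm_less_1 by simp

lemma radial_quotient: "((\<lambda>r. (\<phi> (of_real r * w) - w) / (of_real r * w - w)) \<longlongrightarrow> 1) (at_left 1)"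
  and radial_value: "((\<lambda>r. \<phi> (of_real r * w)) \<longlongrightarrow> w) (at_left 1)"
  using deriv_w unfolding angular_derivative_def
  by (auto intro: angular_limit_radial[OF _ w, of "\<lambda>z. (\<phi> z - w) / (z - w)"] angular_limit_radial[OF _ w, of \<phi>])

lemma half_plane_coord_image_radial:
  "((\<lambda>r. of_real ((1 - r) / (1 + r)) * half_plane_coord (\<phi> (of_real r * w))) \<longlongrightarrow> \<i>) (at_left 1)"
proof -
  have w_nonzero: "w \<noteq> 0" using w by auto
  have "((\<lambda>r. \<i> * ((w + \<phi> (of_real r * w)) / (w * (1 + of_real r)))
      * inverse ((\<phi> (of_real r * w) - w) / (of_real r * w - w)))
    \<longlongrightarrow> \<i> * ((w + w) / (w * (1 + of_real 1))) * inverse 1) (at_left 1)"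
    using w_nonzero by (intro tendsto_intros radial_quotient radial_value) auto
  also have "\<i> * ((w + w) / (w * (1 + of_real 1))) * inverse 1 = \<i>" using w_nonzero by auto
  finally show ?thesis
  proof (rule Lim_transform_eventually)
    show "\<forall>\<^sub>F r in at_left 1. \<i> * ((w + \<phi> (of_real r * w)) / (w * (1 + of_real r)))
        * inverse ((\<phi> (of_real r * w) - w) / (of_real r * w - w))
       = of_real ((1 - r) / (1 + r)) * half_plane_coord (\<phi> (of_real r * w))"
      using eventually_at_left_1
    proof eventually_elim
      case (elim r)
      define p where "p = \<phi> (of_real r * w)"
      have "norm p < 1" unfolding p_def using elim w by (intro norm_less_1) (simp add: norm_mult)
      then have w_neq_p: "w - p \<noteq> 0" using w by auto
      have r_neq: "1 + complex_of_real r \<noteq> 0" using elim by (auto simp: complex_eq_iff)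
      have "inverse ((p - w) / (of_real r * w - w)) = (- (w * (1 - of_real r))) / (- (w - p))"
        by (simp add: algebra_simps)
      then have "inverse ((p - w) / (of_real r * w - w)) = w * (1 - of_real r) / (w - p)"
        unfolding minus_divide_divide .
      then show ?case
        unfolding p_def[symmetric] half_plane_coord_eq using w_nonzero w_neq_p r_neq by (simp add: mult_ac)
    qed
  qed
qed

lemma Schwarz_Pick_radial:
  assumes z: "norm z < 1" and r: "0 < r" "r < 1"
  defines "t \<equiv> (1 - r) / (1 + r)"
  defines "\<alpha> \<equiv> of_real t * half_plane_coord (\<phi> (of_real r * w))"
  shows "Im (half_plane_coord z) / (norm (of_real t * half_plane_coord z + \<i>))\<^sup>2
    \<le> Im (half_plane_coord (\<phi> z)) * Im \<alpha> / (norm (of_real t * half_plane_coord (\<phi> z) - cnj \<alpha>))\<^sup>2"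
proof -
  let ?\<zeta> = "half_plane_coord z" and ?\<omega> = "half_plane_coord (\<phi> z)"
  have t: "0 < t" "t * ((1 + r) / (1 - r)) = 1" using r by (simp_all add: t_def)
  have norm_rw: "norm (of_real r * w) < 1" using r w by (simp add: norm_mult)
  have Im_scale: "Im (of_real t * \<zeta>) = t * Im \<zeta>" for \<zeta> by simp
  have Im_pos: "0 < Im (of_real t * ?\<zeta>)" "0 < Im (of_real t * ?\<omega>)" "0 < Im \<alpha>"
    unfolding \<alpha>_def using t(1) Im_half_plane_coord_pos norm_less_1 z norm_rw by simp_all
  have "complex_of_real t * of_real ((1 + r) / (1 - r)) = 1"
    unfolding of_real_mult[symmetric] t(2) by simp
  then have coord_r: "of_real t * half_plane_coord (of_real r * w) = \<i>"
    using half_plane_coord_radial[OF r(2)] by (metis mult.left_commute mult.right_neutral)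
  have "half_plane_dist (of_real t * ?\<omega>) \<alpha> \<le> pseudo_hyp z (of_real r * w)"
    unfolding \<alpha>_def using t(1) by (subst half_plane_dist_scale) (auto intro: Schwarz_Pick_coord z norm_rw)
  also have "\<dots> = half_plane_dist (of_real t * ?\<zeta>) \<i>"
    unfolding coord_r[symmetric]
    using t(1) by (simp add: half_plane_dist_scale half_plane_dist_coord z norm_rw)
  finally have "Im (of_real t * ?\<zeta>) * Im \<i> / (norm (of_real t * ?\<zeta> - cnj \<i>))\<^sup>2
      \<le> Im (of_real t * ?\<omega>) * Im \<alpha> / (norm (of_real t * ?\<omega> - cnj \<alpha>))\<^sup>2"
    using Im_pos by (intro half_plane_dist_le_imp) auto
  then have "t * (Im ?\<zeta> / (norm (of_real t * ?\<zeta> + \<i>))\<^sup>2) \<le> t * (Im ?\<omega> * Im \<alpha> / (norm (of_real t * ?\<omega> - cnj \<alpha>))\<^sup>2)"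
    unfolding Im_scale by (simp add: mult.assoc)
  then show ?thesis using t(1) by (rule mult_left_le_imp_le)
qed

text \<open>Let \<open>r \<longlonglongrightarrow> 1\<close> in the Schwarz--Pick inequality between \<open>z\<close> and \<open>r w\<close>.\<close>
lemma Julia:
  assumes z: "norm z < 1"
  shows "Im (half_plane_coord z) \<le> Im (half_plane_coord (\<phi> z))"
proof -
  let ?\<zeta> = "half_plane_coord z" and ?\<omega> = "half_plane_coord (\<phi> z)"
  define t where "t r = (1 - r) / (1 + r)" for r :: real
  define \<alpha> where "\<alpha> r = of_real (t r) * half_plane_coord (\<phi> (of_real r * w))" for r :: real
  have "(t \<longlongrightarrow> (1 - 1) / (1 + 1)) (at_left 1)" unfolding t_def by (intro tendsto_intros) auto
  then have t_tendsto: "(t \<longlongrightarrow> 0) (at_left 1)" by simp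
  have \<alpha>_tendsto: "(\<alpha> \<longlongrightarrow> \<i>) (at_left 1)"
    unfolding \<alpha>_def t_def by (rule half_plane_coord_image_radial)
  have "Im ?\<zeta> / (norm (of_real 0 * ?\<zeta> + \<i>))\<^sup>2 \<le> Im ?\<omega> * Im \<i> / (norm (of_real 0 * ?\<omega> - cnj \<i>))\<^sup>2"
  proof (rule tendsto_le)
    show "((\<lambda>r. Im ?\<zeta> / (norm (of_real (t r) * ?\<zeta> + \<i>))\<^sup>2) \<longlongrightarrow> Im ?\<zeta> / (norm (of_real 0 * ?\<zeta> + \<i>))\<^sup>2) (at_left 1)"
      by (intro tendsto_intros t_tendsto) auto
    show "((\<lambda>r. Im ?\<omega> * Im (\<alpha> r) / (norm (of_real (t r) * ?\<omega> - cnj (\<alpha> r)))\<^sup>2)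
        \<longlongrightarrow> Im ?\<omega> * Im \<i> / (norm (of_real 0 * ?\<omega> - cnj \<i>))\<^sup>2) (at_left 1)"
      by (intro tendsto_intros t_tendsto \<alpha>_tendsto) auto
    show "\<forall>\<^sub>F r in at_left 1. Im ?\<zeta> / (norm (of_real (t r) * ?\<zeta> + \<i>))\<^sup>2
        \<le> Im ?\<omega> * Im (\<alpha> r) / (norm (of_real (t r) * ?\<omega> - cnj (\<alpha> r)))\<^sup>2"
      using eventually_at_left_1
      by eventually_elim (auto simp: \<alpha>_def t_def intro: Schwarz_Pick_radial[OF z, simplified])
  qed simp
  then show ?thesis by simp
qed

lemma radial_displacement: "((\<lambda>r. pseudo_hyp (\<phi> (of_real r * w)) (of_real r * w)) \<longlongrightarrow> 0) (at_left 1)"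
proof (rule tendsto_sandwich[where f="\<lambda>_. 0"])
  show "((\<lambda>r. norm ((\<phi> (of_real r * w) - w) / (of_real r * w - w) - 1)) \<longlongrightarrow> 0) (at_left 1)"
    using tendsto_norm[OF tendsto_diff[OF radial_quotient tendsto_const[of 1]]] by simp
  show "\<forall>\<^sub>F r in at_left 1. pseudo_hyp (\<phi> (of_real r * w)) (of_real r * w)
      \<le> norm ((\<phi> (of_real r * w) - w) / (of_real r * w - w) - 1)"
    using eventually_at_left_1
  proof eventually_elim
    case (elim r)
    define a where "a = of_real r * w"
    have norm_a: "norm a = r" using elim w by (simp add: a_def norm_mult)
    then have a: "norm a < 1" using elim by simp
    have "norm (cnj a * \<phi> a) \<le> r * 1"
      unfolding norm_mult using norm_less_1[OF a] norm_a elim by (intro mult_mono) auto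
    then have denominator_ge: "1 - r \<le> norm (1 - cnj a * \<phi> a)"
      using norm_triangle_ineq2[of 1 "cnj a * \<phi> a"] by simp
    have "a - w = of_real (r - 1) * w" by (simp add: a_def left_diff_distrib)
    then have norm_a_w: "norm (a - w) = 1 - r" using elim w by (simp only: norm_mult norm_of_real) simp
    have "pseudo_hyp (\<phi> a) a \<le> norm (\<phi> a - a) / (1 - r)"
      unfolding pseudo_hyp_def norm_divide norm_minus_commute[of a]
      using denominator_ge elim by (intro divide_left_mono mult_pos_pos) auto
    also have "\<dots> = norm ((\<phi> a - a) / (a - w))" by (simp add: norm_divide norm_a_w)
    also have "(\<phi> a - a) / (a - w) = (\<phi> a - w) / (a - w) - 1"
    proof -
      have "a - w \<noteq> 0" using norm_a_w elim by auto
      then show ?thesis by (simp add: field_simps)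
    qed
    finally show ?case by (simp add: a_def)
  qed
qed (auto simp: pseudo_hyp_def)

text \<open>Otherwise \<open>G\<close> would be, up to a translation, a semiconjugacy to \<open>\<zeta> \<mapsto> \<mu> \<zeta>\<close>, which moves all points by a
  hyperbolic distance bounded below, while \<open>\<phi>\<close> hardly moves \<open>r w\<close> for \<open>r\<close> close to \<open>1\<close>.\<close>
lemma multiplier_eq_1:
  assumes G: "G holomorphic_on ball 0 1" "\<And>z. norm z < 1 \<Longrightarrow> 0 < Im (G z)"
    and G_\<phi>: "\<And>z. norm z < 1 \<Longrightarrow> G (\<phi> z) = of_real \<mu> * G z + of_real d" and \<mu>: "1 \<le> \<mu>"
  shows "\<mu> = 1"
proof (rule ccontr)
  assume "\<mu> \<noteq> 1"
  then have \<mu>1: "1 < \<mu>" using \<mu> by simp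
  define H where "H z = G z + of_real (d / (\<mu> - 1))" for z
  have H: "H holomorphic_on ball 0 1" "\<And>z. norm z < 1 \<Longrightarrow> 0 < Im (H z)"
    unfolding H_def using G by (auto intro!: holomorphic_intros)
  have "d + d / (\<mu> - 1) = \<mu> * (d / (\<mu> - 1))" using \<mu>1 by (simp add: field_simps)
  then have "complex_of_real d + of_real (d / (\<mu> - 1)) = of_real \<mu> * of_real (d / (\<mu> - 1))"
    by (metis of_real_add of_real_mult)
  then have H_\<phi>: "H (\<phi> z) = of_real \<mu> * H z" if "norm z < 1" for z
    unfolding H_def G_\<phi>[OF that] distrib_left by (simp only: add.assoc)
  have "(\<mu> - 1) / (\<mu> + 1) \<le> 0"
  proof (rule tendsto_lowerbound[OF radial_displacement])
    show "\<forall>\<^sub>F r in at_left 1. (\<mu> - 1) / (\<mu> + 1) \<le> pseudo_hyp (\<phi> (of_real r * w)) (of_real r * w)"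
      using eventually_at_left_1
    proof eventually_elim
      case (elim r)
      then have a: "norm (of_real r * w) < 1" using w by (simp add: norm_mult)
      have "(\<mu> - 1) / (\<mu> + 1) \<le> half_plane_dist (of_real \<mu> * H (of_real r * w)) (H (of_real r * w))"
        by (rule half_plane_dist_dilation_ge[OF H(2)[OF a] \<mu>1])
      also have "\<dots> \<le> pseudo_hyp (\<phi> (of_real r * w)) (of_real r * w)"
        unfolding H_\<phi>[OF a, symmetric] by (rule Schwarz_Pick_half_plane[OF H norm_less_1[OF a] a])
      finally show ?case .
    qed
  qed simp
  then show False using \<mu>1 by (simp add: divide_le_0_iff)
qed

end

text \<open>The inequality bounds \<open>|1 - \<beta> F|\<close> by a multiple of \<open>|1 - F|\<close>, which is arbitrarily small.\<close>
lemma rotation_eq_1_if_Im_le: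
  assumes F: "mean_inner F" "\<And>z. norm z < 1 \<Longrightarrow> norm (F z) < 1" and \<beta>: "norm \<beta> = 1" and \<mu>: "0 \<le> \<mu>"
    and Im_le: "\<And>z. norm z < 1 \<Longrightarrow> Im (cayley_inv (F z)) \<le> \<mu> * Im (cayley_inv (\<beta> * F z))"
  shows "\<beta> = 1"
proof (rule ccontr)
  assume "\<beta> \<noteq> 1"
  then obtain z where z: "norm z < 1" and near: "norm (1 - F z) < norm (1 - \<beta>) / (sqrt \<mu> + 1)"
    using mean_inner_approaches_circle[OF F, of 1 "norm (1 - \<beta>) / (sqrt \<mu> + 1)"] \<mu>
    by (auto simp: add_nonneg_pos)
  have defect_pos: "0 < 1 - (norm (F z))\<^sup>2" using F(2)[OF z] by (simp add: power_less_one_iff)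
  have "norm (\<beta> * F z) < 1" using F(2)[OF z] \<beta> by (simp add: norm_mult)
  then have denominators_pos: "0 < (norm (1 - F z))\<^sup>2" "0 < (norm (1 - \<beta> * F z))\<^sup>2" using F(2)[OF z] by auto
  have "(1 - (norm (F z))\<^sup>2) / (norm (1 - F z))\<^sup>2 \<le> \<mu> * ((1 - (norm (F z))\<^sup>2) / (norm (1 - \<beta> * F z))\<^sup>2)"
    using Im_le[OF z] \<beta> by (simp add: Im_cayley_inv poisson_kernel_def norm_mult)
  then have "(1 - (norm (F z))\<^sup>2) * (norm (1 - \<beta> * F z))\<^sup>2 \<le> (1 - (norm (F z))\<^sup>2) * (\<mu> * (norm (1 - F z))\<^sup>2)"
    using denominators_pos by (simp add: field_simps)
  then have "(norm (1 - \<beta> * F z))\<^sup>2 \<le> \<mu> * (norm (1 - F z))\<^sup>2"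
    using defect_pos by (simp only: mult_le_cancel_left_pos)
  then have "(norm (1 - \<beta> * F z))\<^sup>2 \<le> (sqrt \<mu> * norm (1 - F z))\<^sup>2"
    using \<mu> by (simp add: power_mult_distrib)
  then have "norm (1 - \<beta> * F z) \<le> sqrt \<mu> * norm (1 - F z)"
    by (rule power2_le_imp_le) (simp add: \<mu>)
  moreover have "norm (\<beta> * F z - \<beta>) = norm (1 - F z)"
  proof -
    have "\<beta> * F z - \<beta> = \<beta> * (F z - 1)" by (simp add: algebra_simps)
    then show ?thesis using \<beta> by (simp add: norm_mult norm_minus_commute)
  qed
  moreover have "norm (1 - \<beta>) \<le> norm (1 - \<beta> * F z) + norm (\<beta> * F z - \<beta>)"
    using norm_triangle_ineq[of "1 - \<beta> * F z" "\<beta> * F z - \<beta>"] by simp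
  ultimately have "norm (1 - \<beta>) \<le> norm (1 - F z) * (sqrt \<mu> + 1)" by (simp add: algebra_simps)
  moreover have "norm (1 - F z) * (sqrt \<mu> + 1) < norm (1 - \<beta>)"
    using near \<mu> by (subst (asm) pos_less_divide_eq) (auto intro: add_nonneg_pos)
  ultimately show False by simp
qed

lemma Montel_disk_maps:
  fixes X :: "nat \<Rightarrow> complex \<Rightarrow> complex"
  assumes "\<And>n. X n holomorphic_on ball 0 1" "\<And>n z. norm z < 1 \<Longrightarrow> norm (X n z) < 1"
  obtains F \<sigma> where "F holomorphic_on ball 0 1" "strict_mono (\<sigma> :: nat \<Rightarrow> nat)"
    "\<And>z. norm z < 1 \<Longrightarrow> (\<lambda>k. X (\<sigma> k) z) \<longlonglongrightarrow> F z"
proof (rule Montel[of "ball 0 1" "range X" X])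
  show "h holomorphic_on ball 0 1" if "h \<in> range X" for h using assms(1) that by auto
  show "\<exists>B. \<forall>h\<in>range X. \<forall>z\<in>K. norm (h z) \<le> B" if "K \<subseteq> ball 0 1" for K
    using assms(2) that by (intro exI[of _ 1]) (auto simp: subset_iff less_imp_le)
qed (auto intro: that)

locale parabolic_positive_step = parabolic_self_map +
  fixes z0 :: complex and L :: real
  assumes z0: "norm z0 < 1" and L: "0 < L"
    and step: "(\<lambda>n. pseudo_hyp ((\<phi> ^^ n) z0) ((\<phi> ^^ Suc n) z0)) \<longlonglongrightarrow> L"
begin

definition orbit :: "nat \<Rightarrow> complex" where
  "orbit n = half_plane_coord ((\<phi> ^^ n) z0)"

definition half_plane_iterate :: "nat \<Rightarrow> complex \<Rightarrow> complex" where
  "half_plane_iterate n z = (half_plane_coord ((\<phi> ^^ n) z) - of_real (Re (orbit n))) / of_real (Im (orbit n))"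

definition disk_iterate :: "nat \<Rightarrow> complex \<Rightarrow> complex" where
  "disk_iterate n z = cayley (half_plane_iterate n z)"

lemma Im_orbit_pos: "0 < Im (orbit n)"
  unfolding orbit_def by (intro Im_half_plane_coord_pos norm_iterate_less_1 z0)

lemma Im_half_plane_iterate: "Im (half_plane_iterate n z) = Im (half_plane_coord ((\<phi> ^^ n) z)) / Im (orbit n)"
  by (simp add: half_plane_iterate_def)

lemma Im_half_plane_iterate_pos: "norm z < 1 \<Longrightarrow> 0 < Im (half_plane_iterate n z)"
  unfolding Im_half_plane_iterate
  by (intro divide_pos_pos Im_orbit_pos Im_half_plane_coord_pos norm_iterate_less_1)

lemma half_plane_iterate_z0: "half_plane_iterate n z0 = \<i>"
  using Im_orbit_pos[of n] by (simp add: half_plane_iterate_def complex_eq_iff flip: orbit_def)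

lemma half_plane_iterate_compose:
  "half_plane_iterate n (\<phi> z) = of_real (Im (half_plane_iterate n (\<phi> z0))) * half_plane_iterate (Suc n) z
    + of_real (Re (half_plane_iterate n (\<phi> z0)))"
proof -
  let ?x = "\<lambda>n. complex_of_real (Re (orbit n))" and ?y = "\<lambda>n. complex_of_real (Im (orbit n))"
  have affine: "half_plane_iterate n (\<phi> z) = of_real (Im (orbit (Suc n)) / Im (orbit n))
        * half_plane_iterate (Suc n) z
      + of_real ((Re (orbit (Suc n)) - Re (orbit n)) / Im (orbit n))" for z
  proof -
    have "half_plane_coord ((\<phi> ^^ n) (\<phi> z)) = ?y (Suc n) * half_plane_iterate (Suc n) z + ?x (Suc n)"
      using Im_orbit_pos[of "Suc n"] by (simp add: half_plane_iterate_def funpow_swap1)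
    then show ?thesis
      by (simp add: half_plane_iterate_def[of n] add_divide_distrib diff_divide_distrib)
  qed
  show ?thesis using affine[of z] affine[of z0] by (simp add: half_plane_iterate_z0)
qed

lemma Im_half_plane_iterate_mono:
  assumes "norm z < 1"
  shows "Im (half_plane_iterate n z) \<le> Im (half_plane_iterate n (\<phi> z))"
  unfolding Im_half_plane_iterate funpow_swap1[symmetric]
  using Im_orbit_pos by (intro divide_right_mono Julia norm_iterate_less_1 assms) (auto intro: less_imp_le)

lemma holomorphic_disk_iterate: "disk_iterate n holomorphic_on ball 0 1"
  unfolding disk_iterate_def
proof (rule holomorphic_on_cayley)
  show "half_plane_iterate n holomorphic_on ball 0 1"
    unfolding half_plane_iterate_def using Im_orbit_pos[of n]
    by (intro holomorphic_intros holomorphic_half_plane_coord holomorphic_iterate)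
       (auto intro: norm_iterate_less_1)
qed (simp add: Im_half_plane_iterate_pos)

lemma norm_disk_iterate_less_1: "norm z < 1 \<Longrightarrow> norm (disk_iterate n z) < 1"
  unfolding disk_iterate_def by (intro norm_cayley_less_1 Im_half_plane_iterate_pos)

lemma disk_iterate_z0: "disk_iterate n z0 = 0"
  by (simp add: disk_iterate_def half_plane_iterate_z0 cayley_def)

lemma cayley_inv_disk_iterate: "norm z < 1 \<Longrightarrow> cayley_inv (disk_iterate n z) = half_plane_iterate n z"
  unfolding disk_iterate_def by (intro cayley_inv_cayley Im_half_plane_iterate_pos)

lemma norm_disk_iterate:
  assumes "norm z < 1"
  shows "norm (disk_iterate n z) = pseudo_hyp ((\<phi> ^^ n) z) ((\<phi> ^^ n) z0)"
proof -
  have "norm (disk_iterate n z) = half_plane_dist (half_plane_coord ((\<phi> ^^ n) z)) (orbit n)"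
    unfolding disk_iterate_def half_plane_iterate_def cayley_normalize[OF Im_orbit_pos] half_plane_dist_def ..
  then show ?thesis by (simp add: orbit_def half_plane_dist_coord norm_iterate_less_1 assms z0)
qed

lemma norm_disk_iterate_antimono:
  assumes "norm z < 1" "n \<le> m"
  shows "norm (disk_iterate m z) \<le> norm (disk_iterate n z)"
  using assms(2) unfolding norm_disk_iterate[OF assms(1)]
proof (induction m rule: dec_induct)
  case (step m)
  have "pseudo_hyp ((\<phi> ^^ Suc m) z) ((\<phi> ^^ Suc m) z0) \<le> pseudo_hyp ((\<phi> ^^ m) z) ((\<phi> ^^ m) z0)"
    by (simp add: Schwarz_Pick norm_iterate_less_1 assms z0)
  then show ?case using step.IH by (rule order_trans)
qed simp

lemma norm_disk_iterate_step: "(\<lambda>n. norm (disk_iterate n (\<phi> z0))) \<longlonglongrightarrow> L"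
  using step by (simp add: norm_disk_iterate norm_less_1 z0 funpow_swap1 pseudo_hyp_commute)

lemma mean_inner_disk_iterate:
  assumes "mean_inner \<phi>"
  shows "mean_inner (disk_iterate n)"
  by (rule mean_inner_pseudo_hyp[OF mean_inner_iterate[OF assms] _ _ holomorphic_disk_iterate norm_disk_iterate])
     (auto intro: norm_iterate_less_1 z0)

lemma norm_subsequence_limit_le:
  assumes "(\<lambda>k. disk_iterate (\<sigma> k) z) \<longlonglongrightarrow> l" "filterlim \<sigma> at_top sequentially" "norm z < 1"
  shows "norm l \<le> norm (disk_iterate n z)"
proof (rule tendsto_upperbound[OF tendsto_norm[OF assms(1)]])
  show "\<forall>\<^sub>F k in sequentially. norm (disk_iterate (\<sigma> k) z) \<le> norm (disk_iterate n z)"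
    using filterlim_at_top[THEN iffD1, OF assms(2), rule_format, of n]
    by eventually_elim (rule norm_disk_iterate_antimono[OF assms(3)])
qed simp

lemma norm_subsequence_limit_eq:
  assumes z: "norm z < 1" and \<sigma>: "filterlim \<sigma> at_top sequentially" "filterlim \<sigma>' at_top sequentially"
    and lim: "(\<lambda>k. disk_iterate (\<sigma> k) z) \<longlonglongrightarrow> l" "(\<lambda>k. disk_iterate (\<sigma>' k) z) \<longlonglongrightarrow> l'"
  shows "norm l = norm l'"
proof (rule antisym)
  show "norm l \<le> norm l'"
    by (rule tendsto_lowerbound[OF tendsto_norm[OF lim(2)]])
       (simp_all add: norm_subsequence_limit_le[OF lim(1) \<sigma>(1) z])
  show "norm l' \<le> norm l"
    by (rule tendsto_lowerbound[OF tendsto_norm[OF lim(1)]])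
       (simp_all add: norm_subsequence_limit_le[OF lim(2) \<sigma>(2) z])
qed

lemma subsequence_limits:
  obtains F F' \<sigma> where "F holomorphic_on ball 0 1" "F' holomorphic_on ball 0 1" "filterlim \<sigma> at_top sequentially"
    "\<And>z. norm z < 1 \<Longrightarrow> (\<lambda>k. disk_iterate (\<sigma> k) z) \<longlonglongrightarrow> F z"
    "\<And>z. norm z < 1 \<Longrightarrow> (\<lambda>k. disk_iterate (Suc (\<sigma> k)) z) \<longlonglongrightarrow> F' z"
proof -
  obtain F \<sigma>1 where F: "F holomorphic_on ball 0 1" "strict_mono \<sigma>1"
    "\<And>z. norm z < 1 \<Longrightarrow> (\<lambda>k. disk_iterate (\<sigma>1 k) z) \<longlonglongrightarrow> F z"
    by (rule Montel_disk_maps[of disk_iterate, OF holomorphic_disk_iterate norm_disk_iterate_less_1])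
       (assumption, rule that)
  obtain F' \<sigma>2 where F': "F' holomorphic_on ball 0 1" "strict_mono \<sigma>2"
    "\<And>z. norm z < 1 \<Longrightarrow> (\<lambda>k. disk_iterate (Suc (\<sigma>1 (\<sigma>2 k))) z) \<longlonglongrightarrow> F' z"
    by (rule Montel_disk_maps[of "\<lambda>k. disk_iterate (Suc (\<sigma>1 k))",
          OF holomorphic_disk_iterate norm_disk_iterate_less_1])
       (assumption, rule that)
  have "filterlim (\<lambda>k. \<sigma>1 (\<sigma>2 k)) at_top sequentially"
    using filterlim_subseq[OF strict_mono_o[OF F(2) F'(2)]] by (simp add: o_def)
  moreover have "(\<lambda>k. disk_iterate (\<sigma>1 (\<sigma>2 k)) z) \<longlonglongrightarrow> F z" if "norm z < 1" for z
    using LIMSEQ_subseq_LIMSEQ[OF F(3)[OF that] F'(2)] by (simp add: o_def)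
  ultimately show ?thesis using that[OF F(1) F'(1)] F'(3) by blast
qed

lemma subsequence_limit:
  assumes \<sigma>: "filterlim \<sigma> at_top sequentially"
    and F: "\<And>z. norm z < 1 \<Longrightarrow> (\<lambda>k. disk_iterate (\<sigma> k) z) \<longlonglongrightarrow> F z" "F holomorphic_on ball 0 1"
  shows "norm z < 1 \<Longrightarrow> norm (F z) < 1" "F z0 = 0" "F (\<phi> z0) \<noteq> 0" "mean_inner \<phi> \<Longrightarrow> mean_inner F"
proof -
  have norm_\<phi>_z0: "norm (\<phi> z0) < 1" by (rule norm_less_1[OF z0])
  have F_le: "norm (F z) \<le> norm (disk_iterate n z)" if "norm z < 1" for z n
    by (rule norm_subsequence_limit_le[OF F(1)[OF that] \<sigma> that])
  show "norm (F z) < 1" if "norm z < 1"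
    using F_le[OF that] norm_disk_iterate_less_1[OF that] by (rule le_less_trans)
  show "F z0 = 0"
    using F(1)[OF z0] by (simp add: disk_iterate_z0 LIMSEQ_const_iff)
  have "norm (F (\<phi> z0)) = L"
    using tendsto_norm[OF F(1)[OF norm_\<phi>_z0]] filterlim_compose[OF norm_disk_iterate_step \<sigma>]
    by (rule LIMSEQ_unique)
  then show F_\<phi>_z0: "F (\<phi> z0) \<noteq> 0" using L by auto
  show "mean_inner F" if "mean_inner \<phi>"
    by (rule mean_inner_limit[OF mean_inner_disk_iterate[OF that] F(2) F_le F(1)[OF norm_\<phi>_z0] norm_\<phi>_z0 F_\<phi>_z0])
qed

text \<open>Both limits of the subsequence have the same modulus, so they differ by a rotation \<open>\<beta>\<close>.\<close>
lemma limit_semiconjugacy: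
  assumes "mean_inner \<phi>"
  obtains F \<beta> where "mean_inner F" "\<And>z. norm z < 1 \<Longrightarrow> norm (F z) < 1" "F z0 = 0" "F (\<phi> z0) \<noteq> 0" "norm \<beta> = 1"
    "\<And>z. norm z < 1 \<Longrightarrow> Im (cayley_inv (F z)) \<le> Im (cayley_inv (F (\<phi> z)))"
    "\<And>z. norm z < 1 \<Longrightarrow> cayley_inv (F (\<phi> z))
      = of_real (Im (cayley_inv (F (\<phi> z0)))) * cayley_inv (\<beta> * F z) + of_real (Re (cayley_inv (F (\<phi> z0))))"
proof -
  obtain F F' \<sigma> where hol: "F holomorphic_on ball 0 1" "F' holomorphic_on ball 0 1"
    and \<sigma>: "filterlim \<sigma> at_top sequentially"
    and F: "\<And>z. norm z < 1 \<Longrightarrow> (\<lambda>k. disk_iterate (\<sigma> k) z) \<longlonglongrightarrow> F z"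
    and F': "\<And>z. norm z < 1 \<Longrightarrow> (\<lambda>k. disk_iterate (Suc (\<sigma> k)) z) \<longlonglongrightarrow> F' z"
    by (rule subsequence_limits) (rule that)
  have F_less: "norm (F z) < 1" if "norm z < 1" for z
    by (rule subsequence_limit(1)[OF \<sigma> F hol(1) that])
  have F_z0: "F z0 = 0" and F_\<phi>_z0: "F (\<phi> z0) \<noteq> 0" and inner: "mean_inner F"
    using subsequence_limit(2-4)[OF \<sigma> F hol(1)] assms by auto
  have norm_F': "norm (F' z) = norm (F z)" if "z \<in> ball 0 1" for z
    using that by (intro norm_subsequence_limit_eq[OF _ filterlim_compose[OF filterlim_Suc \<sigma>] \<sigma> F' F]) auto
  obtain \<beta> where \<beta>: "norm \<beta> = 1" and F'_eq: "\<And>z. z \<in> ball 0 1 \<Longrightarrow> F' z = \<beta> * F z"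
    using norm_eq_imp_rotation[OF hol(2,1) open_ball _ norm_F', of "\<phi> z0"] norm_less_1[OF z0] F_\<phi>_z0 by auto
  have g: "(\<lambda>k. half_plane_iterate (\<sigma> k) z) \<longlonglongrightarrow> cayley_inv (F z)" if z: "norm z < 1" for z
    using tendsto_cayley_inv[OF F[OF z] F_less[OF z]] by (simp add: cayley_inv_disk_iterate z)
  have g': "(\<lambda>k. half_plane_iterate (Suc (\<sigma> k)) z) \<longlonglongrightarrow> cayley_inv (\<beta> * F z)" if z: "norm z < 1" for z
    using tendsto_cayley_inv[OF F'[OF z]] F_less[OF z] F'_eq[of z] \<beta> z
    by (simp add: cayley_inv_disk_iterate norm_mult)
  show ?thesis
  proof (rule that[of F \<beta>])
    fix z :: complex assume z: "norm z < 1"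
    show "Im (cayley_inv (F z)) \<le> Im (cayley_inv (F (\<phi> z)))"
      using Im_half_plane_iterate_mono[OF z]
      by (intro LIMSEQ_le[OF tendsto_Im[OF g[OF z]] tendsto_Im[OF g[OF norm_less_1[OF z]]]]) auto
    show "cayley_inv (F (\<phi> z))
        = of_real (Im (cayley_inv (F (\<phi> z0)))) * cayley_inv (\<beta> * F z) + of_real (Re (cayley_inv (F (\<phi> z0))))"
    proof (rule LIMSEQ_unique[OF g[OF norm_less_1[OF z]]])
      show "(\<lambda>k. half_plane_iterate (\<sigma> k) (\<phi> z)) \<longlonglongrightarrow> of_real (Im (cayley_inv (F (\<phi> z0)))) * cayley_inv (\<beta> * F z)
          + of_real (Re (cayley_inv (F (\<phi> z0))))"
        unfolding half_plane_iterate_compose[of _ z] by (intro tendsto_intros g g' z norm_less_1 z0)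
    qed
  qed (use F_less in \<open>simp_all add: inner F_z0 F_\<phi>_z0 \<beta>\<close>)
qed

theorem translation_semiconjugacy:
  assumes "mean_inner \<phi>"
  obtains G b where "G holomorphic_on ball 0 1" "\<And>z. norm z < 1 \<Longrightarrow> 0 < Im (G z)" "b \<noteq> 0"
    "\<And>z. norm z < 1 \<Longrightarrow> G (\<phi> z) = G z + of_real b" "mean_inner (\<lambda>z. cayley (G z))"
proof -
  obtain F \<beta> where inner: "mean_inner F" and F_less: "\<And>z. norm z < 1 \<Longrightarrow> norm (F z) < 1"
    and F_z0: "F z0 = 0" and F_\<phi>_z0: "F (\<phi> z0) \<noteq> 0" and \<beta>: "norm \<beta> = 1"
    and mono: "\<And>z. norm z < 1 \<Longrightarrow> Im (cayley_inv (F z)) \<le> Im (cayley_inv (F (\<phi> z)))"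
    and affine: "\<And>z. norm z < 1 \<Longrightarrow> cayley_inv (F (\<phi> z))
      = of_real (Im (cayley_inv (F (\<phi> z0)))) * cayley_inv (\<beta> * F z) + of_real (Re (cayley_inv (F (\<phi> z0))))"
    by (rule limit_semiconjugacy[OF assms]) (rule that)
  define G where "G z = cayley_inv (F z)" for z
  define \<mu> where "\<mu> = Im (G (\<phi> z0))"
  define b where "b = Re (G (\<phi> z0))"
  have \<mu>1: "1 \<le> \<mu>" using mono[OF z0] by (simp add: \<mu>_def G_def F_z0 cayley_inv_def)
  have "\<beta> = 1"
  proof (rule rotation_eq_1_if_Im_le[OF inner F_less \<beta>])
    show "Im (cayley_inv (F z)) \<le> \<mu> * Im (cayley_inv (\<beta> * F z))" if "norm z < 1" for z
      using mono[OF that] affine[OF that] by (simp add: \<mu>_def G_def)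
  qed (use \<mu>1 in auto)
  then have G_\<phi>: "G (\<phi> z) = of_real \<mu> * G z + of_real b" if "norm z < 1" for z
    using affine[OF that] by (simp add: G_def \<mu>_def b_def)
  have G: "G holomorphic_on ball 0 1" "\<And>z. norm z < 1 \<Longrightarrow> 0 < Im (G z)"
    unfolding G_def using F_less mean_inner_holomorphic[OF inner]
    by (auto intro!: holomorphic_on_cayley_inv Im_cayley_inv_pos)
  have cayley_G: "cayley (G z) = F z" if "norm z < 1" for z
    unfolding G_def using F_less[OF that] by (intro cayley_cayley_inv) auto
  have "\<mu> = 1" by (rule multiplier_eq_1[OF G G_\<phi> \<mu>1])
  moreover have "b \<noteq> 0"
  proof
    assume "b = 0"
    then have "cayley (G (\<phi> z0)) = cayley (G z0)" using G_\<phi>[OF z0] \<open>\<mu> = 1\<close> by simp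
    then show False using F_z0 F_\<phi>_z0 cayley_G[OF z0] cayley_G[OF norm_less_1[OF z0]] by simp
  qed
  moreover have "mean_inner (\<lambda>z. cayley (G z))"
  proof (rule mean_inner_limit[where F="\<lambda>_. F" and w="\<phi> z0"])
    show "(\<lambda>z. cayley (G z)) holomorphic_on ball 0 1" using G by (intro holomorphic_on_cayley) auto
  qed (simp_all add: inner cayley_G norm_less_1 z0 F_\<phi>_z0)
  ultimately show ?thesis using that[of G b] G G_\<phi> by simp
qed

end

lemma exp_constant_imp_constant:
  assumes G: "G holomorphic_on S" and S: "open S" "connected S" and c: "c \<noteq> 0"
    and const: "\<And>z. z \<in> S \<Longrightarrow> exp (c * G z) = k"
  shows "G constant_on S"
proof -
  have "(G has_field_derivative 0) (at z)" if z: "z \<in> S" for z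
  proof -
    have G_deriv: "(G has_field_derivative deriv G z) (at z)" using G S(1) z by (rule holomorphic_derivI)
    then have "((\<lambda>z. exp (c * G z)) has_field_derivative exp (c * G z) * (c * deriv G z)) (at z)"
      by (intro derivative_eq_intros) auto
    moreover have "((\<lambda>z. exp (c * G z)) has_field_derivative 0) (at z)"
      by (rule has_field_derivative_transform_within_open[OF DERIV_const[of k] S(1) z]) (use const in auto)
    ultimately have "exp (c * G z) * (c * deriv G z) = 0" by (rule DERIV_unique)
    then show ?thesis using G_deriv c by simp
  qed
  then show ?thesis
    using has_field_derivative_0_imp_constant_on[of S G] S by simp
qed

lemma unimodular_eq_cis_positive_multiple:
  assumes "norm \<tau> = 1" "b \<noteq> 0"
  obtains c where "0 < c" "cis (c * b) = \<tau>"
proof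
  define c where "c = (Arg \<tau> + sgn b * (2 * pi)) / b"
  show "0 < c"
    using assms(2) mpi_less_Arg[of \<tau>] Arg_le_pi[of \<tau>] pi_gt_zero
    unfolding c_def by (cases "0 < b") (auto simp: divide_neg_neg)
  have "c * b = Arg \<tau> + sgn b * (2 * pi)" using assms(2) by (simp add: c_def)
  then have "cis (c * b) = cis (Arg \<tau>) * cis (sgn b * (2 * pi))" by (simp add: cis_mult)
  also have "cis (sgn b * (2 * pi)) = 1" using assms(2) by (cases "0 < b") (auto simp: complex_eq_iff)
  also have "cis (Arg \<tau>) * 1 = \<tau>" using assms(1) cis_Arg[of \<tau>] by (cases "\<tau> = 0") (auto simp: sgn_eq)
  finally show "cis (c * b) = \<tau>" .
qed

theorem theorem4p1:
  fixes \<phi> :: "complex \<Rightarrow> complex"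
  assumes "self_map_disk \<phi>" and "inner_function \<phi>"
    and "parabolic \<phi>" and "positive_hyperbolic_step \<phi>"
  shows "\<forall>\<tau>. norm \<tau> = 1 \<longrightarrow>
           (\<exists>u. inner_function u \<and> \<not> (\<exists>c. \<forall>z\<in>ball 0 1. u z = c) \<and>
                (\<forall>z\<in>ball 0 1. u (\<phi> z) = \<tau> * u z))"
proof (intro allI impI)
  fix \<tau> :: complex assume "norm \<tau> = 1"
  obtain w where "norm w = 1" "angular_derivative \<phi> w 1"
    using assms(3) by (auto simp: parabolic_def boundary_DW_point_def)
  moreover obtain z0 L where "norm z0 < 1" "0 < L" "(\<lambda>n. pseudo_hyp ((\<phi> ^^ n) z0) ((\<phi> ^^ Suc n) z0)) \<longlonglongrightarrow> L"
    using assms(4) by (auto simp: positive_hyperbolic_step_def)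
  ultimately interpret parabolic_positive_step \<phi> w z0 L
    using assms(1) by unfold_locales
  obtain G b where G: "G holomorphic_on ball 0 1" "\<And>z. norm z < 1 \<Longrightarrow> 0 < Im (G z)" and "b \<noteq> 0"
    and G_\<phi>: "\<And>z. norm z < 1 \<Longrightarrow> G (\<phi> z) = G z + of_real b" and inner: "mean_inner (\<lambda>z. cayley (G z))"
    by (rule translation_semiconjugacy[OF inner_function_imp_mean_inner[OF assms(2)]]) (rule that)
  obtain c where c: "0 < c" "cis (c * b) = \<tau>"
    by (rule unimodular_eq_cis_positive_multiple[OF \<open>norm \<tau> = 1\<close> \<open>b \<noteq> 0\<close>])
  define u where "u z = exp (\<i> * of_real c * G z)" for z
  have "inner_function u"
    unfolding u_def by (intro mean_inner_imp_inner_function mean_inner_exp G c(1) inner)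
  moreover have "\<not> (\<exists>k. \<forall>z\<in>ball 0 1. u z = k)"
    using exp_constant_imp_constant[OF G(1), of "\<i> * of_real c"] c(1) G_\<phi>[of 0] norm_less_1[of 0] \<open>b \<noteq> 0\<close>
    by (fastforce simp: u_def constant_on_def)
  moreover have "\<forall>z\<in>ball 0 1. u (\<phi> z) = \<tau> * u z"
    using c(2) by (auto simp: u_def G_\<phi> distrib_left exp_add cis_conv_exp mult_ac)
  ultimately show "\<exists>u. inner_function u \<and> \<not> (\<exists>c. \<forall>z\<in>ball 0 1. u z = c) \<and> (\<forall>z\<in>ball 0 1. u (\<phi> z) = \<tau> * u z)"
    by blast
qed

end
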